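(* For all $\varepsilon\in(0,1)$ there exists $\nu>0$ such that for any vector field $f=(f_1,f_2)\in\mathcal{B}_{0,4+\varepsilon}$ on $\mathbb{R}^2$ satisfying $$\|f;\mathcal{B}_{0,4+\varepsilon}\|\le\nu,\qquad \int_{\mathbb{R}^2}f=0,$$ and the symmetry conditions, for all $(x_1,x_2)\in\mathbb{R}^2$, $$f_1(x_1,x_2)=f_1(x_1,-x_2)=-f_1(-x_1,x_2),\qquad f_2(x_1,x_2)=-f_2(x_1,-x_2)=f_2(-x_1,x_2),$$ and $$f_1(x_1,x_2)=f_2(x_2,x_1)=-f_2(-x_2,-x_1),\qquad f_2(x_1,x_2)=f_1(x_2,x_1)=-f_1(-x_2,-x_1),$$ there exist $u$ and $p$ satisfying $$\Delta u-\nabla p-u\cdot\nabla u=f,\qquad \nabla\cdot u=0\quad\text{in }\mathbb{R}^2,\qquad \lim_{|x|\to\infty}u=0,$$ and moreover $u=O(|x|^{-2-\varepsilon})$ and $p=O(|x|^{-3-\varepsilon})$ as $|x|\to\infty$.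
   Context: For $q>0$ let $w_q(x)=1+|x|^q$. The space $\mathcal{B}_{0,q}$ consists of the (componentwise, vector valued) functions $g\in C^0(\mathbb{R}^2)$ with $w_qg\in L^\infty(\mathbb{R}^2)$, with norm $\|g;\mathcal{B}_{0,q}\|=\sup_xw_q(x)|g(x)|$. Since $f$ is only continuous, the equations are understood in the sense of distributions with $u\in C^1(\mathbb{R}^2)$ and $p\in C^0(\mathbb{R}^2)$. *)

theory Defs
  imports "HOL-Analysis.Analysis" "HOL-Library.Landau_Symbols"
begin

type_synonym plane = "real^2"

abbreviation pt :: "real \<Rightarrow> real \<Rightarrow> plane" where
  "pt x1 x2 \<equiv> vector [x1, x2]"


section \<open>Weighted spaces of continuous functions\<close>

(* At x = 0 the library convention 0 powr q = 0 gives the intended value 1. *)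
definition weight :: "real \<Rightarrow> plane \<Rightarrow> real" where
  "weight q x = 1 + norm x powr q"

(* The elements are continuous, so membership of the weighted function in L^infinity
   is the same as boundedness everywhere. *)
definition B0 :: "real \<Rightarrow> (plane \<Rightarrow> plane) set" where
  "B0 q = {g. continuous_on UNIV g \<and> bounded (range (\<lambda>x. weight q x *\<^sub>R g x))}"

(* Meaningful for elements of B0 q only, where the supremum is over a bounded set. *)
definition B0_norm :: "real \<Rightarrow> (plane \<Rightarrow> plane) \<Rightarrow> real" where
  "B0_norm q g = (SUP x. weight q x * norm (g x))"


section \<open>Distributions on the plane\<close>

(* Only used on functions that are differentiable at the point in question. *)
definition partial :: "2 \<Rightarrow> (plane \<Rightarrow> real) \<Rightarrow> plane \<Rightarrow> real" where
  "partial i g x = frechet_derivative g (at x) (axis i 1)"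

fun Ck :: "nat \<Rightarrow> (plane \<Rightarrow> real) \<Rightarrow> bool" where
  "Ck 0 g \<longleftrightarrow> continuous_on UNIV g"
| "Ck (Suc k) g \<longleftrightarrow> g differentiable_on UNIV \<and> (\<forall>i. Ck k (partial i g))"

definition test_function :: "(plane \<Rightarrow> real) \<Rightarrow> bool" where
  "test_function \<phi> \<longleftrightarrow> (\<forall>k. Ck k \<phi>) \<and> compact (closure {x. \<phi> x \<noteq> 0})"

(* Distributions are represented by functionals on all functions; only their values on
   test functions matter, so equations between them are asserted on test functions only. *)
type_synonym distribution = "(plane \<Rightarrow> real) \<Rightarrow> real"

definition dist_of :: "(plane \<Rightarrow> real) \<Rightarrow> distribution" where
  "dist_of g \<phi> = (\<integral>x. g x * \<phi> x \<partial>lborel)"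

definition dist_partial :: "2 \<Rightarrow> distribution \<Rightarrow> distribution" where
  "dist_partial i T \<phi> = - T (partial i \<phi>)"

definition dist_laplacian :: "distribution \<Rightarrow> distribution" where
  "dist_laplacian T \<phi> = (\<Sum>i\<in>UNIV. dist_partial i (dist_partial i T) \<phi>)"


section \<open>The stationary Navier--Stokes equations\<close>

(* The i-th component of u . grad u; classical derivatives suffice since u is C^1. *)
definition convection :: "(plane \<Rightarrow> plane) \<Rightarrow> 2 \<Rightarrow> plane \<Rightarrow> real" where
  "convection u i x = (\<Sum>j\<in>UNIV. u x $ j * partial j (\<lambda>y. u y $ i) x)"

definition navier_stokes_solution ::
  "(plane \<Rightarrow> plane) \<Rightarrow> (plane \<Rightarrow> plane) \<Rightarrow> (plane \<Rightarrow> real) \<Rightarrow> bool" where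
  "navier_stokes_solution f u p \<longleftrightarrow>
     (\<forall>i. Ck 1 (\<lambda>x. u x $ i)) \<and> continuous_on UNIV p \<and>
     (\<forall>\<phi>. test_function \<phi> \<longrightarrow>
        (\<forall>i. dist_laplacian (dist_of (\<lambda>x. u x $ i)) \<phi>
              - dist_partial i (dist_of p) \<phi>
              - dist_of (convection u i) \<phi>
            = dist_of (\<lambda>x. f x $ i) \<phi>) \<and>
        (\<Sum>i\<in>UNIV. dist_partial i (dist_of (\<lambda>x. u x $ i)) \<phi>) = 0)"

end

theory Submission
  imports Defs
begin

text \<open>
  Identify the plane with \<open>\<complex>\<close>, write the velocity as
  \<open>U = u1 + i u2\<close> and the force as a complex function, and let \<open>W = \<partial>U/\<partial>z\<close> and
  \<open>V = \<partial>U/\<partial>(cnj z)\<close>.  The symmetry conditions say that the force is equivariant under the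
  dihedral group of order eight generated by \<open>z \<mapsto> i z\<close> and \<open>z \<mapsto> cnj z\<close>.  The Stokes problem
  \<open>\<Delta>u - \<nabla>p = F\<close>, \<open>div u = 0\<close> has the explicit solution
  \<open>4 \<pi> U = log|.| * F - (z / cnj z) * cnj F / 2\<close>, whose derivatives \<open>W\<close>, \<open>V\<close> and whose pressure
  are convolutions of \<open>F\<close> and \<open>cnj F\<close> with the kernels \<open>1/z\<close>, \<open>1/cnj z\<close> and \<open>z/(cnj z)\<^sup>2\<close>, all of
  modulus \<open>1/|z|\<close>.

  If \<open>|F| \<le> A (1+|z|)\<^bsup>-q\<^esup>\<close> with \<open>4 < q < 5\<close>, the moments of \<open>F\<close> up to order two converge, and
  equivariance kills all of them that occur in the second order Taylor expansion of the
  kernels, except for a first order moment whose contributions to \<open>V\<close> cancel because it is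
  real.  The remainder of that expansion is bounded by \<open>7 |w|\<^sup>3 / (|z|\<^sup>3 |z-w|)\<close>
  (\<open>kernel_taylor\<close>), and integrating it against \<open>F\<close> gives \<open>O(|z|\<^bsup>1-q\<^esup>)\<close> for \<open>W\<close>, \<open>V\<close> and the
  pressure (\<open>conv_decay\<close>).  No expansion of the logarithm is needed for \<open>U\<close>: since
  \<open>U(i z) = i U(z)\<close>, the mean value inequality on the segment from \<open>z\<close> to \<open>i z\<close> bounds \<open>|U(z)|\<close> by
  a multiple of \<open>|z|\<close> times the size of the gradient at distance comparable to \<open>|z|\<close> from the origin
  (\<open>equivariant_decay\<close>), so \<open>U = O(|z|\<^bsup>2-q\<^esup>)\<close>.

  Consequently \<open>u \<sqdot> \<nabla>u = U W + cnj U V\<close> is \<open>O(|z|\<^bsup>3-2q\<^esup>)\<close>, better than the required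
  \<open>O(|z|\<^bsup>-q\<^esup>)\<close>, and is again equivariant.  With \<open>F\<close> as the unknown, the equation
  \<open>F = f + u[F] \<sqdot> \<nabla>u[F]\<close> is a quadratic perturbation of the identity in the weighted space of
  continuous equivariant functions, and for small \<open>f\<close> it is solved by the contraction principle
  (\<open>small_data_fixed_point\<close>).  With \<open>q = 4 + \<epsilon>\<close> the bounds above are the asserted decay.

  Two analytic facts link this to the definition of a solution.  As \<open>F\<close> is only continuous,
  \<open>U\<close> is shown to be \<open>C\<^sup>1\<close> by integrating the kernels along segments and exchanging the
  integrals (\<open>conv_has_derivative\<close>).  The weak equation follows from integration by parts
  and from the Cauchy--Pompeiu formula for test functions (\<open>cauchy_pompeiu\<close>, \<open>stokes_weak\<close>).
\<close>

section \<open>Invariance of Lebesgue measure under rotation, reflection and scaling\<close>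

text \<open>Lebesgue measure is determined by its values on boxes, so a map under which boxes pull back
  to boxes of the same volume preserves it.  This covers the rotation by a right angle and the
  conjugation.\<close>
lemma lborel_distr_box_map:
  fixes T :: "complex \<Rightarrow> complex"
  assumes box: "\<And>l u. T -` box l u = box (L l u) (R l u)"
    and vol: "\<And>l u. \<forall>b\<in>Basis. l \<bullet> b \<le> u \<bullet> b \<Longrightarrow>
      (\<Prod>b\<in>Basis. (R l u - L l u) \<bullet> b) = (\<Prod>b\<in>Basis. (u - l) \<bullet> b) \<and> (\<forall>b\<in>Basis. L l u \<bullet> b \<le> R l u \<bullet> b)"
    and T[measurable]: "T \<in> borel_measurable borel"
  shows "distr lborel borel T = lborel"
proof (rule lborel_eqI[symmetric])
  fix l u :: complex assume lu: "\<And>b. b \<in> Basis \<Longrightarrow> l \<bullet> b \<le> u \<bullet> b"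
  then have lu: "\<forall>b\<in>Basis. l \<bullet> b \<le> u \<bullet> b" by blast
  have "emeasure (distr lborel borel T) (box l u) = emeasure lborel (T -` box l u)"
    by (subst emeasure_distr) auto
  also have "\<dots> = emeasure lborel (box (L l u) (R l u))" by (simp add: box)
  also have "\<dots> = (\<Prod>b\<in>Basis. (R l u - L l u) \<bullet> b)"
    using vol[OF lu] by (subst emeasure_lborel_box) auto
  finally show "emeasure (distr lborel borel T) (box l u) = (\<Prod>b\<in>Basis. (u - l) \<bullet> b)"
    using vol[OF lu] by simp
qed simp

lemma lborel_distr_ii: "distr lborel borel ((*) \<i>) = (lborel :: complex measure)"
proof (rule lborel_distr_box_map[where
    L="\<lambda>l u. Complex (Im l) (- Re u)" and R="\<lambda>l u. Complex (Im u) (- Re l)"])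
  fix l u :: complex
  show "(*) \<i> -` box l u = box (Complex (Im l) (- Re u)) (Complex (Im u) (- Re l))"
    by (auto simp: box_def Basis_complex_def inner_complex_def)
qed (auto simp: Basis_complex_def inner_complex_def)

lemma lborel_distr_cnj: "distr lborel borel cnj = (lborel :: complex measure)"
proof (rule lborel_distr_box_map[where
    L="\<lambda>l u. Complex (Re l) (- Im u)" and R="\<lambda>l u. Complex (Re u) (- Im l)"])
  fix l u :: complex
  show "cnj -` box l u = box (Complex (Re l) (- Im u)) (Complex (Re u) (- Im l))"
    by (auto simp: box_def Basis_complex_def inner_complex_def)
qed (auto simp: Basis_complex_def inner_complex_def borel_measurable_continuous_onI continuous_on_cnj)

lemma lborel_distr_minus_left:
  fixes z :: "'a::euclidean_space"
  shows "distr lborel borel (\<lambda>w. z - w) = lborel"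
  by (subst (2) lborel_affine[of "-1" z]) (auto simp: density_1)

lemma lborel_distr_shift:
  fixes z :: "'a::euclidean_space"
  shows "distr lborel borel (\<lambda>w. w + z) = lborel"
proof -
  have "(\<lambda>w. w + z) = (+) z" by auto
  then show ?thesis using lborel_distr_plus[of z] by simp
qed

lemma lborel_integral_invariant:
  fixes g :: "'a::euclidean_space \<Rightarrow> 'b::{banach, second_countable_topology}"
  assumes "distr lborel borel T = lborel" and [measurable]: "(T :: 'c::euclidean_space \<Rightarrow> 'a) \<in> borel_measurable borel"
    and [measurable]: "g \<in> borel_measurable borel"
  shows "(LBINT w. g (T w)) = (LBINT w. g w)"
  by (subst assms(1)[symmetric]) (simp add: integral_distr)

lemma lborel_integrable_invariant:
  fixes g :: "'a::euclidean_space \<Rightarrow> 'b::{banach, second_countable_topology}"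
  assumes "distr lborel borel T = lborel" and [measurable]: "(T :: 'c::euclidean_space \<Rightarrow> 'a) \<in> borel_measurable borel"
    and [measurable]: "g \<in> borel_measurable borel"
  shows "integrable lborel (\<lambda>w. g (T w)) \<longleftrightarrow> integrable lborel g"
  by (subst assms(1)[symmetric]) (simp add: integrable_distr_eq)

lemma integral_lborel_ii:
  fixes g :: "complex \<Rightarrow> 'b::{banach, second_countable_topology}"
  assumes "g \<in> borel_measurable borel"
  shows "(LBINT w. g (\<i> * w)) = (LBINT w. g w)"
  by (rule lborel_integral_invariant[OF lborel_distr_ii _ assms]) simp

lemma measurable_cnj[measurable]: "cnj \<in> borel_measurable borel"
  by (intro borel_measurable_continuous_onI continuous_intros)

lemma integral_lborel_cnj:
  fixes g :: "complex \<Rightarrow> 'b::{banach, second_countable_topology}"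
  assumes "g \<in> borel_measurable borel"
  shows "(LBINT w. g (cnj w)) = (LBINT w. g w)"
  by (rule lborel_integral_invariant[OF lborel_distr_cnj _ assms]) simp

lemma integral_reflect_shift:
  fixes g :: "'a::euclidean_space \<Rightarrow> 'b::{banach, second_countable_topology}"
  assumes "g \<in> borel_measurable borel"
  shows "(LBINT w. g (z - w)) = (LBINT w. g w)"
  by (rule lborel_integral_invariant[OF lborel_distr_minus_left _ assms]) simp

lemma integrable_reflect_shift:
  fixes g :: "'a::euclidean_space \<Rightarrow> 'b::{banach, second_countable_topology}"
  assumes "g \<in> borel_measurable borel"
  shows "integrable lborel (\<lambda>w. g (z - w)) \<longleftrightarrow> integrable lborel g"
  by (rule lborel_integrable_invariant[OF lborel_distr_minus_left _ assms]) simp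

lemma integral_scale_complex:
  fixes g :: "complex \<Rightarrow> 'b::{banach, second_countable_topology}"
  assumes g[measurable]: "g \<in> borel_measurable borel" and c: "c > 0"
  shows "(LBINT w. g w) = c\<^sup>2 *\<^sub>R (LBINT w. g (t + c *\<^sub>R w))"
    and "integrable lborel (\<lambda>w. g (t + c *\<^sub>R w)) \<longleftrightarrow> integrable lborel g"
proof -
  have eq: "lborel = density (distr lborel borel (\<lambda>x. t + c *\<^sub>R x)) (\<lambda>_. ennreal (c\<^sup>2))"
    using lborel_affine[of c t] c by (simp add: power2_eq_square ennreal_mult)
  show "(LBINT w. g w) = c\<^sup>2 *\<^sub>R (LBINT w. g (t + c *\<^sub>R w))"
    by (subst eq, subst integral_density) (use c in \<open>auto simp: integral_distr\<close>)
  have *: "integrable lborel g \<longleftrightarrow> integrable lborel (\<lambda>w. c\<^sup>2 *\<^sub>R g (t + c *\<^sub>R w))"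
    by (subst eq, subst integrable_density) (use c in \<open>auto simp: integrable_distr_eq\<close>)
  show "integrable lborel (\<lambda>w. g (t + c *\<^sub>R w)) \<longleftrightarrow> integrable lborel g"
    unfolding * using c integrable_scaleR_right[of "inverse (c\<^sup>2)" lborel "\<lambda>w. c\<^sup>2 *\<^sub>R g (t + c *\<^sub>R w)"]
    by auto
qed

section \<open>Integrability of powers of the modulus in the plane\<close>

text \<open>The weight of order \<open>s\<close>, regular at the origin.\<close>
abbreviation wt :: "real \<Rightarrow> 'a::real_normed_vector \<Rightarrow> real" where
  "wt s w \<equiv> (1 + norm w) powr s"

text \<open>A substitute for polar coordinates: a function dominated near each point by one of the
  constants \<open>c n\<close> on a disc of radius \<open>r n\<close> is integrable if \<open>c n\<close> times the area of the disc is
  summable.  It is applied with dyadic radii.\<close>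
lemma integrable_ball_sum_bound:
  fixes f :: "complex \<Rightarrow> real" and c r :: "nat \<Rightarrow> real"
  assumes f[measurable]: "f \<in> borel_measurable borel"
    and c: "\<And>n. 0 \<le> c n" and r: "\<And>n. 0 \<le> r n" and s: "summable (\<lambda>n. c n * (r n)\<^sup>2)"
    and bnd: "\<And>w. f w \<noteq> 0 \<Longrightarrow> \<exists>n. norm w \<le> r n \<and> \<bar>f w\<bar> \<le> c n"
  shows "integrable lborel f"
proof (rule integrableI_bounded)
  have "(\<integral>\<^sup>+ w. ennreal (norm (f w)) \<partial>lborel)
      \<le> (\<integral>\<^sup>+ w. (\<Sum>n. ennreal (c n) * indicator (cball (0::complex) (r n)) w) \<partial>lborel)"
  proof (rule nn_integral_mono)
    fix w
    have single: "sum g {k} = g k" for g :: "nat \<Rightarrow> ennreal" and k by simp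
    show "ennreal (norm (f w)) \<le> (\<Sum>n. ennreal (c n) * indicator (cball (0::complex) (r n)) w)"
    proof (cases "f w = 0")
      case False
      then obtain n where n: "norm w \<le> r n" "\<bar>f w\<bar> \<le> c n" using bnd by blast
      have "ennreal (norm (f w)) \<le> ennreal (c n) * indicator (cball (0::complex) (r n)) w"
        using n by (auto simp: indicator_def intro: ennreal_leI)
      also have "\<dots> = sum (\<lambda>k. ennreal (c k) * indicator (cball 0 (r k)) w) {n}"
        by (subst single) (rule refl)
      also have "\<dots> \<le> (\<Sum>k. ennreal (c k) * indicator (cball 0 (r k)) w)"
        by (rule sum_le_suminf) auto
      finally show ?thesis .
    qed simp
  qed
  also have "\<dots> = (\<Sum>n. \<integral>\<^sup>+ w. ennreal (c n) * indicator (cball (0::complex) (r n)) w \<partial>lborel)"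
  proof (rule nn_integral_suminf)
    fix n
    have [measurable]: "cball (0::complex) (r n) \<in> sets borel" by simp
    show "(\<lambda>w. ennreal (c n) * indicator (cball (0::complex) (r n)) w) \<in> borel_measurable lborel"
      by measurable
  qed
  also have "\<dots> = (\<Sum>n. ennreal (pi * (c n * (r n)\<^sup>2)))"
  proof (rule suminf_cong)
    fix n
    have "(\<integral>\<^sup>+ w. ennreal (c n) * indicator (cball (0::complex) (r n)) w \<partial>lborel)
        = ennreal (c n) * emeasure lborel (cball (0::complex) (r n))"
      by (subst nn_integral_cmult_indicator) auto
    also have "emeasure lborel (cball (0::complex) (r n)) = ennreal (pi * (r n)\<^sup>2)"
      using r[of n] by (subst emeasure_cball)
        (auto simp: unit_ball_vol_2 numeral_2_eq_2[symmetric])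
    finally show "(\<integral>\<^sup>+ w. ennreal (c n) * indicator (cball (0::complex) (r n)) w \<partial>lborel)
        = ennreal (pi * (c n * (r n)\<^sup>2))"
      using c[of n] by (simp add: ennreal_mult[symmetric] mult_ac)
  qed
  also have "\<dots> = ennreal (\<Sum>n. pi * (c n * (r n)\<^sup>2))"
    by (rule suminf_ennreal2) (use c s in auto)
  also have "\<dots> < \<infinity>" by simp
  finally show "(\<integral>\<^sup>+ w. ennreal (norm (f w)) \<partial>lborel) < \<infinity>" .
qed simp

lemma integrable_decay_far:
  fixes a :: real
  assumes a: "2 < a"
  shows "integrable lborel (\<lambda>w::complex. wt (- a) w)"
proof (rule integrable_ball_sum_bound[where c="\<lambda>n. (2 ^ n) powr (- a)" and r="\<lambda>n. 2 ^ Suc n"])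
  have "(2 ^ n) powr (- a) * (2 ^ Suc n)\<^sup>2 = 4 * (2 powr (2 - a)) ^ n" for n
  proof -
    have "(2 ^ n) powr (- a) * (2 ^ Suc n)\<^sup>2 = 2 powr (- a * n) * (4 * 2 powr (2 * n))"
      by (simp add: powr_powr powr_realpow[symmetric] power2_eq_square powr_add[symmetric] mult_ac)
    also have "\<dots> = 4 * 2 powr ((2 - a) * n)"
      by (simp add: powr_add[symmetric] algebra_simps)
    also have "\<dots> = 4 * (2 powr (2 - a)) ^ n"
      by (simp add: powr_powr[symmetric] powr_realpow)
    finally show ?thesis .
  qed
  moreover have "summable (\<lambda>n. 4 * (2 powr (2 - a)) ^ n)"
  proof -
    have "(2::real) powr (2 - a) < 2 powr 0" using a by (intro powr_less_mono) auto
    then show ?thesis by (intro summable_mult summable_geometric) auto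
  qed
  ultimately show "summable (\<lambda>n. (2 ^ n) powr (- a) * (2 ^ Suc n :: real)\<^sup>2)" by (simp only:)
  fix w :: complex
  have "1 \<le> 1 + norm w" by simp
  define n where "n = nat \<lfloor>log 2 (1 + norm w)\<rfloor>"
  have l0: "0 \<le> log 2 (1 + norm w)" by (simp add: zero_le_log_cancel_iff add_pos_nonneg)
  have n1: "real n \<le> log 2 (1 + norm w)" unfolding n_def using l0 by linarith
  have n2: "log 2 (1 + norm w) \<le> real (Suc n)" unfolding n_def using l0 by linarith
  have m1: "2 ^ n \<le> 1 + norm w"
    using n1 by (subst (asm) le_log_iff) (auto simp: powr_realpow add_pos_nonneg)
  have m2: "1 + norm w \<le> 2 ^ Suc n"
    using n2 by (subst (asm) log_le_iff) (auto simp: powr_realpow add_pos_nonneg powr_add)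
  show "\<exists>n. norm w \<le> 2 ^ Suc n \<and> \<bar>(1 + norm w) powr - a\<bar> \<le> (2 ^ n) powr - a"
    using m1 m2 a by (intro exI[of _ n]) (auto intro!: powr_mono2')
qed auto

lemma integrable_singular_near:
  fixes a :: real
  assumes a: "0 \<le> a" "a < 2"
  shows "integrable lborel (\<lambda>w::complex. indicator (cball 0 1) w * norm w powr (- a))"
proof (rule integrable_ball_sum_bound[where c="\<lambda>n. (1 / 2 ^ Suc n) powr (- a)" and r="\<lambda>n. 1 / 2 ^ n"])
  have "(1 / 2 ^ Suc n) powr (- a) * (1 / 2 ^ n)\<^sup>2 = 2 powr a * (2 powr (a - 2)) ^ n" for n
  proof -
    have "(1 / 2 ^ Suc n :: real) = 2 powr (- real (Suc n))"
      by (simp add: powr_minus powr_realpow inverse_eq_divide del: of_nat_Suc power_Suc)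
    moreover have "(1 / 2 ^ n :: real)\<^sup>2 = 2 powr (- 2 * real n)"
      by (simp add: powr_minus powr_realpow[symmetric] powr_add[symmetric] power2_eq_square inverse_eq_divide)
    ultimately have "(1 / 2 ^ Suc n) powr (- a) * (1 / 2 ^ n)\<^sup>2 = 2 powr (a * Suc n - 2 * n)"
      by (simp add: powr_powr powr_add[symmetric] algebra_simps del: of_nat_Suc power_Suc)
    also have "\<dots> = 2 powr a * 2 powr ((a - 2) * n)"
      by (simp add: powr_add[symmetric] algebra_simps)
    also have "\<dots> = 2 powr a * (2 powr (a - 2)) ^ n"
      by (simp add: powr_powr[symmetric] powr_realpow)
    finally show ?thesis .
  qed
  moreover have "summable (\<lambda>n. 2 powr a * (2 powr (a - 2)) ^ n)"
  proof -
    have "(2::real) powr (a - 2) < 2 powr 0" using a by (intro powr_less_mono) auto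
    then show ?thesis by (intro summable_mult summable_geometric) auto
  qed
  ultimately show "summable (\<lambda>n. (1 / 2 ^ Suc n) powr (- a) * (1 / 2 ^ n :: real)\<^sup>2)" by (simp only:)
  show "(\<lambda>w::complex. indicator (cball 0 1) w * norm w powr (- a)) \<in> borel_measurable borel"
    by (intro borel_measurable_times borel_measurable_indicator powr_real_measurable) auto
  fix w :: complex
  assume "indicator (cball 0 1) w * norm w powr (- a) \<noteq> 0"
  then have w: "0 < norm w" "norm w \<le> 1" by (auto simp: indicator_def split: if_splits)
  define n where "n = nat \<lfloor>- log 2 (norm w)\<rfloor>"
  have l0: "0 \<le> - log 2 (norm w)" using w by simp
  have n1: "real n \<le> - log 2 (norm w)" unfolding n_def using l0 by linarith
  have n2: "- log 2 (norm w) \<le> real (Suc n)" unfolding n_def using l0 by linarith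
  have m1: "norm w \<le> 1 / 2 ^ n"
  proof -
    have "log 2 (norm w) \<le> - real n" using n1 by simp
    then have "norm w \<le> 2 powr (- real n)" using w by (subst (asm) log_le_iff) auto
    then show ?thesis by (simp add: powr_minus powr_realpow inverse_eq_divide)
  qed
  have m2: "1 / 2 ^ Suc n \<le> norm w"
  proof -
    have "- real (Suc n) \<le> log 2 (norm w)" using n2 by simp
    then have "2 powr (- real (Suc n)) \<le> norm w" using w by (subst (asm) le_log_iff) auto
    then show ?thesis by (simp add: powr_minus powr_realpow inverse_eq_divide del: of_nat_Suc power_Suc)
  qed
  show "\<exists>n. norm w \<le> 1 / 2 ^ n \<and> \<bar>indicator (cball 0 1) w * norm w powr - a\<bar> \<le> (1 / 2 ^ Suc n) powr - a"
    using m1 m2 a w by (intro exI[of _ n]) (auto intro!: powr_mono2' simp del: power_Suc simp: indicator_def)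
qed auto

lemma integrable_newton_near:
  fixes z :: complex
  shows "integrable lborel (\<lambda>w. indicator (cball 0 1) (z - w) * norm (z - w) powr (- 1) :: real)"
    and "(LBINT w. indicator (cball 0 1) (z - w) * norm (z - w) powr (- 1))
       = (LBINT w. indicator (cball 0 1) (w::complex) * norm w powr (- 1) :: real)"
proof -
  let ?g = "\<lambda>w::complex. indicator (cball 0 1) w * norm w powr (- 1) :: real"
  have m: "?g \<in> borel_measurable borel"
    by (intro borel_measurable_times borel_measurable_indicator powr_real_measurable) auto
  show "integrable lborel (\<lambda>w. ?g (z - w))"
    using integrable_reflect_shift[OF m, of z] integrable_singular_near[of 1] by simp
  show "(LBINT w. ?g (z - w)) = (LBINT w. ?g w)"
    by (rule integral_reflect_shift[OF m])
qed

text \<open>The potential of a decaying density with kernel \<open>1/|z|\<close> is bounded uniformly in the plane.\<close>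
lemma newton_potential_bounded:
  fixes q :: real
  assumes q: "2 < q"
  shows "\<exists>C\<ge>0. \<forall>z::complex. integrable lborel (\<lambda>w. wt (- q) w / norm (z - w)) \<and>
           (LBINT w. wt (- q) w / norm (z - w)) \<le> C"
proof -
  let ?g = "\<lambda>w::complex. indicator (cball 0 1) w * norm w powr (- 1) :: real"
  let ?f = "\<lambda>w::complex. wt (- q) w"
  let ?C = "(LBINT w. ?g w) + (LBINT w. ?f w)"
  have far: "integrable lborel ?f" by (rule integrable_decay_far[OF q])
  have "integrable lborel (\<lambda>w. ?f w / norm (z - w)) \<and> (LBINT w. ?f w / norm (z - w)) \<le> ?C" for z
  proof -
    have dom: "integrable lborel (\<lambda>w. ?g (z - w) + ?f w)"
      using integrable_newton_near(1) far by (rule Bochner_Integration.integrable_add)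
    have le: "?f w / norm (z - w) \<le> ?g (z - w) + ?f w" for w
    proof (cases "norm (z - w) \<le> 1")
      case True
      have "?f w \<le> 1" using powr_mono2'[of "-q" 1 "1 + norm w"] q by simp
      then have "?f w / norm (z - w) \<le> 1 / norm (z - w)" by (intro divide_right_mono) auto
      moreover have "norm (z - w) powr (- 1) = 1 / norm (z - w)"
        by (cases "z - w = 0") (auto simp: powr_minus_divide)
      ultimately show ?thesis using True by (simp add: add_increasing2)
    next
      case False
      then have "?f w / norm (z - w) \<le> ?f w / 1" by (intro divide_left_mono) auto
      then show ?thesis using False by simp
    qed
    have int: "integrable lborel (\<lambda>w. ?f w / norm (z - w))"
      by (rule Bochner_Integration.integrable_bound[OF dom]) (use le in \<open>auto intro!: order_trans[OF le]\<close>)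
    have "(LBINT w. ?f w / norm (z - w)) \<le> (LBINT w. ?g (z - w) + ?f w)"
      by (rule integral_mono[OF int dom le])
    also have "\<dots> = ?C"
      using integrable_newton_near far by (subst Bochner_Integration.integral_add) auto
    finally show ?thesis using int by simp
  qed
  moreover have "0 \<le> ?C" by (intro add_nonneg_nonneg Bochner_Integration.integral_nonneg) auto
  ultimately show ?thesis by blast
qed

text \<open>The integrand has its singularities at \<open>0\<close> and at \<open>e\<close>.  In the disc of radius \<open>1/2\<close> about one
  of these points the factor singular at the other one is bounded, and away from both points
  the integrand is at most a multiple of \<open>(1+|w|)\<^bsup>-1-s\<^esup>\<close>.\<close>
lemma riesz_newton_unit:
  fixes s :: real
  assumes s: "1 < s" "s < 2"
  shows "\<exists>C\<ge>0. \<forall>e::complex. norm e = 1 \<longrightarrow> integrable lborel (\<lambda>w. norm w powr (- s) / norm (e - w)) \<and>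
           (LBINT w. norm w powr (- s) / norm (e - w)) \<le> C"
proof -
  let ?g = "\<lambda>w::complex. indicator (cball 0 1) w * norm w powr (- 1) :: real"
  let ?h = "\<lambda>w::complex. indicator (cball 0 1) w * norm w powr (- s) :: real"
  let ?f = "\<lambda>w::complex. (1 + norm w) powr (- (1 + s))"
  let ?C = "2 * (LBINT w. ?h w) + 4 * (LBINT w. ?g w) + 45 * (LBINT w. ?f w)"
  have far: "integrable lborel ?f" by (rule integrable_decay_far) (use s in auto)
  have near: "integrable lborel ?h" by (rule integrable_singular_near) (use s in auto)
  have "integrable lborel (\<lambda>w. norm w powr (- s) / norm (e - w)) \<and>
      (LBINT w. norm w powr (- s) / norm (e - w)) \<le> ?C" if e: "norm e = 1" for e :: complex
  proof -
    have dom: "integrable lborel (\<lambda>w. 2 * ?h w + 4 * ?g (e - w) + 45 * ?f w)"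
      using integrable_newton_near(1)[of e] far near
      by (intro Bochner_Integration.integrable_add integrable_mult_right) auto
    have le: "norm w powr (- s) / norm (e - w) \<le> 2 * ?h w + 4 * ?g (e - w) + 45 * ?f w" for w
    proof -
      have nn: "0 \<le> ?h w" "0 \<le> ?g (e - w)" "0 \<le> ?f w" by auto
      have tri: "norm (e - w) \<ge> 1 - norm w" "norm (e - w) \<ge> norm w - 1"
        using e norm_triangle_ineq2[of e w] norm_triangle_ineq3[of e w] by auto
      have g: "norm (e - w) powr (- 1) = 1 / norm (e - w)"
        by (cases "e - w = 0") (auto simp: powr_minus_divide)
      show ?thesis
      proof (cases "norm w \<le> 1/2")
        case True
        then have "norm (e - w) \<ge> 1/2" using tri by simp
        then have "norm w powr (- s) / norm (e - w) \<le> norm w powr (- s) / (1/2)"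
          by (intro divide_left_mono) auto
        moreover have "?h w = norm w powr (- s)" using True by simp
        moreover have "x \<le> 2 * h + 4 * g + 45 * f"
          if "x \<le> y / (1/2)" "h = y" "0 \<le> g" "0 \<le> f" for x y h g f :: real
          using that by simp
        ultimately show ?thesis using nn by blast
      next
        case w: False
        show ?thesis
        proof (cases "norm (e - w) \<le> 1/2")
          case True
          have "norm w powr (- s) \<le> (1/2) powr (- s)" using w s by (intro powr_mono2') auto
          also have "\<dots> = 2 powr s" by (simp add: powr_minus powr_divide)
          also have "\<dots> \<le> 2 powr 2" using s by (intro powr_mono) auto
          finally have "norm w powr (- s) \<le> 4" by simp
          then have "norm w powr (- s) / norm (e - w) \<le> 4 / norm (e - w)"
            by (intro divide_right_mono) auto
          moreover have "?g (e - w) = 1 / norm (e - w)" using True g by simp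
          moreover have "x \<le> 2 * h + 4 * g + 45 * f"
            if "x \<le> 4 / y" "g = 1 / y" "0 \<le> h" "0 \<le> f" for x y h g f :: real
            using that by simp
          ultimately show ?thesis using nn by blast
        next
          case False
          \<comment> \<open>Away from both singularities \<open>|w|\<close> and \<open>|e - w|\<close> are comparable to \<open>1 + |w|\<close>.\<close>
          have "norm w powr (- s) \<le> ((1 + norm w) / 3) powr (- s)"
            using w s by (intro powr_mono2') (auto simp: add_pos_nonneg)
          also have "\<dots> = 3 powr s * wt (- s) w"
            by (simp add: powr_divide powr_minus field_simps)
          also have "\<dots> \<le> 3 powr 2 * wt (- s) w"
            using s by (intro mult_right_mono powr_mono) auto
          finally have a: "norm w powr (- s) \<le> 9 * wt (- s) w" by simp
          have "norm w \<le> 1 + norm (e - w)" using tri by simp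
          then have "(1 + norm w) / 5 \<le> norm (e - w)" using False by simp
          then have "norm w powr (- s) / norm (e - w) \<le> 9 * wt (- s) w / ((1 + norm w) / 5)"
            using a by (intro frac_le) (auto simp: add_pos_nonneg)
          also have "\<dots> = 45 * ?f w"
            by (simp add: powr_minus powr_add field_simps add_nonneg_eq_0_iff powr_diff add_pos_nonneg)
          finally show ?thesis using nn by linarith
        qed
      qed
    qed
    have int: "integrable lborel (\<lambda>w. norm w powr (- s) / norm (e - w))"
      by (rule Bochner_Integration.integrable_bound[OF dom]) (use le in \<open>auto intro!: order_trans[OF le]\<close>)
    have "(LBINT w. norm w powr (- s) / norm (e - w)) \<le> (LBINT w. 2 * ?h w + 4 * ?g (e - w) + 45 * ?f w)"
      by (rule integral_mono[OF int dom le])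
    also have "\<dots> = ?C"
    proof -
      have "(LBINT w. 2 * h w + 4 * g w + 45 * f w)
          = 2 * (LBINT w. h w) + 4 * (LBINT w. g w) + 45 * (LBINT w. f w)"
        if "integrable lborel h" "integrable lborel g" "integrable lborel f" for h g f :: "complex \<Rightarrow> real"
        using that by simp
      from this[OF near integrable_newton_near(1)[of e] far] show ?thesis
        by (simp only: integrable_newton_near(2))
    qed
    finally show ?thesis using int by simp
  qed
  moreover have "0 \<le> ?C" by (intro add_nonneg_nonneg mult_nonneg_nonneg Bochner_Integration.integral_nonneg) auto
  ultimately show ?thesis by blast
qed

text \<open>Scaling by \<open>|z|\<close> reduces the general case to the unit circle and produces the exact power
  \<open>|z|\<^bsup>1-s\<^esup>\<close> on which all decay rates below rest.\<close>
lemma riesz_newton_decay: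
  fixes s :: real
  assumes s: "1 < s" "s < 2"
  shows "\<exists>C\<ge>0. \<forall>z::complex. z \<noteq> 0 \<longrightarrow> integrable lborel (\<lambda>w. norm w powr (- s) / norm (z - w)) \<and>
           (LBINT w. norm w powr (- s) / norm (z - w)) \<le> C * norm z powr (1 - s)"
proof -
  obtain C where C: "C \<ge> 0" and bd: "\<And>e::complex. norm e = 1 \<Longrightarrow>
      integrable lborel (\<lambda>w. norm w powr (- s) / norm (e - w)) \<and>
      (LBINT w. norm w powr (- s) / norm (e - w)) \<le> C"
    using riesz_newton_unit[OF s] by blast
  have "integrable lborel (\<lambda>w. norm w powr (- s) / norm (z - w)) \<and>
      (LBINT w. norm w powr (- s) / norm (z - w)) \<le> C * norm z powr (1 - s)"
    if z: "z \<noteq> 0" for z :: complex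
  proof -
    define r where "r = norm z"
    have r: "r > 0" using z by (simp add: r_def)
    define e where "e = z /\<^sub>R r"
    have e: "norm e = 1" using r by (simp add: e_def r_def)
    have ze: "z = r *\<^sub>R e" using r by (simp add: e_def)
    let ?g = "\<lambda>w. norm w powr (- s) / norm (z - w)"
    have m[measurable]: "?g \<in> borel_measurable borel" by measurable
    have sc: "?g (0 + r *\<^sub>R w) = r powr (- s - 1) * (norm w powr (- s) / norm (e - w))" for w
    proof -
      have "norm (z - r *\<^sub>R w) = r * norm (e - w)"
        using r by (simp add: ze scaleR_diff_right[symmetric])
      then show ?thesis using r by (simp add: powr_mult powr_diff)
    qed
    have "integrable lborel (\<lambda>w. ?g (0 + r *\<^sub>R w))"
      unfolding sc using bd[OF e] by (intro integrable_mult_right) auto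
    then have int: "integrable lborel ?g" using integral_scale_complex(2)[OF m r, of 0] by simp
    have "(LBINT w. ?g w) = r\<^sup>2 *\<^sub>R (LBINT w. ?g (0 + r *\<^sub>R w))"
      by (rule integral_scale_complex(1)[OF m r])
    also have "\<dots> = r powr 2 * (r powr (- s - 1) * (LBINT w. norm w powr (- s) / norm (e - w)))"
      unfolding sc using r by (subst integral_mult_right_zero) (simp add: powr_numeral)
    also have "\<dots> \<le> r powr 2 * (r powr (- s - 1) * C)"
      using bd[OF e] by (intro mult_left_mono) auto
    also have "\<dots> = C * r powr (1 - s)" using r by (simp add: powr_add[symmetric] mult.assoc[symmetric] del: powr_numeral)
    finally show ?thesis using int by (simp add: r_def)
  qed
  then show ?thesis using C by blast
qed

section \<open>Convolution with kernels of Cauchy type\<close>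

text \<open>Kernels that are continuous off the origin and of modulus at most \<open>1/|y|\<close>.  Since \<open>1 / 0 = 0\<close>,
  such a kernel vanishes at the origin; this value never matters in an integral.\<close>
definition singular_kernel :: "(complex \<Rightarrow> complex) \<Rightarrow> bool" where
  "singular_kernel k \<longleftrightarrow> continuous_on (- {0}) k \<and> (\<forall>y. norm (k y) \<le> 1 / norm y)"

text \<open>Continuous functions of size \<open>A (1+|w|)\<^bsup>-q\<^esup>\<close>.  The weight \<open>(1+|w|)\<^sup>q\<close> is equivalent to
  \<open>1+|w|\<^sup>q\<close> and behaves well under translation (\<open>weight_shift\<close>).\<close>
definition decaying :: "real \<Rightarrow> real \<Rightarrow> (complex \<Rightarrow> complex) \<Rightarrow> bool" where
  "decaying q A F \<longleftrightarrow> continuous_on UNIV F \<and> (\<forall>w. norm (F w) \<le> A * wt (- q) w)"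

abbreviation cnj_fun :: "(complex \<Rightarrow> complex) \<Rightarrow> complex \<Rightarrow> complex" where
  "cnj_fun F \<equiv> \<lambda>w. cnj (F w)"

definition conv :: "(complex \<Rightarrow> complex) \<Rightarrow> (complex \<Rightarrow> complex) \<Rightarrow> complex \<Rightarrow> complex" where
  "conv k F z = (LBINT w. k (z - w) * F w)"

lemma singular_kernel_measurable[measurable_dest]:
  "singular_kernel k \<Longrightarrow> k \<in> borel_measurable borel"
  unfolding singular_kernel_def by (auto intro!: borel_measurable_continuous_countable_exceptions[of "{0}"])

lemma decaying_measurable[measurable_dest]: "decaying q A F \<Longrightarrow> F \<in> borel_measurable borel"
  unfolding decaying_def by (auto intro: borel_measurable_continuous_onI)

lemma decaying_nonneg: "decaying q A F \<Longrightarrow> 0 \<le> A"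
proof -
  assume "decaying q A F"
  then have "norm (F 0) \<le> A * wt (- q) (0::complex)" unfolding decaying_def by blast
  then have "norm (F 0) \<le> A" by simp
  then show "0 \<le> A" using norm_ge_zero order_trans by blast
qed

lemma decaying_norm: "decaying q A F \<Longrightarrow> norm (F w) \<le> A * wt (- q) w"
  unfolding decaying_def by blast

lemma decaying_cnj: "decaying q A F \<Longrightarrow> decaying q A (cnj_fun F)"
  unfolding decaying_def by (auto intro: continuous_intros)

lemma integrable_product_bound:
  assumes dom: "integrable lborel (\<lambda>w::complex. wt (- q) w * g w)"
    and F: "decaying q A F" and m: "(\<lambda>w. k w * F w) \<in> borel_measurable borel"
    and b: "\<And>w. norm (k w) \<le> g w"
  shows "integrable lborel (\<lambda>w. k w * F w)"
    and "(LBINT w. norm (k w * F w)) \<le> A * (LBINT w. wt (- q) w * g w)"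
proof -
  have A: "0 \<le> A" by (rule decaying_nonneg[OF F])
  have le: "norm (k w * F w) \<le> A * (wt (- q) w * g w)" for w
  proof -
    have "norm (k w * F w) = norm (k w) * norm (F w)" by (rule norm_mult)
    also have "\<dots> \<le> g w * (A * wt (- q) w)"
      using b[of w] decaying_norm[OF F, of w] order_trans[OF norm_ge_zero b[of w]]
      by (intro mult_mono) auto
    finally show ?thesis by (simp add: mult_ac)
  qed
  have dom': "integrable lborel (\<lambda>w::complex. A * (wt (- q) w * g w))"
    using dom by (intro integrable_mult_right) auto
  show int: "integrable lborel (\<lambda>w. k w * F w)"
    by (rule Bochner_Integration.integrable_bound[OF dom'])
      (use m in \<open>auto intro!: order_trans[OF le]\<close>)
  have "(LBINT w. norm (k w * F w)) \<le> (LBINT w. A * (wt (- q) w * g w))"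
    by (rule integral_mono[OF _ dom' le]) (use int in auto)
  also have "\<dots> = A * (LBINT w. wt (- q) w * g w)" by (rule integral_mult_right_zero)
  finally show "(LBINT w. norm (k w * F w)) \<le> A * (LBINT w. wt (- q) w * g w)" .
qed

lemma conv_integrable_bounded:
  assumes q: "2 < q"
  shows "\<exists>C\<ge>0. \<forall>k F A z. singular_kernel k \<longrightarrow> decaying q A F \<longrightarrow>
      integrable lborel (\<lambda>w. k (z - w) * F w) \<and> (LBINT w. norm (k (z - w) * F w)) \<le> C * A \<and> norm (conv k F z) \<le> C * A"
proof -
  obtain C where C: "C \<ge> 0" and bd: "\<And>z::complex.
      integrable lborel (\<lambda>w. wt (- q) w / norm (z - w)) \<and>
      (LBINT w. wt (- q) w / norm (z - w)) \<le> C"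
    using newton_potential_bounded[OF q] by blast
  have "integrable lborel (\<lambda>w. k (z - w) * F w) \<and> (LBINT w. norm (k (z - w) * F w)) \<le> C * A \<and> norm (conv k F z) \<le> C * A"
    if k: "singular_kernel k" and F: "decaying q A F" for k F A z
  proof -
    note [measurable] = singular_kernel_measurable[OF k] decaying_measurable[OF F]
    have A: "0 \<le> A" by (rule decaying_nonneg[OF F])
    have dom: "integrable lborel (\<lambda>w. wt (- q) w * (1 / norm (z - w)))"
      using bd[of z] by simp
    have b: "norm (k (z - w)) \<le> 1 / norm (z - w)" for w using k unfolding singular_kernel_def by blast
    have m: "(\<lambda>w. k (z - w) * F w) \<in> borel_measurable borel" by measurable
    note int = integrable_product_bound[OF dom F m b]
    have "A * (LBINT w. wt (- q) w * (1 / norm (z - w))) \<le> A * C"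
      using bd[of z] A by (intro mult_left_mono) auto
    with int(2) have le: "(LBINT w. norm (k (z - w) * F w)) \<le> C * A" by (simp add: mult.commute[of C])
    moreover have "norm (conv k F z) \<le> C * A"
      unfolding conv_def using integral_norm_bound le by (rule order_trans)
    ultimately show ?thesis using int(1) by blast
  qed
  then show ?thesis using C by blast
qed

lemma conv_integrable:
  assumes "2 < q" "singular_kernel k" "decaying q A F"
  shows "integrable lborel (\<lambda>w. k (z - w) * F w)"
  using conv_integrable_bounded[OF assms(1)] assms(2,3) by blast

text \<open>Decay at \<open>z - y\<close> can be traded for decay at \<open>y\<close>, locally uniformly in \<open>z\<close>.\<close>
lemma weight_shift:
  fixes z y :: complex
  assumes q: "0 \<le> q"
  shows "wt (- q) (z - y) \<le> wt q z * wt (- q) y"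
proof -
  have "1 + norm y \<le> 1 + norm z + norm (z - y)"
    using norm_triangle_ineq2[of y z] by (simp add: norm_minus_commute)
  also have "\<dots> \<le> (1 + norm z) * (1 + norm (z - y))" by (simp add: algebra_simps)
  finally have "wt q y \<le> ((1 + norm z) * (1 + norm (z - y))) powr q"
    using q by (intro powr_mono2) auto
  also have "\<dots> = wt q z * wt q (z - y)"
    by (simp add: powr_mult)
  finally have le: "wt q y \<le> wt q z * wt q (z - y)" .
  have p: "0 < wt q y" "0 < wt q (z - y)"
    by (auto simp: add_nonneg_eq_0_iff)
  show ?thesis using le p by (simp add: powr_minus field_simps)
qed

lemma conv_flip:
  assumes "singular_kernel k" "decaying q A F"
  shows "conv k F z = (LBINT y. k y * F (z - y))"
proof -
  note [measurable] = singular_kernel_measurable[OF assms(1)] decaying_measurable[OF assms(2)]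
  have "(LBINT w. (\<lambda>y. k y * F (z - y)) (z - w)) = (LBINT y. k y * F (z - y))"
    by (rule integral_reflect_shift) measurable
  then show ?thesis unfolding conv_def by simp
qed

lemma conv_continuous:
  assumes q: "2 < q" and k: "singular_kernel k" and F: "decaying q A F"
  shows "continuous_on UNIV (conv k F)"
proof -
  note [measurable] = singular_kernel_measurable[OF k] decaying_measurable[OF F]
  have A: "0 \<le> A" by (rule decaying_nonneg[OF F])
  have "isCont (conv k F) z" for z
    unfolding continuous_at_sequentially comp_def
  proof (intro allI impI)
    fix x :: "nat \<Rightarrow> complex" assume x: "x \<longlonglongrightarrow> z"
    then have "bounded (range x)" by (rule convergent_imp_bounded)
    then obtain R where R: "\<And>n. norm (x n) \<le> R" "0 < R" unfolding bounded_pos by auto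
    have cF: "isCont F y" for y using F unfolding decaying_def by (simp add: continuous_on_eq_continuous_at)
    let ?w = "\<lambda>y::complex. A * (1 + R) powr q * (wt (- q) y / norm y)"
    have "(\<lambda>n. LBINT y. k y * F (x n - y)) \<longlonglongrightarrow> (LBINT y. k y * F (z - y))"
    proof (rule integral_dominated_convergence[where w="?w"])
      show "integrable lborel ?w"
        using newton_potential_bounded[OF q] by (intro integrable_mult_right) (auto dest: spec[of _ 0])
      show "AE y in lborel. (\<lambda>n. k y * F (x n - y)) \<longlonglongrightarrow> k y * F (z - y)"
        by (intro AE_I2 tendsto_mult tendsto_const isCont_tendsto_compose[OF cF] tendsto_diff x)
      show "AE y in lborel. norm (k y * F (x n - y)) \<le> ?w y" for n
      proof (rule AE_I2)
        fix y :: complex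
        have "norm (F (x n - y)) \<le> A * wt (- q) (x n - y)" by (rule decaying_norm[OF F])
        also have "\<dots> \<le> A * (wt q (x n) * wt (- q) y)"
          using weight_shift[of q "x n" y] q A by (intro mult_left_mono) auto
        also have "\<dots> \<le> A * ((1 + R) powr q * wt (- q) y)"
          using R q A by (intro mult_left_mono mult_right_mono powr_mono2) auto
        finally have 1: "norm (F (x n - y)) \<le> A * ((1 + R) powr q * wt (- q) y)" .
        have "norm (k y) * norm (F (x n - y)) \<le> 1 / norm y * (A * ((1 + R) powr q * wt (- q) y))"
          using k 1 unfolding singular_kernel_def by (intro mult_mono) auto
        then show "norm (k y * F (x n - y)) \<le> ?w y" by (simp add: norm_mult mult_ac)
      qed
    qed measurable
    then show "(\<lambda>n. conv k F (x n)) \<longlonglongrightarrow> conv k F z"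
      unfolding conv_flip[OF k F] .
  qed
  then show ?thesis by (simp add: continuous_on_eq_continuous_at)
qed

lemma integrable_weight_moment:
  fixes m :: nat
  assumes q: "real m + 2 < q"
  shows "integrable lborel (\<lambda>w::complex. wt (- q) w * norm w ^ m)"
proof (rule Bochner_Integration.integrable_bound)
  show "integrable lborel (\<lambda>w::complex. (1 + norm w) powr (- (q - m)))"
    by (rule integrable_decay_far) (use q in simp)
  show "AE w::complex in lborel. norm (wt (- q) w * norm w ^ m) \<le> norm ((1 + norm w) powr (- (q - m)))"
  proof (rule AE_I2)
    fix w :: complex
    have "wt (- q) w * norm w ^ m \<le> wt (- q) w * (1 + norm w) ^ m"
      by (intro mult_left_mono power_mono) auto
    also have "\<dots> = wt (- q) w * (1 + norm w) powr m"
      by (subst powr_realpow) (auto simp: add_pos_nonneg)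
    also have "\<dots> = (1 + norm w) powr (- (q - m))" by (simp add: powr_add[symmetric])
    finally show "norm (wt (- q) w * norm w ^ m) \<le> norm ((1 + norm w) powr (- (q - m)))"
      by simp
  qed
qed auto

section \<open>Derivatives of convolutions\<close>

text \<open>The bound on the kernel allows both the logarithm and kernels of modulus one.\<close>
lemma log_kernel_integrable:
  assumes q: "3 < q" and F: "decaying q A F" and K: "K \<in> borel_measurable borel"
    and b: "\<And>y. norm (K y) \<le> norm y + 1 / norm y"
  shows "integrable lborel (\<lambda>w. K (z - w) * F w)"
proof -
  note [measurable] = K decaying_measurable[OF F]
  have dom: "integrable lborel (\<lambda>w. wt (- q) w * (norm z + norm w ^ 1 + 1 / norm (z - w)))"
  proof -
    have "integrable lborel (\<lambda>w. norm z * wt (- q) w + wt (- q) w * norm w ^ 1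
        + wt (- q) w / norm (z - w))"
      using integrable_decay_far[of q] integrable_weight_moment[of 1 q] newton_potential_bounded[of q] q
      by (intro Bochner_Integration.integrable_add integrable_mult_right) auto
    then show ?thesis by (simp add: algebra_simps)
  qed
  show ?thesis
  proof (rule integrable_product_bound(1)[OF dom F])
    show "norm (K (z - w)) \<le> norm z + norm w ^ 1 + 1 / norm (z - w)" for w
      using b[of "z - w"] norm_triangle_ineq4[of z w] by simp
  qed measurable
qed

text \<open>Throughout, the pair \<open>(a, b)\<close> in a derivative \<open>h \<mapsto> a h + b cnj h\<close> consists of the two
  Wirtinger derivatives \<open>\<partial>/\<partial>z\<close> and \<open>\<partial>/\<partial>(cnj z)\<close>.\<close>
lemma kernel_line_integral:
  assumes K: "\<And>y. y \<noteq> 0 \<Longrightarrow> (K has_derivative (\<lambda>h. a y * h + b y * cnj h)) (at y)"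
    and a: "singular_kernel a" and b: "singular_kernel b"
    and w: "w \<notin> closed_segment z (z + h)"
  shows "(LBINT t. indicator {0..1::real} t *\<^sub>R (a (z + t *\<^sub>R h - w) * h + b (z + t *\<^sub>R h - w) * cnj h))
       = K (z + h - w) - K (z - w)"
proof -
  have ne: "z + t *\<^sub>R h - w \<noteq> 0" if "t \<in> {0..1}" for t
  proof
    assume "z + t *\<^sub>R h - w = 0"
    then have "w = (1 - t) *\<^sub>R z + t *\<^sub>R (z + h)" by (simp add: algebra_simps)
    then show False using w that unfolding closed_segment_def by auto
  qed
  have "(LBINT t. indicator {0..1} t *\<^sub>R (a (z + t *\<^sub>R h - w) * h + b (z + t *\<^sub>R h - w) * cnj h))
      = K (z + 1 *\<^sub>R h - w) - K (z + 0 *\<^sub>R h - w)"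
  proof (rule integral_FTC_Icc)
    fix t :: real assume t: "0 \<le> t" "t \<le> 1"
    have "((\<lambda>t. z + t *\<^sub>R h - w) has_derivative (\<lambda>s. s *\<^sub>R h)) (at t within {0..1})"
      by (auto intro!: derivative_eq_intros)
    from has_derivative_compose[OF this K[OF ne]] t
    have "((\<lambda>t. K (z + t *\<^sub>R h - w)) has_derivative
        (\<lambda>s. a (z + t *\<^sub>R h - w) * (s *\<^sub>R h) + b (z + t *\<^sub>R h - w) * cnj (s *\<^sub>R h))) (at t within {0..1})"
      by simp
    then show "((\<lambda>t. K (z + t *\<^sub>R h - w)) has_vector_derivative
        (a (z + t *\<^sub>R h - w) * h + b (z + t *\<^sub>R h - w) * cnj h)) (at t within {0..1})"
      unfolding has_vector_derivative_def by (simp add: scaleR_add_right)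
  next
    have "continuous_on {0..1} (\<lambda>t. k (z + t *\<^sub>R h - w))" if k: "singular_kernel k" for k
    proof (rule continuous_on_compose2[of "- {0}" k "{0..1}" "\<lambda>t. z + t *\<^sub>R h - w"])
      show "continuous_on (- {0}) k" using k unfolding singular_kernel_def by blast
      show "continuous_on {0..1} (\<lambda>t. z + t *\<^sub>R h - w)" by (intro continuous_intros)
      show "(\<lambda>t. z + t *\<^sub>R h - w) ` {0..1} \<subseteq> - {0}"
      proof (rule image_subsetI)
        show "z + t *\<^sub>R h - w \<in> - {0}" if "t \<in> {0..1}" for t
          using ne[OF that] by simp
      qed
    qed
    from this[OF a] this[OF b]
    show "continuous_on {0..1} (\<lambda>t. a (z + t *\<^sub>R h - w) * h + b (z + t *\<^sub>R h - w) * cnj h)"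
      by (intro continuous_on_add continuous_on_mult continuous_on_const)
  qed simp
  then show ?thesis by simp
qed

lemma closed_segment_null:
  fixes a b :: "'a::euclidean_space"
  assumes "2 \<le> DIM('a)"
  shows "closed_segment a b \<in> null_sets lborel"
proof -
  have "negligible (closed_segment a b)"
    using interior_closed_segment_ge2[OF assms, of a b] negligible_convex_interior[OF convex_closed_segment]
    by blast
  then have "closed_segment a b \<in> null_sets lebesgue" by (simp add: negligible_iff_null_sets)
  moreover have "closed_segment a b \<in> sets borel" using compact_segment by (intro borel_compact) auto
  ultimately show ?thesis by (auto simp: null_sets_def)
qed

text \<open>The fundamental theorem of calculus passes from the kernel to the convolution, because for
  fixed endpoints it fails for the kernel only when \<open>w\<close> lies on the segment, a null set.\<close>
lemma conv_line_integral:
  assumes K: "\<And>y. y \<noteq> 0 \<Longrightarrow> (K has_derivative (\<lambda>h. a y * h + b y * cnj h)) (at y)"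
    and a: "singular_kernel a" and b: "singular_kernel b"
    and Km: "K \<in> borel_measurable borel" and Kb: "\<And>y. norm (K y) \<le> norm y + 1 / norm y"
    and q: "3 < q" and F: "decaying q A F"
  shows "(LBINT t. indicator {0..1::real} t *\<^sub>R (conv a F (z + t *\<^sub>R h) * h + conv b F (z + t *\<^sub>R h) * cnj h))
       = conv K F (z + h) - conv K F z"
proof -
  note [measurable] = singular_kernel_measurable[OF a] singular_kernel_measurable[OF b] decaying_measurable[OF F] Km
  have q2: "2 < q" using q by simp
  obtain C where C: "C \<ge> 0" and bd: "\<And>k z. singular_kernel k \<Longrightarrow>
      integrable lborel (\<lambda>w. k (z - w) * F w) \<and> (LBINT w. norm (k (z - w) * F w)) \<le> C * A"
    using conv_integrable_bounded[OF q2] F by blast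
  define D where "D t w = indicator {0..1::real} t *\<^sub>R ((a (z + t *\<^sub>R h - w) * h + b (z + t *\<^sub>R h - w) * cnj h) * F w)"
    for t :: real and w
  have D_eq: "D t w = indicator {0..1::real} t *\<^sub>R
      (h * (a (z + t *\<^sub>R h - w) * F w) + cnj h * (b (z + t *\<^sub>R h - w) * F w))" for t w
    by (simp add: D_def algebra_simps)
  have Dint: "integrable lborel (\<lambda>w. D t w)" for t
    unfolding D_eq using bd[OF a] bd[OF b]
    by (intro integrable_scaleR_right Bochner_Integration.integrable_add integrable_mult_right) auto
  have Dval: "(LBINT w. D t w)
      = indicator {0..1::real} t *\<^sub>R (conv a F (z + t *\<^sub>R h) * h + conv b F (z + t *\<^sub>R h) * cnj h)" for t
    unfolding D_eq conv_def using bd[OF a] bd[OF b]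
    by (simp add: mult.commute[of _ h] mult.commute[of _ "cnj h"])
  have Dm[measurable]: "case_prod D \<in> borel_measurable (lborel \<Otimes>\<^sub>M lborel)"
    unfolding D_def split_beta' by measurable
  have Dnorm: "(LBINT w. norm (D t w)) \<le> indicator {0..1} t * (2 * norm h * (C * A))" for t
  proof (cases "t \<in> {0..1}")
    case True
    have "(LBINT w. norm (D t w)) \<le> (LBINT w. norm h * norm (a (z + t *\<^sub>R h - w) * F w)
        + norm h * norm (b (z + t *\<^sub>R h - w) * F w))"
    proof (rule integral_mono)
      show "integrable lborel (\<lambda>w. norm (D t w))" using Dint by auto
      show "integrable lborel (\<lambda>w. norm h * norm (a (z + t *\<^sub>R h - w) * F w)
        + norm h * norm (b (z + t *\<^sub>R h - w) * F w))"
        using bd[OF a] bd[OF b]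
        by (intro Bochner_Integration.integrable_add integrable_mult_right integrable_norm) auto
      show "norm (D t w) \<le> norm h * norm (a (z + t *\<^sub>R h - w) * F w)
        + norm h * norm (b (z + t *\<^sub>R h - w) * F w)" for w
        using True norm_triangle_ineq[of "h * (a (z + t *\<^sub>R h - w) * F w)" "cnj h * (b (z + t *\<^sub>R h - w) * F w)"]
        unfolding D_eq by (simp add: norm_mult)
    qed
    also have "\<dots> = norm h * (LBINT w. norm (a (z + t *\<^sub>R h - w) * F w))
        + norm h * (LBINT w. norm (b (z + t *\<^sub>R h - w) * F w))"
      using bd[OF a] bd[OF b] by (subst Bochner_Integration.integral_add) (auto intro!: integrable_mult_right)
    also have "\<dots> \<le> norm h * (C * A) + norm h * (C * A)"
      using bd[OF a] bd[OF b] by (intro add_mono mult_left_mono) auto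
    finally show ?thesis using True by (simp add: mult_ac)
  qed (simp add: D_def)
  \<comment> \<open>The inner integral of the modulus is bounded uniformly in \<open>t\<close>, although the kernel is singular.\<close>
  have Dpair: "integrable (lborel \<Otimes>\<^sub>M lborel) (case_prod D)"
  proof (rule lborel_pair.Fubini_integrable)
    show "integrable lborel (\<lambda>t. LBINT w. norm (case (t, w) of (x, y) \<Rightarrow> D x y))"
    proof (rule Bochner_Integration.integrable_bound)
      show "integrable lborel (\<lambda>t. indicator {0..1::real} t * (2 * norm h * (C * A)))"
        by (intro integrable_mult_left integrable_real_indicator) auto
      show "AE t in lborel. norm (LBINT w. norm (case (t, w) of (x, y) \<Rightarrow> D x y))
          \<le> norm (indicator {0..1} t * (2 * norm h * (C * A)))"
        using Dnorm by (auto intro!: AE_I2 order_trans[OF Dnorm] simp: abs_of_nonneg Bochner_Integration.integral_nonneg)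
    qed measurable
    show "AE t in lborel. integrable lborel (\<lambda>w. case (t, w) of (x, y) \<Rightarrow> D x y)" using Dint by simp
  qed measurable
  have Kint: "integrable lborel (\<lambda>w. K (x - w) * F w)" for x
    by (rule log_kernel_integrable[OF q F Km Kb])
  have "(LBINT t. indicator {0..1::real} t *\<^sub>R (conv a F (z + t *\<^sub>R h) * h + conv b F (z + t *\<^sub>R h) * cnj h))
      = (LBINT t. (LBINT w. D t w))"
    unfolding Dval ..
  also have "\<dots> = (LBINT w. (LBINT t. D t w))"
    by (rule lborel_pair.Fubini_integral[OF Dpair, symmetric])
  also have "\<dots> = (LBINT w. (K (z + h - w) - K (z - w)) * F w)"
  proof (rule integral_cong_AE)
    show "(\<lambda>w. LBINT t. D t w) \<in> borel_measurable lborel"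
      using lborel_pair.integrable_snd[OF Dpair] by auto
    show "(\<lambda>w. (K (z + h - w) - K (z - w)) * F w) \<in> borel_measurable lborel" by measurable
    have "AE w in lborel. w \<notin> closed_segment z (z + h)"
      by (rule AE_not_in[OF closed_segment_null]) simp
    then show "AE w in lborel. (LBINT t. D t w) = (K (z + h - w) - K (z - w)) * F w"
    proof eventually_elim
      case (elim w)
      have "(LBINT t. D t w) = (LBINT t. (indicator {0..1::real} t *\<^sub>R
          (a (z + t *\<^sub>R h - w) * h + b (z + t *\<^sub>R h - w) * cnj h)) * F w)"
        unfolding D_def by simp
      also have "\<dots> = (LBINT t. (indicator {0..1::real} t *\<^sub>R
          (a (z + t *\<^sub>R h - w) * h + b (z + t *\<^sub>R h - w) * cnj h))) * F w"
        by (rule integral_mult_left_zero)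
      also have "(LBINT t. (indicator {0..1::real} t *\<^sub>R
          (a (z + t *\<^sub>R h - w) * h + b (z + t *\<^sub>R h - w) * cnj h))) = K (z + h - w) - K (z - w)"
        by (rule kernel_line_integral[OF _ a b elim]) (rule K)
      finally show ?case .
    qed
  qed
  also have "\<dots> = (LBINT w. K (z + h - w) * F w - K (z - w) * F w)"
    by (simp add: left_diff_distrib)
  also have "\<dots> = conv K F (z + h) - conv K F z"
    unfolding conv_def by (rule Bochner_Integration.integral_diff) (rule Kint)+
  finally show ?thesis .
qed

text \<open>The density \<open>F\<close> need not be differentiable: the derivative falls on the kernel, and
  differentiability follows from the preceding integral formula and the continuity of the
  convolutions with \<open>a\<close> and \<open>b\<close>.\<close>
lemma conv_has_derivative:
  assumes K: "\<And>y. y \<noteq> 0 \<Longrightarrow> (K has_derivative (\<lambda>h. a y * h + b y * cnj h)) (at y)"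
    and a: "singular_kernel a" and b: "singular_kernel b"
    and Km: "K \<in> borel_measurable borel" and Kb: "\<And>y. norm (K y) \<le> norm y + 1 / norm y"
    and q: "3 < q" and F: "decaying q A F"
  shows "(conv K F has_derivative (\<lambda>h. conv a F z * h + conv b F z * cnj h)) (at z)"
  unfolding has_derivative_at_alt
proof (intro conjI allI impI)
  show "bounded_linear (\<lambda>h. conv a F z * h + conv b F z * cnj h)"
    by (intro bounded_linear_add bounded_linear_mult_right
        bounded_linear_compose[OF bounded_linear_mult_right bounded_linear_cnj])
  fix e :: real assume e: "0 < e"
  have q2: "2 < q" using q by simp
  have ca: "continuous_on UNIV (conv a F)" and cb: "continuous_on UNIV (conv b F)"
    using conv_continuous[OF q2 a F] conv_continuous[OF q2 b F] by auto
  have "isCont (conv a F) z" "isCont (conv b F) z"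
    using ca cb by (auto simp: continuous_on_eq_continuous_at)
  then obtain d1 d2 where d: "d1 > 0" "d2 > 0"
      "\<And>y. dist y z < d1 \<Longrightarrow> dist (conv a F y) (conv a F z) < e / 2"
      "\<And>y. dist y z < d2 \<Longrightarrow> dist (conv b F y) (conv b F z) < e / 2"
    using e unfolding continuous_at_eps_delta by (metis half_gt_zero)
  show "\<exists>d>0. \<forall>y. norm (y - z) < d \<longrightarrow>
      norm (conv K F y - conv K F z - (conv a F z * (y - z) + conv b F z * cnj (y - z))) \<le> e * norm (y - z)"
  proof (intro exI[of _ "min d1 d2"] conjI allI impI)
    fix y assume y: "norm (y - z) < min d1 d2"
    define h where "h = y - z"
    define G where "G x = conv a F x * h + conv b F x * cnj h" for x
    have cG: "continuous_on UNIV G" unfolding G_def by (intro continuous_intros ca cb)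
    have int: "integrable lborel (\<lambda>t. indicator {0..1::real} t *\<^sub>R G (z + t *\<^sub>R h))"
      by (rule borel_integrable_compact)
        (auto intro!: continuous_intros continuous_on_compose2[OF cG])
    have "conv K F y - conv K F z = (LBINT t. indicator {0..1::real} t *\<^sub>R G (z + t *\<^sub>R h))"
      unfolding G_def using conv_line_integral[OF K a b Km Kb q F, of z h] by (simp add: h_def)
    moreover have "G z = (LBINT t. indicator {0..1::real} t *\<^sub>R G z)" by simp
    ultimately have "conv K F y - conv K F z - G z
        = (LBINT t. indicator {0..1::real} t *\<^sub>R G (z + t *\<^sub>R h)) - (LBINT t. indicator {0..1::real} t *\<^sub>R G z)"
      by simp
    also have "\<dots> = (LBINT t. indicator {0..1::real} t *\<^sub>R G (z + t *\<^sub>R h) - indicator {0..1::real} t *\<^sub>R G z)"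
      by (rule Bochner_Integration.integral_diff[symmetric, OF int]) simp
    finally have eq: "conv K F y - conv K F z - G z
        = (LBINT t. indicator {0..1::real} t *\<^sub>R (G (z + t *\<^sub>R h) - G z))"
      by (simp only: scaleR_diff_right)
    have "norm (LBINT t. indicator {0..1::real} t *\<^sub>R (G (z + t *\<^sub>R h) - G z))
        \<le> (LBINT t. indicator {0..1::real} t * (e * norm h))"
    proof (rule Bochner_Integration.integral_norm_bound_integral)
      show "integrable lborel (\<lambda>t. indicator {0..1::real} t *\<^sub>R (G (z + t *\<^sub>R h) - G z))"
        unfolding scaleR_diff_right by (intro Bochner_Integration.integrable_diff int) simp
      show "norm (indicator {0..1} t *\<^sub>R (G (z + t *\<^sub>R h) - G z)) \<le> indicator {0..1} t * (e * norm h)" for t :: real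
      proof (cases "t \<in> {0..1}")
        case True
        have "dist (z + t *\<^sub>R h) z \<le> norm h" using True by (simp add: dist_norm mult_left_le_one_le)
        then have "dist (z + t *\<^sub>R h) z < d1" "dist (z + t *\<^sub>R h) z < d2" using y h_def by auto
        then have ab: "norm (conv a F (z + t *\<^sub>R h) - conv a F z) \<le> e / 2"
          "norm (conv b F (z + t *\<^sub>R h) - conv b F z) \<le> e / 2"
          using d(3,4) by (auto simp: dist_norm intro: less_imp_le)
        have "G (z + t *\<^sub>R h) - G z = (conv a F (z + t *\<^sub>R h) - conv a F z) * h
            + (conv b F (z + t *\<^sub>R h) - conv b F z) * cnj h" by (simp add: G_def algebra_simps)
        also have "norm \<dots> \<le> e / 2 * norm h + e / 2 * norm h"
          by (rule norm_triangle_mono; unfold norm_mult complex_mod_cnj)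
            (intro mult_right_mono ab norm_ge_zero)+
        finally show ?thesis using True by simp
      qed simp
    qed simp
    then show "norm (conv K F y - conv K F z - (conv a F z * (y - z) + conv b F z * cnj (y - z))) \<le> e * norm (y - z)"
      using eq by (simp add: G_def h_def)
  qed (use d in auto)
qed

section \<open>Integration by parts and the Cauchy--Pompeiu formula\<close>

lemma integrable_continuous_compact_support:
  fixes f :: "'a::euclidean_space \<Rightarrow> 'b::{banach, second_countable_topology}"
  assumes f: "continuous_on UNIV f" and z: "\<And>x. R < norm x \<Longrightarrow> f x = 0"
  shows "integrable lborel f"
proof -
  have "integrable lborel (\<lambda>x. indicator (cball 0 R) x *\<^sub>R f x)"
    by (rule borel_integrable_compact) (auto intro: continuous_on_subset[OF f])
  moreover have "(\<lambda>x. indicator (cball 0 R) x *\<^sub>R f x) = f"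
    using z by (auto simp: fun_eq_iff indicator_def)
  ultimately show ?thesis by simp
qed

lemma derivative_zero_outside:
  fixes g :: "'a::real_normed_vector \<Rightarrow> 'b::real_normed_vector"
  assumes g: "(g has_derivative g') (at x)" and z: "\<And>x. R < norm x \<Longrightarrow> g x = 0" and x: "R < norm x"
  shows "g' = (\<lambda>_. 0)"
proof (rule has_derivative_unique[OF g])
  have "open {x::'a. R < norm x}" by (intro open_Collect_less continuous_intros)
  then show "(g has_derivative (\<lambda>_. 0)) (at x)"
    by (rule has_derivative_transform_within_open[OF has_derivative_const]) (use z x in auto)
qed

text \<open>Averaging \<open>g (x + v) - g x\<close> over the whole space gives zero by translation invariance; writing
  the difference as an integral of the derivative along the segment and exchanging the
  integrals gives the claim.\<close>
lemma integral_directional_derivative_zero: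
  fixes g :: "'a::euclidean_space \<Rightarrow> 'b::{euclidean_space}"
  assumes g: "\<And>x. (g has_derivative g' x) (at x)" and c: "continuous_on UNIV (\<lambda>x. g' x v)"
    and z: "\<And>x. R < norm x \<Longrightarrow> g x = 0"
  shows "(LBINT x. g' x v) = 0"
proof -
  define S where "S = {0..1::real} \<times> cball (0::'a) (R + norm v)"
  define D where "D t x = indicator S (t, x) *\<^sub>R g' (x + t *\<^sub>R v) v" for t x
  have z': "g' x v = 0" if "R < norm x" for x using derivative_zero_outside[OF g z that] by simp
  have cg: "continuous_on UNIV g"
    by (intro continuous_at_imp_continuous_on ballI has_derivative_continuous[OF g])
  have D_eq: "D t x = indicator {0..1} t *\<^sub>R g' (x + t *\<^sub>R v) v" for t x
  proof (cases "t \<in> {0..1}")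
    case True
    have "norm x \<le> norm (x + t *\<^sub>R v) + norm (t *\<^sub>R v)" using norm_triangle_ineq4[of "x + t *\<^sub>R v" "t *\<^sub>R v"] by simp
    also have "norm (t *\<^sub>R v) \<le> norm v" using True by (simp add: mult_left_le_one_le)
    finally have "R < norm (x + t *\<^sub>R v)" if "x \<notin> cball 0 (R + norm v)" using that by simp
    then show ?thesis using True z' by (auto simp: D_def S_def indicator_def)
  qed (auto simp: D_def S_def indicator_def)
  have "integrable lborel (\<lambda>p. indicator S p *\<^sub>R g' (snd p + fst p *\<^sub>R v) v)"
    unfolding S_def
    by (rule borel_integrable_compact)
      (auto intro!: compact_Times continuous_on_compose2[OF c] continuous_intros)
  moreover have "case_prod D = (\<lambda>p. indicator S p *\<^sub>R g' (snd p + fst p *\<^sub>R v) v)"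
    by (auto simp: D_def)
  ultimately have Dint: "integrable (lborel \<Otimes>\<^sub>M lborel) (case_prod D)" unfolding lborel_prod by simp
  have cm: "(\<lambda>x. g' x v) \<in> borel_measurable borel" by (rule borel_measurable_continuous_onI[OF c])
  have gm: "g \<in> borel_measurable borel" by (rule borel_measurable_continuous_onI[OF cg])
  have shift: "(LBINT x. f (x + w)) = (LBINT x. f x)"
    if "f \<in> borel_measurable borel" for f :: "'a \<Rightarrow> 'b" and w
    by (rule lborel_integral_invariant[OF lborel_distr_shift _ that]) simp
  have gi: "integrable lborel g" by (rule integrable_continuous_compact_support[OF cg z])
  have gi': "integrable lborel (\<lambda>x. g (x + v))"
    by (rule lborel_integrable_invariant[OF lborel_distr_shift _ gm, THEN iffD2, OF _ gi]) simp
  have "(LBINT x. g' x v) = (LBINT t. indicator {0..1::real} t *\<^sub>R (LBINT x. g' x v))" by simp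
  also have "\<dots> = (LBINT t. (LBINT x. D t x))"
    unfolding D_eq using shift[OF cm] by simp
  also have "\<dots> = (LBINT x. (LBINT t. D t x))"
    by (rule lborel_pair.Fubini_integral[OF Dint, symmetric])
  also have "\<dots> = (LBINT x. g (x + v) - g x)"
  proof (rule Bochner_Integration.integral_cong[OF refl])
    fix x
    have "(LBINT t. D t x) = g (x + 1 *\<^sub>R v) - g (x + 0 *\<^sub>R v)"
      unfolding D_eq
    proof (rule integral_FTC_Icc)
      fix t :: real
      have "((\<lambda>t. x + t *\<^sub>R v) has_derivative (\<lambda>s. s *\<^sub>R v)) (at t within {0..1})"
        by (auto intro!: derivative_eq_intros)
      from has_derivative_compose[OF this g]
      have "((\<lambda>t. g (x + t *\<^sub>R v)) has_derivative (\<lambda>s. g' (x + t *\<^sub>R v) (s *\<^sub>R v))) (at t within {0..1})"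
        by simp
      then show "((\<lambda>t. g (x + t *\<^sub>R v)) has_vector_derivative g' (x + t *\<^sub>R v) v) (at t within {0..1})"
        unfolding has_vector_derivative_def
        by (simp add: linear_cmul[OF has_derivative_linear[OF g]])
    next
      show "continuous_on {0..1} (\<lambda>t. g' (x + t *\<^sub>R v) v)"
        by (rule continuous_on_compose2[OF c]) (auto intro!: continuous_intros)
    qed simp
    then show "(LBINT t. D t x) = g (x + v) - g x" by simp
  qed
  also have "\<dots> = (LBINT x. g (x + v)) - (LBINT x. g x)"
    by (rule Bochner_Integration.integral_diff[OF gi' gi])
  also have "\<dots> = 0" using shift[OF gm] by simp
  finally show ?thesis .
qed

text \<open>\<open>g\<close> is continuously differentiable in the real sense with \<open>\<partial>g/\<partial>z = a\<close> and
  \<open>\<partial>g/\<partial>(cnj z) = b\<close>.\<close>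
definition wirtinger :: "(complex \<Rightarrow> complex) \<Rightarrow> (complex \<Rightarrow> complex) \<Rightarrow> (complex \<Rightarrow> complex) \<Rightarrow> bool" where
  "wirtinger g a b \<longleftrightarrow> (\<forall>z. (g has_derivative (\<lambda>h. a z * h + b z * cnj h)) (at z)) \<and>
     continuous_on UNIV a \<and> continuous_on UNIV b"

lemma wirtinger_continuous: "wirtinger g a b \<Longrightarrow> continuous_on UNIV g"
  unfolding wirtinger_def
  by (meson continuous_at_imp_continuous_on has_derivative_continuous)

lemma wirtinger_support:
  assumes w: "wirtinger g a b" and z: "\<And>x. R < norm x \<Longrightarrow> g x = 0" and x: "R < norm x"
  shows "a x = 0" "b x = 0"
proof -
  have "(g has_derivative (\<lambda>h. a x * h + b x * cnj h)) (at x)" using w unfolding wirtinger_def by blast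
  from derivative_zero_outside[OF this z x]
  have *: "a x * h + b x * cnj h = 0" for h by meson
  have "a x + b x = 0" using *[of 1] by simp
  moreover have "(a x - b x) * \<i> = 0" using *[of "\<i>"] by (simp add: algebra_simps)
  then have "a x = b x" by simp
  ultimately show "a x = 0" "b x = 0" by simp_all
qed

lemma wirtinger_integral_zero:
  assumes w: "wirtinger g a b" and z: "\<And>x. R < norm x \<Longrightarrow> g x = 0"
  shows "(LBINT x. a x) = 0" "(LBINT x. b x) = 0"
proof -
  have ca: "continuous_on UNIV a" and cb: "continuous_on UNIV b" using w unfolding wirtinger_def by auto
  have ia: "integrable lborel a" and ib: "integrable lborel b"
    using integrable_continuous_compact_support[OF ca] integrable_continuous_compact_support[OF cb]
      wirtinger_support[OF w z] by blast+
  have "(LBINT x. a x * v + b x * cnj v) = 0" for v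
    by (rule integral_directional_derivative_zero[of g _ v R])
      (use w z in \<open>auto simp: wirtinger_def intro!: continuous_intros\<close>)
  then have *: "(LBINT x. a x) * v + (LBINT x. b x) * cnj v = 0" for v
    using ia ib by simp
  have "(LBINT x. a x) + (LBINT x. b x) = 0" using *[of 1] by simp
  moreover have "((LBINT x. a x) - (LBINT x. b x)) * \<i> = 0" using *[of "\<i>"] by (simp add: algebra_simps)
  then have "(LBINT x. a x) = (LBINT x. b x)" by simp
  ultimately show "(LBINT x. a x) = 0" "(LBINT x. b x) = 0" by simp_all
qed

lemma wirtinger_mult:
  assumes g: "wirtinger g a b" and h: "wirtinger h c d"
  shows "wirtinger (\<lambda>z. g z * h z) (\<lambda>z. a z * h z + g z * c z) (\<lambda>z. b z * h z + g z * d z)"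
  unfolding wirtinger_def
proof (intro conjI allI)
  fix z
  have "((\<lambda>z. g z * h z) has_derivative (\<lambda>x. g z * (c z * x + d z * cnj x) + (a z * x + b z * cnj x) * h z)) (at z)"
    using g h unfolding wirtinger_def by (intro has_derivative_mult) auto
  then show "((\<lambda>z. g z * h z) has_derivative (\<lambda>x. (a z * h z + g z * c z) * x + (b z * h z + g z * d z) * cnj x)) (at z)"
    by (simp add: algebra_simps)
qed (use g h wirtinger_continuous[OF g] wirtinger_continuous[OF h] in \<open>auto simp: wirtinger_def intro!: continuous_intros\<close>)

lemma wirtinger_by_parts:
  assumes g: "wirtinger g a b" and h: "wirtinger h c d" and z: "\<And>x. R < norm x \<Longrightarrow> h x = 0"
  shows "(LBINT x. g x * c x) = - (LBINT x. a x * h x)"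
    and "(LBINT x. g x * d x) = - (LBINT x. b x * h x)"
proof -
  note m = wirtinger_mult[OF g h]
  have zz: "\<And>x. R < norm x \<Longrightarrow> g x * h x = 0" using z by simp
  have c: "continuous_on UNIV g" "continuous_on UNIV h" "continuous_on UNIV a" "continuous_on UNIV b"
    "continuous_on UNIV c" "continuous_on UNIV d"
    using g h wirtinger_continuous[OF g] wirtinger_continuous[OF h] by (auto simp: wirtinger_def)
  have i: "integrable lborel (\<lambda>x. f x * k x)"
    if "continuous_on UNIV f" "continuous_on UNIV k" "\<And>x. R < norm x \<Longrightarrow> k x = 0" for f k :: "complex \<Rightarrow> complex"
    using that by (intro integrable_continuous_compact_support[of _ R]) (auto intro!: continuous_intros)
  show "(LBINT x. g x * c x) = - (LBINT x. a x * h x)"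
    using wirtinger_integral_zero(1)[OF m zz] i[OF c(3) c(2) z] i[OF c(1) c(5) wirtinger_support(1)[OF h z]]
    by (simp add: eq_neg_iff_add_eq_0 add.commute)
  show "(LBINT x. g x * d x) = - (LBINT x. b x * h x)"
    using wirtinger_integral_zero(2)[OF m zz] i[OF c(4) c(2) z] i[OF c(1) c(6) wirtinger_support(2)[OF h z]]
    by (simp add: eq_neg_iff_add_eq_0 add.commute)
qed

lemma decaying_compact_support:
  assumes f: "continuous_on UNIV f" and z: "\<And>x. R < norm x \<Longrightarrow> f x = 0"
  shows "\<exists>A. decaying q A f"
proof -
  have "compact ((\<lambda>x. norm (f x) * wt q x) ` cball 0 R)"
    by (intro compact_continuous_image continuous_intros continuous_on_subset[OF f])
      (auto simp: add_nonneg_eq_0_iff)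
  then obtain A where A: "\<And>x. x \<in> cball 0 R \<Longrightarrow> norm (norm (f x) * wt q x) \<le> A" "0 < A"
    using compact_imp_bounded bounded_pos by (metis (no_types, lifting) imageI)
  have "norm (f x) \<le> A * wt (- q) x" for x
  proof (cases "norm x \<le> R")
    case True
    have "0 < wt q x" by (simp add: add_nonneg_eq_0_iff)
    moreover have "norm (f x) * wt q x \<le> A" using A(1)[of x] True by simp
    ultimately show ?thesis by (simp add: powr_minus field_simps)
  next
    case False
    then show ?thesis using z[of x] A by simp
  qed
  then show ?thesis using f unfolding decaying_def by blast
qed

text \<open>The mass of the approximate identity \<open>\<delta>\<^sup>2/(|z|\<^sup>2 + \<delta>\<^sup>2)\<^sup>2\<close> that arises from the regularised
  Cauchy kernel.  Its value is \<open>\<pi>\<close>, but only its positivity is needed.\<close>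
definition bump_mass :: real where
  "bump_mass = (LBINT y. 1 / (1 + (norm (y::complex))\<^sup>2)\<^sup>2)"

lemma bump_integrable: "integrable lborel (\<lambda>y::complex. 1 / (1 + (norm y)\<^sup>2)\<^sup>2)"
proof (rule Bochner_Integration.integrable_bound)
  show "integrable lborel (\<lambda>y::complex. 4 * wt (- 4) y)"
    by (intro integrable_mult_right integrable_decay_far) auto
  show "AE y::complex in lborel. norm (1 / (1 + (norm y)\<^sup>2)\<^sup>2) \<le> norm (4 * wt (- 4) y)"
  proof (rule AE_I2)
    fix y :: complex
    define t where "t = norm y"
    have t: "t \<ge> 0" by (simp add: t_def)
    have "(1 + t)\<^sup>2 \<le> 2 * (1 + t\<^sup>2)" using sum_squares_bound[of 1 t] by (simp add: power2_eq_square algebra_simps)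
    then have "((1 + t)\<^sup>2)\<^sup>2 \<le> (2 * (1 + t\<^sup>2))\<^sup>2" by (rule power_mono) simp
    then have le: "(1 + t) ^ 4 \<le> 4 * (1 + t\<^sup>2)\<^sup>2"
      unfolding power_mult_distrib by (simp flip: power_mult)
    have "(1 + t) powr (- 4) = 1 / (1 + t) ^ 4"
      using t by (simp add: powr_minus_divide)
    moreover have "1 / (1 + t\<^sup>2)\<^sup>2 \<le> 4 / (1 + t) ^ 4"
      using le t by (simp add: divide_simps add_nonneg_eq_0_iff add_pos_nonneg mult.commute)
    ultimately show "norm (1 / (1 + (norm y)\<^sup>2)\<^sup>2) \<le> norm (4 * wt (- 4) y)"
      by (simp add: t_def)
  qed
qed auto

lemma bump_mass_pos: "0 < bump_mass"
proof -
  have "(LBINT y. indicator (cball (0::complex) 1) y * (1/4)) \<le> (LBINT y. 1 / (1 + (norm (y::complex))\<^sup>2)\<^sup>2)"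
  proof (rule integral_mono)
    show "integrable lborel (\<lambda>y. indicator (cball (0::complex) 1) y * (1/4::real))"
      by (intro integrable_mult_left integrable_real_indicator)
        (auto simp: emeasure_cball)
    show "indicator (cball (0::complex) 1) y * (1/4) \<le> 1 / (1 + (norm y)\<^sup>2)\<^sup>2" for y
    proof (cases "norm y \<le> 1")
      case True
      have "(1 + (norm y)\<^sup>2)\<^sup>2 \<le> (1 + 1\<^sup>2)\<^sup>2" using True by (intro power_mono add_left_mono) auto
      moreover have "0 < 1 + (norm y)\<^sup>2" by (intro add_pos_nonneg) auto
      ultimately have "1 / 4 \<le> 1 / (1 + (norm y)\<^sup>2)\<^sup>2"
        by (intro divide_left_mono) auto
      then show ?thesis using True by simp
    qed simp
  qed (rule bump_integrable)
  moreover have "(LBINT y. indicator (cball (0::complex) 1) y * (1/4)) = pi / 4"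
    by (simp add: content_cball unit_ball_vol_2)
  ultimately show ?thesis unfolding bump_mass_def using pi_gt_zero by linarith
qed

text \<open>The kernel \<open>cnj z/(|z|\<^sup>2 + \<delta>\<^sup>2)\<close> is a smooth approximation of \<open>1/z\<close> from below in modulus.\<close>
lemma wirtinger_regularised_kernel:
  assumes d: "0 < d"
  shows "wirtinger (\<lambda>z. cnj (z - w) / ((z - w) * cnj (z - w) + of_real (d\<^sup>2)))
    (\<lambda>z. - (cnj (z - w))\<^sup>2 / ((z - w) * cnj (z - w) + of_real (d\<^sup>2))\<^sup>2)
    (\<lambda>z. of_real (d\<^sup>2) / ((z - w) * cnj (z - w) + of_real (d\<^sup>2))\<^sup>2)"
proof -
  have nz: "(z - w) * cnj (z - w) + of_real (d\<^sup>2) \<noteq> 0" for z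
  proof
    assume "(z - w) * cnj (z - w) + of_real (d\<^sup>2) = 0"
    then have "of_real ((norm (z - w))\<^sup>2 + d\<^sup>2) = (0::complex)"
      by (simp only: of_real_add complex_norm_square)
    then have "(norm (z - w))\<^sup>2 + d\<^sup>2 = 0" by (simp only: of_real_eq_0_iff)
    then show False using d by (simp add: sum_power2_eq_zero_iff)
  qed
  show ?thesis
    unfolding wirtinger_def
  proof (intro conjI allI)
    fix z
    let ?N = "(z - w) * cnj (z - w) + of_real (d\<^sup>2)"
    have "((\<lambda>z. cnj (z - w) / ((z - w) * cnj (z - w) + of_real (d\<^sup>2))) has_derivative
      (\<lambda>h. (cnj h * ?N - cnj (z - w) * ((z - w) * cnj h + h * cnj (z - w))) / (?N * ?N))) (at z)"
    proof (rule has_derivative_divide')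
      show "((\<lambda>z. cnj (z - w)) has_derivative cnj) (at z)"
        by (auto intro!: derivative_eq_intros has_derivative_cnj)
      show "((\<lambda>z. (z - w) * cnj (z - w) + of_real (d\<^sup>2)) has_derivative
          (\<lambda>h. (z - w) * cnj h + h * cnj (z - w))) (at z)"
        by (auto intro!: derivative_eq_intros has_derivative_cnj)
    qed (rule nz)
    moreover have "(cnj h * ?N - cnj (z - w) * ((z - w) * cnj h + h * cnj (z - w))) / (?N * ?N)
        = - (cnj (z - w))\<^sup>2 / ?N\<^sup>2 * h + of_real (d\<^sup>2) / ?N\<^sup>2 * cnj h" for h
    proof -
      have "cnj h * ?N - cnj (z - w) * ((z - w) * cnj h + h * cnj (z - w))
        = - (cnj (z - w))\<^sup>2 * h + of_real (d\<^sup>2) * cnj h"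
        by (simp add: algebra_simps power2_eq_square)
      then show ?thesis by (simp add: add_divide_distrib diff_divide_distrib power2_eq_square)
    qed
    ultimately show "((\<lambda>z. cnj (z - w) / ((z - w) * cnj (z - w) + of_real (d\<^sup>2))) has_derivative
      (\<lambda>h. - (cnj (z - w))\<^sup>2 / ?N\<^sup>2 * h + of_real (d\<^sup>2) / ?N\<^sup>2 * cnj h)) (at z)"
      by simp
  qed (use nz in \<open>auto intro!: continuous_intros\<close>)
qed

lemma singular_kernel_inverse: "singular_kernel (\<lambda>y. 1 / y)"
  unfolding singular_kernel_def by (auto intro!: continuous_intros simp: norm_divide)

text \<open>The formula is obtained by integrating by parts against the regularised kernel and letting
  \<open>\<delta>\<close> tend to zero on both sides.\<close>
lemma cauchy_pompeiu:
  assumes g: "wirtinger g a b" and z: "\<And>x. R < norm x \<Longrightarrow> g x = 0"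
  shows "conv (\<lambda>y. 1 / y) b w = of_real bump_mass * g w"
proof -
  have cg: "continuous_on UNIV g" and cb: "continuous_on UNIV b"
    using g wirtinger_continuous[OF g] by (auto simp: wirtinger_def)
  have [measurable]: "g \<in> borel_measurable borel" "b \<in> borel_measurable borel"
    using cg cb by (auto intro: borel_measurable_continuous_onI)
  obtain A where A: "decaying 4 A b"
    using decaying_compact_support[OF cb, of R 4] wirtinger_support(2)[OF g z] by blast
  obtain B where B: "decaying 0 B g" using decaying_compact_support[OF cg z] by blast
  have Bg: "norm (g x) \<le> B" for x
  proof -
    have "1 + norm x \<noteq> 0" using norm_ge_zero[of x] by linarith
    then show ?thesis using decaying_norm[OF B, of x] by simp
  qed
  define d where "d n = inverse (real (Suc n))" for n
  have d: "0 < d n" for n by (simp add: d_def)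
  have dlim: "d \<longlonglongrightarrow> 0" unfolding d_def by (rule LIMSEQ_inverse_real_of_nat)
  define N where "N n z = (z - w) * cnj (z - w) + of_real ((d n)\<^sup>2)" for n z
  have N: "N n z = of_real ((norm (z - w))\<^sup>2 + (d n)\<^sup>2)" for n z
    by (simp only: N_def of_real_add complex_norm_square)
  have eq: "(LBINT z. b z * (- cnj (z - w) / N n z)) = (LBINT y. of_real (1 / (1 + (norm y)\<^sup>2)\<^sup>2) * g (w + d n *\<^sub>R y))" for n
  proof -
    have "(LBINT z. b z * (- cnj (z - w) / N n z)) = - (LBINT z. cnj (z - w) / N n z * b z)"
    proof -
      have "b z * (- cnj (z - w) / N n z) = - (cnj (z - w) / N n z * b z)" for z
        by (simp add: mult.commute del: complex_cnj_diff)
      then show ?thesis by (simp only: Bochner_Integration.integral_minus)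
    qed
    also have "\<dots> = (LBINT z. of_real ((d n)\<^sup>2) / (N n z)\<^sup>2 * g z)"
      using wirtinger_by_parts(2)[OF wirtinger_regularised_kernel[OF d[of n], of w] g z] by (simp add: N_def)
    also have "\<dots> = (d n)\<^sup>2 *\<^sub>R (LBINT y. of_real ((d n)\<^sup>2) / (N n (w + d n *\<^sub>R y))\<^sup>2 * g (w + d n *\<^sub>R y))"
      by (rule integral_scale_complex(1)[OF _ d]) (simp add: N)
    also have "\<dots> = (LBINT y. (d n)\<^sup>2 *\<^sub>R (of_real ((d n)\<^sup>2) / (N n (w + d n *\<^sub>R y))\<^sup>2 * g (w + d n *\<^sub>R y)))"
      by (rule integral_scaleR_right[symmetric])
    also have "\<dots> = (LBINT y. of_real (1 / (1 + (norm y)\<^sup>2)\<^sup>2) * g (w + d n *\<^sub>R y))"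
    proof (rule Bochner_Integration.integral_cong[OF refl])
      fix y :: complex
      have "N n (w + d n *\<^sub>R y) = of_real ((d n)\<^sup>2) * of_real (1 + (norm y)\<^sup>2)"
        using d[of n] by (simp add: N power_mult_distrib algebra_simps)
      moreover have "of_real ((d n)\<^sup>2) \<noteq> (0::complex)" using d[of n] by simp
      moreover have "(of_real (1 + (norm y)\<^sup>2) :: complex) \<noteq> 0"
        by (simp only: of_real_eq_0_iff) (simp add: add_nonneg_eq_0_iff)
      moreover have "D * (D / (D * M)\<^sup>2 * x) = 1 / M\<^sup>2 * x" if "D \<noteq> 0" "M \<noteq> 0" for D M x :: complex
        using that by (simp add: power2_eq_square)
      ultimately show "(d n)\<^sup>2 *\<^sub>R (of_real ((d n)\<^sup>2) / (N n (w + d n *\<^sub>R y))\<^sup>2 * g (w + d n *\<^sub>R y))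
          = of_real (1 / (1 + (norm y)\<^sup>2)\<^sup>2) * g (w + d n *\<^sub>R y)"
        by (simp only: scaleR_conv_of_real of_real_divide of_real_power of_real_1)
    qed
    finally show ?thesis .
  qed
  have lim1: "(\<lambda>n. LBINT z. b z * (- cnj (z - w) / N n z)) \<longlonglongrightarrow> (LBINT z. 1 / (w - z) * b z)"
  proof (rule integral_dominated_convergence[where w="\<lambda>z. norm (1 / (w - z) * b z)"])
    show "integrable lborel (\<lambda>z. norm (1 / (w - z) * b z))"
      using conv_integrable[OF _ singular_kernel_inverse A, of w] by (intro integrable_norm) auto
    show "AE z in lborel. (\<lambda>n. b z * (- cnj (z - w) / N n z)) \<longlonglongrightarrow> 1 / (w - z) * b z"
    proof -
      have "AE z in lborel. z \<noteq> w" by (rule AE_lborel_singleton)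
      then show ?thesis
      proof eventually_elim
        case (elim z)
        have "(\<lambda>n. b z * (- cnj (z - w) / N n z)) \<longlonglongrightarrow> b z * (- cnj (z - w) / ((z - w) * cnj (z - w) + of_real (0\<^sup>2)))"
          unfolding N_def using elim by (intro tendsto_intros dlim) auto
        moreover have "b z * (- cnj (z - w) / ((z - w) * cnj (z - w) + of_real (0\<^sup>2))) = 1 / (w - z) * b z"
        proof -
          have "cnj (z - w) \<noteq> 0" "z - w \<noteq> 0" "w - z \<noteq> 0" using elim by (auto simp del: complex_cnj_diff)
          then have "- cnj (z - w) / ((z - w) * cnj (z - w)) = - 1 / (z - w)" by (simp del: complex_cnj_diff)
          also have "\<dots> = 1 / (w - z)" by (metis minus_diff_eq minus_divide_divide minus_minus)
          finally show ?thesis by (simp del: complex_cnj_diff)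
        qed
        ultimately show ?case by simp
      qed
    qed
    show "AE z in lborel. norm (b z * (- cnj (z - w) / N n z)) \<le> norm (1 / (w - z) * b z)" for n
    proof (rule AE_I2)
      fix z
      have "norm (cnj (z - w) / N n z) \<le> 1 / norm (z - w)"
      proof (cases "z = w")
        case False
        then have p: "0 < norm (z - w)" by simp
        have "norm (N n z) = (norm (z - w))\<^sup>2 + (d n)\<^sup>2"
          unfolding N norm_of_real by simp
        then have "norm (cnj (z - w) / N n z) = norm (z - w) / ((norm (z - w))\<^sup>2 + (d n)\<^sup>2)"
          by (simp add: norm_divide del: complex_cnj_diff)
        also have "\<dots> \<le> norm (z - w) / (norm (z - w))\<^sup>2"
          using p by (intro divide_left_mono) (auto intro!: mult_pos_pos add_pos_nonneg)
        finally show ?thesis using p by (simp add: power2_eq_square)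
      qed simp
      then have "norm (cnj (z - w) / N n z) * norm (b z) \<le> 1 / norm (z - w) * norm (b z)"
        by (rule mult_right_mono) simp
      then show "norm (b z * (- cnj (z - w) / N n z)) \<le> norm (1 / (w - z) * b z)"
        by (simp add: norm_mult norm_divide norm_minus_commute mult.commute del: complex_cnj_diff)
    qed
  qed (simp_all add: N)
  have lim2: "(\<lambda>n. LBINT y. of_real (1 / (1 + (norm y)\<^sup>2)\<^sup>2) * g (w + d n *\<^sub>R y))
      \<longlonglongrightarrow> (LBINT y. of_real (1 / (1 + (norm y)\<^sup>2)\<^sup>2) * g (w + 0 *\<^sub>R y))"
  proof (rule integral_dominated_convergence[where w="\<lambda>y. B * (1 / (1 + (norm y)\<^sup>2)\<^sup>2)"])
    show "integrable lborel (\<lambda>y::complex. B * (1 / (1 + (norm y)\<^sup>2)\<^sup>2))"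
      by (intro integrable_mult_right bump_integrable)
    have ig: "isCont g x" for x using cg by (simp add: continuous_on_eq_continuous_at)
    show "AE y in lborel. (\<lambda>n. of_real (1 / (1 + (norm y)\<^sup>2)\<^sup>2) * g (w + d n *\<^sub>R y))
        \<longlonglongrightarrow> of_real (1 / (1 + (norm y)\<^sup>2)\<^sup>2) * g (w + 0 *\<^sub>R y)"
      by (intro AE_I2 tendsto_mult tendsto_const isCont_tendsto_compose[OF ig] tendsto_add tendsto_scaleR dlim)
    show "AE y in lborel. norm (of_real (1 / (1 + (norm y)\<^sup>2)\<^sup>2) * g (w + d n *\<^sub>R y))
        \<le> B * (1 / (1 + (norm y)\<^sup>2)\<^sup>2)" for n
    proof (rule AE_I2)
      fix y :: complex
      have "norm (of_real (1 / (1 + (norm y)\<^sup>2)\<^sup>2) * g (w + d n *\<^sub>R y))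
          = 1 / (1 + (norm y)\<^sup>2)\<^sup>2 * norm (g (w + d n *\<^sub>R y))"
        unfolding norm_mult norm_of_real by simp
      also have "\<dots> \<le> 1 / (1 + (norm y)\<^sup>2)\<^sup>2 * B" by (intro mult_left_mono Bg) simp
      finally show "norm (of_real (1 / (1 + (norm y)\<^sup>2)\<^sup>2) * g (w + d n *\<^sub>R y))
        \<le> B * (1 / (1 + (norm y)\<^sup>2)\<^sup>2)" by (simp add: mult.commute)
    qed
  qed measurable
  have "(LBINT z. 1 / (w - z) * b z) = (LBINT y. of_real (1 / (1 + (norm y)\<^sup>2)\<^sup>2) * g (w + 0 *\<^sub>R y))"
    using lim1 lim2 unfolding eq by (rule LIMSEQ_unique)
  also have "\<dots> = (LBINT y. of_real (1 / (1 + (norm (y::complex))\<^sup>2)\<^sup>2)) * g w"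
    by (simp only: scaleR_zero_left add_0_right integral_mult_left_zero)
  also have "(LBINT y. of_real (1 / (1 + (norm (y::complex))\<^sup>2)\<^sup>2)) = (of_real bump_mass :: complex)"
    unfolding bump_mass_def by (rule integral_of_real[OF bump_integrable])
  finally show ?thesis unfolding conv_def .
qed

section \<open>Symmetry of mixed second derivatives\<close>

text \<open>The mean value theorem, applied in the direction \<open>u\<close> and then in the direction \<open>v\<close>.\<close>
lemma second_difference:
  fixes f :: "'a::real_normed_vector \<Rightarrow> real"
  assumes f: "\<And>x. (f has_derivative f' x) (at x)"
    and f2: "\<And>x. ((\<lambda>y. f' y u) has_derivative f'' x) (at x)" and s: "0 < s"
  shows "\<exists>\<xi> \<eta>. 0 < \<xi> \<and> \<xi> < s \<and> 0 < \<eta> \<and> \<eta> < s \<and>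
    f (z + s *\<^sub>R u + s *\<^sub>R v) - f (z + s *\<^sub>R u) - f (z + s *\<^sub>R v) + f z = s * (s * f'' (z + \<xi> *\<^sub>R u + \<eta> *\<^sub>R v) v)"
proof -
  have line: "((\<lambda>t. g (a + t *\<^sub>R w)) has_real_derivative g' (a + t *\<^sub>R w) w) (at t)"
    if g: "\<And>x. (g has_derivative g' x) (at x)" for g :: "'a \<Rightarrow> real" and g' a w t
  proof -
    have "((\<lambda>t. a + t *\<^sub>R w) has_derivative (\<lambda>s. s *\<^sub>R w)) (at t)"
      by (auto intro!: derivative_eq_intros)
    from has_derivative_compose[OF this g]
    have "((\<lambda>t. g (a + t *\<^sub>R w)) has_derivative (\<lambda>s. g' (a + t *\<^sub>R w) (s *\<^sub>R w))) (at t)" .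
    moreover have "(\<lambda>s. g' (a + t *\<^sub>R w) (s *\<^sub>R w)) = (*) (g' (a + t *\<^sub>R w) w)"
      using linear_cmul[OF has_derivative_linear[OF g]] by (auto simp: mult.commute)
    ultimately show ?thesis unfolding has_field_derivative_def by simp
  qed
  define G where "G t = f (z + s *\<^sub>R v + t *\<^sub>R u) - f (z + t *\<^sub>R u)" for t
  have "\<exists>\<xi>. 0 < \<xi> \<and> \<xi> < s \<and> G s - G 0 = (s - 0) * (f' (z + s *\<^sub>R v + \<xi> *\<^sub>R u) u - f' (z + \<xi> *\<^sub>R u) u)"
    unfolding G_def by (intro MVT2 s DERIV_diff line f)
  then obtain \<xi> where x: "0 < \<xi>" "\<xi> < s"
      "G s - G 0 = s * (f' (z + s *\<^sub>R v + \<xi> *\<^sub>R u) u - f' (z + \<xi> *\<^sub>R u) u)" by auto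
  define H where "H t = f' (z + \<xi> *\<^sub>R u + t *\<^sub>R v) u" for t
  have "\<exists>\<eta>. 0 < \<eta> \<and> \<eta> < s \<and> H s - H 0 = (s - 0) * f'' (z + \<xi> *\<^sub>R u + \<eta> *\<^sub>R v) v"
    unfolding H_def by (intro MVT2 s line[of "\<lambda>y. f' y u"] f2)
  then obtain \<eta> where y: "0 < \<eta>" "\<eta> < s" "H s - H 0 = s * f'' (z + \<xi> *\<^sub>R u + \<eta> *\<^sub>R v) v" by auto
  show ?thesis
    using x y by (intro exI[of _ \<xi>] exI[of _ \<eta>]) (simp add: G_def H_def add_ac)
qed

lemma mixed_partials_equal:
  fixes f :: "'a::real_normed_vector \<Rightarrow> real"
  assumes f: "\<And>x. (f has_derivative f' x) (at x)"
    and fu: "\<And>x. ((\<lambda>y. f' y u) has_derivative fu x) (at x)"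
    and fv: "\<And>x. ((\<lambda>y. f' y v) has_derivative fv x) (at x)"
    and cu: "continuous_on UNIV (\<lambda>x. fu x v)" and cv: "continuous_on UNIV (\<lambda>x. fv x u)"
  shows "fu z v = fv z u"
proof -
  define s where "s n = inverse (real (Suc n))" for n
  have s: "0 < s n" for n by (simp add: s_def)
  have sl: "s \<longlonglongrightarrow> 0" unfolding s_def by (rule LIMSEQ_inverse_real_of_nat)
  have "\<exists>\<xi> \<eta> \<xi>' \<eta>'. 0 \<le> \<xi> \<and> \<xi> \<le> s n \<and> 0 \<le> \<eta> \<and> \<eta> \<le> s n \<and> 0 \<le> \<xi>' \<and> \<xi>' \<le> s n \<and> 0 \<le> \<eta>' \<and> \<eta>' \<le> s n \<and>
      fu (z + \<xi> *\<^sub>R u + \<eta> *\<^sub>R v) v = fv (z + \<xi>' *\<^sub>R v + \<eta>' *\<^sub>R u) u" for n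
  proof -
    obtain \<xi> \<eta> where 1: "0 < \<xi>" "\<xi> < s n" "0 < \<eta>" "\<eta> < s n"
      "f (z + s n *\<^sub>R u + s n *\<^sub>R v) - f (z + s n *\<^sub>R u) - f (z + s n *\<^sub>R v) + f z = s n * (s n * fu (z + \<xi> *\<^sub>R u + \<eta> *\<^sub>R v) v)"
      using second_difference[OF f fu s, of n z v] by blast
    obtain \<xi>' \<eta>' where 2: "0 < \<xi>'" "\<xi>' < s n" "0 < \<eta>'" "\<eta>' < s n"
      "f (z + s n *\<^sub>R v + s n *\<^sub>R u) - f (z + s n *\<^sub>R v) - f (z + s n *\<^sub>R u) + f z = s n * (s n * fv (z + \<xi>' *\<^sub>R v + \<eta>' *\<^sub>R u) u)"
      using second_difference[OF f fv s, of n z u] by blast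
    have "s n * (s n * fu (z + \<xi> *\<^sub>R u + \<eta> *\<^sub>R v) v) = s n * (s n * fv (z + \<xi>' *\<^sub>R v + \<eta>' *\<^sub>R u) u)"
    proof -
      have "z + s n *\<^sub>R v + s n *\<^sub>R u = z + s n *\<^sub>R u + s n *\<^sub>R v" by (simp add: add_ac)
      with 2(5) have "f (z + s n *\<^sub>R u + s n *\<^sub>R v) - f (z + s n *\<^sub>R v) - f (z + s n *\<^sub>R u) + f z
          = s n * (s n * fv (z + \<xi>' *\<^sub>R v + \<eta>' *\<^sub>R u) u)" by (simp only:)
      then show ?thesis using 1(5) by linarith
    qed
    then have "fu (z + \<xi> *\<^sub>R u + \<eta> *\<^sub>R v) v = fv (z + \<xi>' *\<^sub>R v + \<eta>' *\<^sub>R u) u" using s[of n] by simp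
    then show ?thesis using 1 2 by (intro exI[of _ \<xi>] exI[of _ \<eta>] exI[of _ \<xi>'] exI[of _ \<eta>']) auto
  qed
  then obtain \<xi> \<eta> \<xi>' \<eta>' where
    b: "\<And>n. 0 \<le> \<xi> n" "\<And>n. \<xi> n \<le> s n" "\<And>n. 0 \<le> \<eta> n" "\<And>n. \<eta> n \<le> s n"
       "\<And>n. 0 \<le> \<xi>' n" "\<And>n. \<xi>' n \<le> s n" "\<And>n. 0 \<le> \<eta>' n" "\<And>n. \<eta>' n \<le> s n"
    and eq: "\<And>n. fu (z + \<xi> n *\<^sub>R u + \<eta> n *\<^sub>R v) v = fv (z + \<xi>' n *\<^sub>R v + \<eta>' n *\<^sub>R u) u"
    by metis
  have sq: "p \<longlonglongrightarrow> 0" if "\<And>n. 0 \<le> p n" "\<And>n. p n \<le> s n" for p :: "nat \<Rightarrow> real"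
    using that by (intro tendsto_sandwich[OF _ _ tendsto_const sl]) auto
  have lims: "\<xi> \<longlonglongrightarrow> 0" "\<eta> \<longlonglongrightarrow> 0" "\<xi>' \<longlonglongrightarrow> 0" "\<eta>' \<longlonglongrightarrow> 0" using b by (auto intro: sq)
  have "isCont (\<lambda>x. fu x v) z" "isCont (\<lambda>x. fv x u) z"
    using cu cv by (auto simp: continuous_on_eq_continuous_at)
  moreover have "(\<lambda>n. z + \<xi> n *\<^sub>R u + \<eta> n *\<^sub>R v) \<longlonglongrightarrow> z + 0 *\<^sub>R u + 0 *\<^sub>R v"
    "(\<lambda>n. z + \<xi>' n *\<^sub>R v + \<eta>' n *\<^sub>R u) \<longlonglongrightarrow> z + 0 *\<^sub>R v + 0 *\<^sub>R u"
    by (intro tendsto_intros lims)+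
  ultimately have "(\<lambda>n. fu (z + \<xi> n *\<^sub>R u + \<eta> n *\<^sub>R v) v) \<longlonglongrightarrow> fu z v"
    "(\<lambda>n. fv (z + \<xi>' n *\<^sub>R v + \<eta>' n *\<^sub>R u) u) \<longlonglongrightarrow> fv z u"
    using isCont_tendsto_compose[of z "\<lambda>x. fu x v"] isCont_tendsto_compose[of z "\<lambda>x. fv x u"] by auto
  then show ?thesis unfolding eq by (rule LIMSEQ_unique)
qed

section \<open>The Stokes problem in complex notation\<close>

text \<open>Equivariance under the symmetry group of the square, acting on the plane \<open>\<complex>\<close> and on vectors
  alike; it suffices to require it for two generators.\<close>
definition equivariant :: "(complex \<Rightarrow> complex) \<Rightarrow> bool" where
  "equivariant F \<longleftrightarrow> (\<forall>z. F (\<i> * z) = \<i> * F z) \<and> (\<forall>z. F (cnj z) = cnj (F z))"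

text \<open>The kernels of the Stokes problem: \<open>ker_log\<close> and \<open>ker_dir\<close> for the velocity, the other three
  for its derivatives.  Only their values off the origin matter.\<close>
definition ker_z :: "complex \<Rightarrow> complex" where "ker_z y = 1 / y"
definition ker_zbar :: "complex \<Rightarrow> complex" where "ker_zbar y = 1 / cnj y"
definition ker_strain :: "complex \<Rightarrow> complex" where "ker_strain y = y / (cnj y)\<^sup>2"
definition ker_log :: "complex \<Rightarrow> complex" where "ker_log y = of_real (ln (norm y))"
definition ker_dir :: "complex \<Rightarrow> complex" where "ker_dir y = y / cnj y"

lemma singular_ker_z: "singular_kernel ker_z"
  unfolding ker_z_def[abs_def] by (rule singular_kernel_inverse)

lemma singular_ker_zbar: "singular_kernel ker_zbar"
  unfolding singular_kernel_def ker_zbar_def by (auto intro!: continuous_intros simp: norm_divide)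

lemma singular_ker_strain: "singular_kernel ker_strain"
  unfolding singular_kernel_def ker_strain_def
  by (auto intro!: continuous_intros simp: norm_divide norm_mult power2_eq_square)

lemma singular_uminus: "singular_kernel k \<Longrightarrow> singular_kernel (\<lambda>y. - k y)"
  unfolding singular_kernel_def by (auto intro!: continuous_intros)

lemma singular_half: "singular_kernel k \<Longrightarrow> singular_kernel (\<lambda>y. k y / 2)"
  unfolding singular_kernel_def
proof (intro conjI allI)
  fix y assume "continuous_on (- {0}) k \<and> (\<forall>y. norm (k y) \<le> 1 / norm y)"
  then have "norm (k y) \<le> 1 / norm y" by blast
  then show "norm (k y / 2) \<le> 1 / norm y"
    using norm_ge_zero[of "k y"] unfolding norm_divide norm_numeral by linarith
qed (auto intro!: continuous_intros)

lemma ker_log_derivative: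
  assumes "y \<noteq> 0"
  shows "(ker_log has_derivative (\<lambda>h. ker_z y / 2 * h + ker_zbar y / 2 * cnj h)) (at y)"
proof -
  have p: "0 < (Re y)\<^sup>2 + (Im y)\<^sup>2" using assms by (simp add: complex_neq_0)
  have eq: "ker_log = (\<lambda>y. of_real (ln ((Re y)\<^sup>2 + (Im y)\<^sup>2) / 2))"
    by (auto simp: ker_log_def fun_eq_iff cmod_def ln_sqrt)
  have "((\<lambda>y. ln ((Re y)\<^sup>2 + (Im y)\<^sup>2) / 2) has_derivative
      (\<lambda>h. (2 * Re y * Re h + 2 * Im y * Im h) / ((Re y)\<^sup>2 + (Im y)\<^sup>2) / 2)) (at y)"
    using p by (auto intro!: derivative_eq_intros simp: field_simps)
  then have "((\<lambda>y. complex_of_real (ln ((Re y)\<^sup>2 + (Im y)\<^sup>2) / 2)) has_derivative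
      (\<lambda>h. of_real ((2 * Re y * Re h + 2 * Im y * Im h) / ((Re y)\<^sup>2 + (Im y)\<^sup>2) / 2))) (at y)"
    by (rule has_derivative_of_real)
  moreover have "of_real ((2 * Re y * Re h + 2 * Im y * Im h) / ((Re y)\<^sup>2 + (Im y)\<^sup>2) / 2)
      = ker_z y / 2 * h + ker_zbar y / 2 * cnj h" for h
  proof -
    have N: "y * cnj y = of_real ((Re y)\<^sup>2 + (Im y)\<^sup>2)" by (rule complex_mult_cnj)
    have "ker_z y / 2 * h + ker_zbar y / 2 * cnj h = (cnj y * h + y * cnj h) / (2 * (y * cnj y))"
      using assms by (simp add: ker_z_def ker_zbar_def field_simps)
    also have "cnj y * h + y * cnj h = of_real (2 * Re y * Re h + 2 * Im y * Im h)"
      by (simp add: complex_eq_iff)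
    finally show ?thesis unfolding N of_real_divide of_real_numeral divide_divide_eq_left
      by (simp only: mult.commute of_real_mult of_real_numeral)
  qed
  ultimately show ?thesis unfolding eq by simp
qed

lemma ker_dir_derivative:
  assumes "y \<noteq> 0"
  shows "(ker_dir has_derivative (\<lambda>h. ker_zbar y * h + (- ker_strain y) * cnj h)) (at y)"
proof -
  have nz: "cnj y \<noteq> 0" using assms by simp
  have "(ker_dir has_derivative (\<lambda>h. (h * cnj y - y * cnj h) / (cnj y * cnj y))) (at y)"
    unfolding ker_dir_def[abs_def]
    by (rule has_derivative_divide'[where f="\<lambda>y. y" and g=cnj, OF _ _ nz])
      (auto intro!: derivative_eq_intros has_derivative_cnj)
  moreover have "(h * cnj y - y * cnj h) / (cnj y * cnj y) = ker_zbar y * h + (- ker_strain y) * cnj h" for h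
    using nz by (simp add: ker_zbar_def ker_strain_def field_simps power2_eq_square)
  ultimately show ?thesis by simp
qed

lemma ker_log_bound: "norm (ker_log y) \<le> norm y + 1 / norm y"
proof (cases "y = 0")
  case False
  have "ln (norm y) \<le> norm y" using ln_bound[of "norm y"] False by simp
  moreover have "- ln (norm y) \<le> 1 / norm y"
    using ln_bound[of "1 / norm y"] False by (simp add: ln_div)
  moreover have "0 \<le> norm y" "0 \<le> 1 / norm y" by auto
  ultimately have "\<bar>ln (norm y)\<bar> \<le> norm y + 1 / norm y" by linarith
  then show ?thesis by (simp add: ker_log_def)
qed (simp add: ker_log_def)

lemma ker_dir_bound: "norm (ker_dir y) \<le> norm y + 1 / norm y"
proof (cases "y = 0")
  case False
  then have p: "0 < norm y" by simp
  have "norm (ker_dir y) = 1" using p by (simp add: ker_dir_def norm_divide)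
  also have "1 \<le> norm y + 1 / norm y"
  proof (cases "norm y \<le> 1")
    case True
    then have "1 \<le> 1 / norm y" using p by simp
    then show ?thesis using p by linarith
  next
    case False
    then show ?thesis by (simp add: add_increasing2)
  qed
  finally show ?thesis .
qed (simp add: ker_dir_def)

lemma measurable_ker_log: "ker_log \<in> borel_measurable borel"
  unfolding ker_log_def[abs_def] by measurable

lemma measurable_ker_dir: "ker_dir \<in> borel_measurable borel"
  unfolding ker_dir_def[abs_def] by measurable

text \<open>The normalisation \<open>1/(4 \<pi>)\<close> of the fundamental solution.\<close>
definition stokes_const :: complex where "stokes_const = of_real (1 / (4 * bump_mass))"

text \<open>The velocity field of the Stokes problem with force \<open>F\<close>: the convolution with the tensor
  \<open>(log|x| I - x x\<^sup>T/|x|\<^sup>2)/(4 \<pi>)\<close>.  In complex form \<open>x (x \<sqdot> F)/|x|\<^sup>2\<close> equals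
  \<open>F/2 + (z / cnj z) cnj F/2\<close>; the term \<open>F/2\<close> is dropped, since it contributes only a multiple
  of the total force, which is zero for equivariant \<open>F\<close>.\<close>
definition velocity :: "(complex \<Rightarrow> complex) \<Rightarrow> complex \<Rightarrow> complex" where
  "velocity F z = stokes_const * (conv ker_log F z - conv ker_dir (cnj_fun F) z / 2)"

text \<open>The Wirtinger derivatives of the velocity.\<close>
definition velocity_z :: "(complex \<Rightarrow> complex) \<Rightarrow> complex \<Rightarrow> complex" where
  "velocity_z F z = stokes_const / 2 * (conv ker_z F z - conv ker_zbar (cnj_fun F) z)"

definition velocity_zbar :: "(complex \<Rightarrow> complex) \<Rightarrow> complex \<Rightarrow> complex" where
  "velocity_zbar F z = stokes_const / 2 * (conv ker_zbar F z + conv ker_strain (cnj_fun F) z)"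

lemma conv_anti_cauchy: "conv ker_zbar (cnj_fun F) z = cnj (conv ker_z F z)"
proof -
  have "conv ker_zbar (cnj_fun F) z = (LBINT w. cnj (ker_z (z - w) * F w))"
    unfolding conv_def ker_zbar_def ker_z_def by simp
  also have "\<dots> = cnj (LBINT w. ker_z (z - w) * F w)" by (rule Bochner_Integration.integral_cnj)
  finally show ?thesis unfolding conv_def .
qed

lemma conv_half: "conv (\<lambda>y. k y / 2) F z = conv k F z / 2"
proof -
  have "conv (\<lambda>y. k y / 2) F z = (LBINT w. (k (z - w) * F w) / 2)" by (simp add: conv_def)
  then show ?thesis by (simp only: conv_def integral_divide_zero)
qed

lemma conv_uminus: "conv (\<lambda>y. - k y) F z = - conv k F z"
  unfolding conv_def by simp

lemma velocity_wirtinger: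
  assumes q: "3 < q" and F: "decaying q A F"
  shows "wirtinger (velocity F) (velocity_z F) (velocity_zbar F)"
  unfolding wirtinger_def
proof (intro conjI allI)
  have q2: "2 < q" using q by simp
  note F' = decaying_cnj[OF F]
  fix z
  have 1: "(conv ker_log F has_derivative (\<lambda>h. conv (\<lambda>y. ker_z y / 2) F z * h + conv (\<lambda>y. ker_zbar y / 2) F z * cnj h)) (at z)"
    by (rule conv_has_derivative[OF ker_log_derivative singular_half[OF singular_ker_z] singular_half[OF singular_ker_zbar]
       measurable_ker_log ker_log_bound q F])
  have 2: "(conv ker_dir (cnj_fun F) has_derivative
     (\<lambda>h. conv ker_zbar (cnj_fun F) z * h + conv (\<lambda>y. - ker_strain y) (cnj_fun F) z * cnj h)) (at z)"
    by (rule conv_has_derivative[OF ker_dir_derivative singular_ker_zbar singular_uminus[OF singular_ker_strain]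
       measurable_ker_dir ker_dir_bound q F'])
  have "((\<lambda>z. stokes_const * (conv ker_log F z - conv ker_dir (cnj_fun F) z / 2)) has_derivative
      (\<lambda>h. stokes_const * ((conv (\<lambda>y. ker_z y / 2) F z * h + conv (\<lambda>y. ker_zbar y / 2) F z * cnj h)
      - (conv ker_zbar (cnj_fun F) z * h + conv (\<lambda>y. - ker_strain y) (cnj_fun F) z * cnj h) / 2))) (at z)"
    by (intro has_derivative_mult_right has_derivative_diff has_derivative_divide 1 2 bounded_linear.has_derivative[OF bounded_linear_divide])
  then show "(velocity F has_derivative (\<lambda>h. velocity_z F z * h + velocity_zbar F z * cnj h)) (at z)"
    unfolding velocity_def[abs_def] velocity_z_def velocity_zbar_def conv_half conv_uminus
    by (simp add: algebra_simps add_divide_distrib diff_divide_distrib)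
  show "continuous_on UNIV (velocity_z F)"
    unfolding velocity_z_def[abs_def]
    by (intro continuous_intros conv_continuous[OF q2 singular_ker_z F] conv_continuous[OF q2 singular_ker_zbar F'])
  show "continuous_on UNIV (velocity_zbar F)"
    unfolding velocity_zbar_def[abs_def]
    by (intro continuous_intros conv_continuous[OF q2 singular_ker_zbar F] conv_continuous[OF q2 singular_ker_strain F'])
qed

text \<open>The real part of \<open>\<partial>U/\<partial>z\<close> is half the divergence.\<close>
lemma velocity_div_free: "Re (velocity_z F z) = 0"
  unfolding velocity_z_def conv_anti_cauchy stokes_const_def by (simp add: complex_diff_cnj)

text \<open>The distributional derivative of the Cauchy transform: by Fubini's theorem all derivatives
  fall on the test function.\<close>
lemma cauchy_transform_weak:
  assumes q: "2 < q" and F: "decaying q A F"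
    and g: "wirtinger g a b" and z: "\<And>x. R < norm x \<Longrightarrow> g x = 0"
  shows "(LBINT x. conv ker_z F x * b x) = - of_real bump_mass * (LBINT x. F x * g x)"
proof -
  have cb: "continuous_on UNIV b" using g by (auto simp: wirtinger_def)
  have [measurable]: "b \<in> borel_measurable borel" "ker_z \<in> borel_measurable borel"
    using cb singular_ker_z by (auto intro: borel_measurable_continuous_onI singular_kernel_measurable)
  note [measurable] = decaying_measurable[OF F]
  obtain C where bd: "\<And>x. integrable lborel (\<lambda>w. ker_z (x - w) * F w) \<and> (LBINT w. norm (ker_z (x - w) * F w)) \<le> C * A"
    using conv_integrable_bounded[OF q] F singular_ker_z by blast
  have bi: "integrable lborel b"
    by (rule integrable_continuous_compact_support[OF cb wirtinger_support(2)[OF g z]])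
  define H where "H x w = ker_z (x - w) * F w * b x" for x w
  have Hm[measurable]: "case_prod H \<in> borel_measurable (lborel \<Otimes>\<^sub>M lborel)"
    unfolding H_def split_beta' by measurable
  have Hint: "integrable (lborel \<Otimes>\<^sub>M lborel) (case_prod H)"
  proof (rule lborel_pair.Fubini_integrable)
    show "integrable lborel (\<lambda>x. LBINT w. norm (case (x, w) of (x, y) \<Rightarrow> H x y))"
    proof (rule Bochner_Integration.integrable_bound)
      show "integrable lborel (\<lambda>x. C * A * norm (b x))" using bi by (intro integrable_mult_right integrable_norm) auto
      show "AE x in lborel. norm (LBINT w. norm (case (x, w) of (x, y) \<Rightarrow> H x y)) \<le> norm (C * A * norm (b x))"
      proof (rule AE_I2)
        fix x
        have "(LBINT w. norm (H x w)) = (LBINT w. norm (ker_z (x - w) * F w)) * norm (b x)"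
          unfolding H_def norm_mult[of _ "b x"] by (rule integral_mult_left_zero)
        also have "\<dots> \<le> C * A * norm (b x)" using bd by (intro mult_right_mono) auto
        finally show "norm (LBINT w. norm (case (x, w) of (x, y) \<Rightarrow> H x y)) \<le> norm (C * A * norm (b x))"
          by (simp add: abs_of_nonneg Bochner_Integration.integral_nonneg)
      qed
    qed measurable
    show "AE x in lborel. integrable lborel (\<lambda>w. case (x, w) of (x, y) \<Rightarrow> H x y)"
      unfolding H_def using bd by (auto intro!: AE_I2 integrable_mult_left)
  qed measurable
  have "(LBINT x. conv ker_z F x * b x) = (LBINT x. (LBINT w. H x w))"
    unfolding H_def conv_def by (simp only: integral_mult_left_zero)
  also have "\<dots> = (LBINT w. (LBINT x. H x w))"
    by (rule lborel_pair.Fubini_integral[OF Hint, symmetric])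
  also have "\<dots> = (LBINT w. - of_real bump_mass * (F w * g w))"
  proof (rule Bochner_Integration.integral_cong[OF refl])
    fix w
    have "(LBINT x. H x w) = (LBINT x. - F w * (1 / (w - x) * b x))"
    proof (rule Bochner_Integration.integral_cong[OF refl])
      fix x
      have "1 / (x - w) = - (1 / (w - x))" by (metis minus_diff_eq minus_divide_right)
      then show "H x w = - F w * (1 / (w - x) * b x)" by (simp add: H_def ker_z_def)
    qed
    also have "\<dots> = - F w * conv (\<lambda>y. 1 / y) b w" unfolding conv_def by (rule integral_mult_right_zero)
    also have "conv (\<lambda>y. 1 / y) b w = of_real bump_mass * g w" by (rule cauchy_pompeiu[OF g z])
    finally show "(LBINT x. H x w) = - of_real bump_mass * (F w * g w)" by (simp add: mult_ac)
  qed
  also have "\<dots> = - of_real bump_mass * (LBINT x. F x * g x)" by (rule integral_mult_right_zero)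
  finally show ?thesis .
qed

text \<open>Pressure and vorticity come from one multiple \<open>G\<close> of the Cauchy transform of \<open>F\<close>, normalised
  by \<open>\<partial>G/\<partial>(cnj z) = F/2\<close>: the pressure is \<open>- Re G\<close>, the vorticity is \<open>Im G\<close>, and
  \<open>\<partial>U/\<partial>z = i Im G/2\<close>.\<close>
definition pressure :: "(complex \<Rightarrow> complex) \<Rightarrow> complex \<Rightarrow> real" where
  "pressure F z = - Re (2 * stokes_const * conv ker_z F z)"

text \<open>For real \<open>g\<close>, \<open>4 e\<close> is the Laplacian of \<open>g\<close> and \<open>2 b\<close> its gradient in complex notation, so
  this is the momentum equation tested with \<open>g\<close>.\<close>
lemma stokes_weak:
  assumes q: "3 < q" and F: "decaying q A F"
    and g: "wirtinger g a b" and b: "wirtinger b e d" and z: "\<And>x. R < norm x \<Longrightarrow> g x = 0"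
  shows "(LBINT x. velocity F x * (4 * e x)) + (LBINT x. of_real (pressure F x) * (2 * b x))
    = (LBINT x. F x * g x)"
proof -
  have q2: "2 < q" using q by simp
  note V = velocity_wirtinger[OF q F]
  have zb: "\<And>x. R < norm x \<Longrightarrow> b x = 0" by (rule wirtinger_support(2)[OF g z])
  have cb: "continuous_on UNIV b" and cV: "continuous_on UNIV (velocity_z F)"
    using g V by (auto simp: wirtinger_def)
  have cP: "continuous_on UNIV (\<lambda>x. complex_of_real (pressure F x))"
    unfolding pressure_def by (intro continuous_intros conv_continuous[OF q2 singular_ker_z F])
  have i1: "integrable lborel (\<lambda>x. -4 * (velocity_z F x * b x))"
    by (rule integrable_continuous_compact_support[of _ R]) (auto intro!: continuous_intros cb cV simp: zb)
  have i2: "integrable lborel (\<lambda>x. of_real (pressure F x) * (2 * b x))"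
    by (rule integrable_continuous_compact_support[of _ R]) (auto intro!: continuous_intros cb cP simp: zb)
  have "(LBINT x. velocity F x * (4 * e x)) = 4 * (LBINT x. velocity F x * e x)"
    by (simp add: mult.left_commute[of _ 4])
  also have "\<dots> = -4 * (LBINT x. velocity_z F x * b x)"
    using wirtinger_by_parts(1)[OF V b zb] by simp
  also have "\<dots> = (LBINT x. -4 * (velocity_z F x * b x))" by (rule integral_mult_right_zero[symmetric])
  finally have "(LBINT x. velocity F x * (4 * e x)) + (LBINT x. of_real (pressure F x) * (2 * b x))
      = (LBINT x. -4 * (velocity_z F x * b x)) + (LBINT x. of_real (pressure F x) * (2 * b x))"
    by simp
  also have "\<dots> = (LBINT x. -4 * (velocity_z F x * b x) + of_real (pressure F x) * (2 * b x))"
    by (rule Bochner_Integration.integral_add[symmetric, OF i1 i2])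
  also have "\<dots> = (LBINT x. - (4 * stokes_const) * (conv ker_z F x * b x))"
  proof (rule Bochner_Integration.integral_cong[OF refl])
    fix x
    let ?X = "conv ker_z F x"
    have "of_real (pressure F x) = - (stokes_const * (?X + cnj ?X))"
      by (simp add: pressure_def complex_add_cnj stokes_const_def complex_eq_iff)
    then show "-4 * (velocity_z F x * b x) + of_real (pressure F x) * (2 * b x) = - (4 * stokes_const) * (?X * b x)"
      unfolding velocity_z_def conv_anti_cauchy by (simp only:) (simp add: algebra_simps)
  qed
  also have "\<dots> = - (4 * stokes_const) * (LBINT x. conv ker_z F x * b x)" by (rule integral_mult_right_zero)
  also have "\<dots> = 4 * stokes_const * of_real bump_mass * (LBINT x. F x * g x)"
    by (subst cauchy_transform_weak[OF q2 F g z]) simp_all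
  also have "4 * stokes_const * of_real bump_mass = 1" using bump_mass_pos by (simp add: stokes_const_def)
  finally show ?thesis by simp
qed

section \<open>Symmetry and vanishing moments\<close>

lemma conv_rotate:
  assumes k: "k \<in> borel_measurable borel" and F: "F \<in> borel_measurable borel"
    and ki: "\<And>y. k (\<i> * y) = \<alpha> * k y" and Fi: "\<And>w. F (\<i> * w) = \<beta> * F w"
  shows "conv k F (\<i> * z) = \<alpha> * \<beta> * conv k F z"
proof -
  note [measurable] = k F
  have "conv k F (\<i> * z) = (LBINT w. k (\<i> * z - \<i> * w) * F (\<i> * w))"
    unfolding conv_def by (rule integral_lborel_ii[symmetric]) measurable
  also have "\<dots> = (LBINT w. \<alpha> * \<beta> * (k (z - w) * F w))"
  proof (rule Bochner_Integration.integral_cong[OF refl])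
    fix w
    have "\<i> * z - \<i> * w = \<i> * (z - w)" by (simp add: algebra_simps)
    then show "k (\<i> * z - \<i> * w) * F (\<i> * w) = \<alpha> * \<beta> * (k (z - w) * F w)"
      by (simp only: ki Fi mult_ac)
  qed
  also have "\<dots> = \<alpha> * \<beta> * conv k F z" unfolding conv_def by (rule integral_mult_right_zero)
  finally show ?thesis .
qed

lemma conv_conjugate:
  assumes k: "k \<in> borel_measurable borel" and F: "F \<in> borel_measurable borel"
    and ki: "\<And>y. k (cnj y) = cnj (k y)" and Fi: "\<And>w. F (cnj w) = cnj (F w)"
  shows "conv k F (cnj z) = cnj (conv k F z)"
proof -
  note [measurable] = k F
  have "conv k F (cnj z) = (LBINT w. k (cnj z - cnj w) * F (cnj w))"
    unfolding conv_def by (rule integral_lborel_cnj[symmetric]) measurable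
  also have "\<dots> = (LBINT w. cnj (k (z - w) * F w))"
    by (simp add: ki Fi flip: complex_cnj_diff)
  also have "\<dots> = cnj (conv k F z)" unfolding conv_def by (rule Bochner_Integration.integral_cnj)
  finally show ?thesis .
qed

text \<open>Under rotation by a right angle each kernel is multiplied by a constant of modulus one, and
  these constants combine with those of \<open>F\<close> and \<open>cnj F\<close>.\<close>
lemma velocity_equivariant:
  assumes F: "equivariant F" and m: "F \<in> borel_measurable borel"
  shows "equivariant (velocity F)"
    and "velocity_z F (\<i> * z) = velocity_z F z" "velocity_z F (cnj z) = cnj (velocity_z F z)"
    and "velocity_zbar F (\<i> * z) = - velocity_zbar F z" "velocity_zbar F (cnj z) = cnj (velocity_zbar F z)"
proof -
  note [measurable] = m
  have mc: "(cnj_fun F) \<in> borel_measurable borel" by measurable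
  have Fi: "F (\<i> * w) = \<i> * F w" and Fc: "F (cnj w) = cnj (F w)" for w
    using F unfolding equivariant_def by auto
  have Gi: "cnj (F (\<i> * w)) = - \<i> * cnj (F w)" and Gc: "cnj (F (cnj w)) = cnj (cnj (F w))" for w
    by (simp_all add: Fi Fc)
  have cc: "cnj stokes_const = stokes_const" by (simp add: stokes_const_def)
  note ms = singular_kernel_measurable[OF singular_ker_z] singular_kernel_measurable[OF singular_ker_zbar]
    singular_kernel_measurable[OF singular_ker_strain]
  have lr: "ker_log (\<i> * y) = 1 * ker_log y" "ker_dir (\<i> * y) = (- 1) * ker_dir y" "ker_z (\<i> * y) = - \<i> * ker_z y"
    "ker_zbar (\<i> * y) = \<i> * ker_zbar y" "ker_strain (\<i> * y) = - \<i> * ker_strain y" for y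
    by (simp_all add: ker_log_def ker_dir_def ker_z_def ker_zbar_def ker_strain_def norm_mult power_mult_distrib
        divide_simps)
  have lc: "ker_log (cnj y) = cnj (ker_log y)" "ker_dir (cnj y) = cnj (ker_dir y)" "ker_z (cnj y) = cnj (ker_z y)"
    "ker_zbar (cnj y) = cnj (ker_zbar y)" "ker_strain (cnj y) = cnj (ker_strain y)" for y
    by (simp_all add: ker_log_def ker_dir_def ker_z_def ker_zbar_def ker_strain_def)
  note r = conv_rotate[OF measurable_ker_log m lr(1) Fi] conv_rotate[OF measurable_ker_dir mc lr(2) Gi]
    conv_rotate[OF ms(1) m lr(3) Fi] conv_rotate[OF ms(2) m lr(4) Fi]
    conv_rotate[OF ms(2) mc lr(4) Gi] conv_rotate[OF ms(3) mc lr(5) Gi]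
  note c = conv_conjugate[OF measurable_ker_log m lc(1) Fc] conv_conjugate[OF measurable_ker_dir mc lc(2) Gc]
    conv_conjugate[OF ms(1) m lc(3) Fc] conv_conjugate[OF ms(2) m lc(4) Fc]
    conv_conjugate[OF ms(2) mc lc(4) Gc] conv_conjugate[OF ms(3) mc lc(5) Gc]
  show "equivariant (velocity F)"
    unfolding equivariant_def velocity_def r c by (auto simp: cc algebra_simps)
  show "velocity_z F (\<i> * z) = velocity_z F z" unfolding velocity_z_def r by simp
  show "velocity_z F (cnj z) = cnj (velocity_z F z)" unfolding velocity_z_def c by (simp add: cc)
  show "velocity_zbar F (\<i> * z) = - velocity_zbar F z" unfolding velocity_zbar_def r by (simp add: algebra_simps)
  show "velocity_zbar F (cnj z) = cnj (velocity_zbar F z)" unfolding velocity_zbar_def c by (simp add: cc)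
qed

lemma moment_vanishes:
  fixes g :: "complex \<Rightarrow> complex"
  assumes g: "g \<in> borel_measurable borel" and r: "\<And>w. g (\<i> * w) = \<alpha> * g w" and \<alpha>: "\<alpha> \<noteq> 1"
  shows "(LBINT w. g w) = 0"
proof -
  have "(LBINT w. g w) = (LBINT w. g (\<i> * w))" by (rule integral_lborel_ii[OF g, symmetric])
  also have "\<dots> = \<alpha> * (LBINT w. g w)" unfolding r by (rule integral_mult_right_zero)
  finally show ?thesis using \<alpha> by simp
qed

lemma moment_integrable:
  assumes q: "4 < q" and F: "decaying q A F" and mn: "m + n \<le> 2"
  shows "integrable lborel (\<lambda>w. w ^ m * cnj w ^ n * F w)"
proof (rule integrable_product_bound(1)[OF _ F])
  note [measurable] = decaying_measurable[OF F]
  show "integrable lborel (\<lambda>w::complex. wt (- q) w * norm w ^ (m + n))"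
    by (rule integrable_weight_moment) (use q mn in linarith)
  show "(\<lambda>w. w ^ m * cnj w ^ n * F w) \<in> borel_measurable borel" by measurable
  show "norm (w ^ m * cnj w ^ n) \<le> norm w ^ (m + n)" for w
    by (simp add: norm_mult norm_power power_add)
qed

section \<open>Decay of the Stokes solution\<close>

text \<open>If \<open>P\<close> approximates the kernel to third order in \<open>w\<close>, then the convolution agrees with the
  integral of \<open>P F\<close> up to \<open>O(|z|\<^bsup>1-q\<^esup>)\<close>.\<close>
lemma conv_decay:
  fixes q :: real
  assumes q: "4 < q" "q < 5"
  shows "\<exists>C\<ge>0. \<forall>k F A z P. singular_kernel k \<longrightarrow> decaying q A F \<longrightarrow> z \<noteq> 0 \<longrightarrow>
      integrable lborel (\<lambda>w. P w * F w) \<longrightarrow> P \<in> borel_measurable borel \<longrightarrow>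
      (\<forall>w. w \<noteq> z \<longrightarrow> norm (k (z - w) - P w) \<le> 7 * norm w ^ 3 / (norm z ^ 3 * norm (z - w))) \<longrightarrow>
      norm (conv k F z - (LBINT w. P w * F w)) \<le> C * A * norm z powr (1 - q)"
proof -
  define s where "s = q - 3"
  have s: "1 < s" "s < 2" using q by (auto simp: s_def)
  obtain C where C: "C \<ge> 0" and bd: "\<And>z::complex. z \<noteq> 0 \<Longrightarrow>
      integrable lborel (\<lambda>w. norm w powr (- s) / norm (z - w)) \<and>
      (LBINT w. norm w powr (- s) / norm (z - w)) \<le> C * norm z powr (1 - s)"
    using riesz_newton_decay[OF s] by blast
  have "norm (conv k F z - (LBINT w. P w * F w)) \<le> 7 * C * A * norm z powr (1 - q)"
    if k: "singular_kernel k" and F: "decaying q A F" and z: "z \<noteq> 0"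
      and iP: "integrable lborel (\<lambda>w. P w * F w)" and Pm: "P \<in> borel_measurable borel"
      and b: "\<And>w. w \<noteq> z \<Longrightarrow> norm (k (z - w) - P w) \<le> 7 * norm w ^ 3 / (norm z ^ 3 * norm (z - w))"
    for k F A z P
  proof -
    note [measurable] = singular_kernel_measurable[OF k] decaying_measurable[OF F] Pm
    have q2: "2 < q" using q by simp
    have A: "0 \<le> A" by (rule decaying_nonneg[OF F])
    \<comment> \<open>At \<open>w = z\<close> the bound on the remainder reads \<open>0\<close> and may fail, so that point is cut out.\<close>
    define R where "R w = (if w = z then 0 else k (z - w) - P w)" for w
    define g where "g w = 7 * norm w ^ 3 / (norm z ^ 3 * norm (z - w))" for w
    have Rg: "norm (R w) \<le> g w" for w using b[of w] by (simp add: R_def g_def)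
    have le: "wt (- q) w * g w \<le> 7 / norm z ^ 3 * (norm w powr (- s) / norm (z - w))" for w
    proof (cases "w = 0")
      case False
      have "wt (- q) w \<le> norm w powr (- q)" using False q by (intro powr_mono2') auto
      then have "wt (- q) w * norm w ^ 3 \<le> norm w powr (- q) * norm w powr 3"
        using False by (intro mult_mono) (auto simp: powr_numeral)
      also have "\<dots> = norm w powr (- s)" by (simp add: powr_add[symmetric] s_def del: powr_numeral)
      finally have "7 / (norm z ^ 3 * norm (z - w)) * (wt (- q) w * norm w ^ 3)
         \<le> 7 / (norm z ^ 3 * norm (z - w)) * norm w powr (- s)" by (intro mult_left_mono) auto
      then show ?thesis by (simp add: g_def field_simps)
    qed (simp add: g_def)
    have dom': "integrable lborel (\<lambda>w. 7 / norm z ^ 3 * (norm w powr (- s) / norm (z - w)))"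
      using bd[OF z] by (intro integrable_mult_right) auto
    have dom: "integrable lborel (\<lambda>w. wt (- q) w * g w)"
    proof (rule Bochner_Integration.integrable_bound[OF dom'])
      show "(\<lambda>w. wt (- q) w * g w) \<in> borel_measurable lborel"
        unfolding g_def by measurable
      show "AE w in lborel. norm (wt (- q) w * g w)
          \<le> norm (7 / norm z ^ 3 * (norm w powr (- s) / norm (z - w)))"
      proof (rule AE_I2)
        fix w
        have "0 \<le> wt (- q) w * g w" by (simp add: g_def)
        with le[of w] show "norm (wt (- q) w * g w)
          \<le> norm (7 / norm z ^ 3 * (norm w powr (- s) / norm (z - w)))" by simp
      qed
    qed
    have Rm: "(\<lambda>w. R w * F w) \<in> borel_measurable borel" unfolding R_def by measurable
    have "conv k F z - (LBINT w. P w * F w) = (LBINT w. k (z - w) * F w - P w * F w)"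
      unfolding conv_def
      by (rule Bochner_Integration.integral_diff[symmetric, OF conv_integrable[OF q2 k F] iP])
    also have "\<dots> = (LBINT w. R w * F w)"
    proof (rule integral_cong_AE)
      have "AE w in lborel. w \<noteq> z" by (rule AE_lborel_singleton)
      then show "AE w in lborel. k (z - w) * F w - P w * F w = R w * F w"
        by eventually_elim (simp add: R_def left_diff_distrib)
    qed (use Rm in \<open>auto\<close>)
    also have "norm \<dots> \<le> A * (LBINT w. wt (- q) w * g w)"
      by (rule order_trans[OF integral_norm_bound integrable_product_bound(2)[OF dom F Rm Rg]])
    also have "\<dots> \<le> A * (LBINT w. 7 / norm z ^ 3 * (norm w powr (- s) / norm (z - w)))"
      using A by (intro mult_left_mono integral_mono[OF dom dom' le]) auto
    also have "\<dots> = A * (7 / norm z ^ 3 * (LBINT w. norm w powr (- s) / norm (z - w)))"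
      by (simp only: integral_mult_right_zero)
    also have "\<dots> \<le> A * (7 / norm z ^ 3 * (C * norm z powr (1 - s)))"
      using A bd[OF z] by (intro mult_left_mono) auto
    also have "\<dots> = 7 * C * A * (norm z powr (- 3) * norm z powr (1 - s))"
      using z by (simp add: powr_minus powr_numeral field_simps)
    also have "norm z powr (- 3) * norm z powr (1 - s) = norm z powr (1 - q)"
      by (simp add: powr_add[symmetric] s_def)
    finally show ?thesis .
  qed
  then show ?thesis using C by (intro exI[of _ "7 * C"]) auto
qed

text \<open>The Taylor polynomials of degree two in \<open>w\<close> and \<open>cnj w\<close> of \<open>1/(z - w)\<close> and of
  \<open>(z - w)/(cnj (z - w))\<^sup>2\<close>.  It is essential to truncate the second one at total degree
  two, as moments of order three need not converge.\<close>
abbreviation taylor :: "complex \<Rightarrow> complex \<Rightarrow> complex" where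
  "taylor z w \<equiv> 1 / z + w / z\<^sup>2 + w\<^sup>2 / z ^ 3"

abbreviation strain_taylor :: "complex \<Rightarrow> complex \<Rightarrow> complex" where
  "strain_taylor z w \<equiv>
    (z - w) * (1 / (cnj z)\<^sup>2 + 2 * cnj w / cnj z ^ 3) + 3 * z * (cnj w)\<^sup>2 / cnj z ^ 4"

text \<open>The remainders are computed exactly, not estimated for small \<open>w\<close>, and hence are controlled
  uniformly in \<open>w\<close>.\<close>
lemma kernel_taylor:
  fixes z w :: complex
  assumes z: "z \<noteq> 0" and w: "w \<noteq> z"
  shows "norm (ker_z (z - w) - taylor z w) \<le> 7 * norm w ^ 3 / (norm z ^ 3 * norm (z - w))"
    and "norm (ker_zbar (z - w) - taylor (cnj z) (cnj w)) \<le> 7 * norm w ^ 3 / (norm z ^ 3 * norm (z - w))"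
    and "norm (ker_strain (z - w) - strain_taylor z w)
       \<le> 7 * norm w ^ 3 / (norm z ^ 3 * norm (z - w))"
proof -
  have geo: "1 / (a - b) - (1 / a + b / a\<^sup>2 + b\<^sup>2 / a ^ 3) = b ^ 3 / (a ^ 3 * (a - b))"
    if "a \<noteq> 0" "a - b \<noteq> 0" for a b :: complex
    using that by (simp add: divide_simps) (simp add: algebra_simps power2_eq_square power3_eq_cube)
  have zw: "z - w \<noteq> 0" "cnj z - cnj w \<noteq> 0" "cnj z \<noteq> 0" using z w by auto
  have b1: "norm w ^ 3 / (norm z ^ 3 * norm (z - w)) \<le> 7 * norm w ^ 3 / (norm z ^ 3 * norm (z - w))"
    by (intro divide_right_mono) auto
  have nc: "norm (cnj z - cnj w) = norm (z - w)" by (metis complex_cnj_diff complex_mod_cnj)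
  show "norm (ker_z (z - w) - taylor z w) \<le> 7 * norm w ^ 3 / (norm z ^ 3 * norm (z - w))"
    unfolding ker_z_def geo[OF z zw(1)] using b1 by (simp add: norm_divide norm_mult norm_power)
  show "norm (ker_zbar (z - w) - taylor (cnj z) (cnj w)) \<le> 7 * norm w ^ 3 / (norm z ^ 3 * norm (z - w))"
    unfolding ker_zbar_def complex_cnj_diff geo[OF zw(3) zw(2)] using b1
    by (simp add: norm_divide norm_mult norm_power nc)
  \<comment> \<open>The second term on the right contains \<open>z b - w a\<close>, which supplies a further factor \<open>|w|\<close>.\<close>
  have alg: "(z - w) / (a - b)\<^sup>2 - ((z - w) * (1 / a\<^sup>2 + 2 * b / a ^ 3) + 3 * z * b\<^sup>2 / a ^ 4)
      = (z - w) * b ^ 3 / (a ^ 3 * (a - b)\<^sup>2) + 3 * b\<^sup>2 * (z * b - w * a) / (a ^ 4 * (a - b))"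
    if "a \<noteq> 0" "a - b \<noteq> 0" for a b :: complex
  proof -
    have "(a - b)\<^sup>2 * a ^ 4 * ((z - w) / (a - b)\<^sup>2 - ((z - w) * (1 / a\<^sup>2 + 2 * b / a ^ 3) + 3 * z * b\<^sup>2 / a ^ 4))
        = (z - w) * a ^ 4 - (a - b)\<^sup>2 * ((z - w) * (a\<^sup>2 + 2 * b * a) + 3 * z * b\<^sup>2)"
    proof -
      have "D\<^sup>2 * a ^ 4 * (p / D\<^sup>2 - (p * (1 / a\<^sup>2 + 2 * b / a ^ 3) + r / a ^ 4))
          = p * a ^ 4 - D\<^sup>2 * (p * (a\<^sup>2 + 2 * b * a) + r)" if "D \<noteq> 0" for D p r
        using that \<open>a \<noteq> 0\<close> by (simp add: field_simps power2_eq_square power3_eq_cube power4_eq_xxxx)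
      then show ?thesis using that(2) by blast
    qed
    also have "\<dots> = (z - w) * b ^ 3 * a + 3 * b\<^sup>2 * (z * b - w * a) * (a - b)"
      by (simp add: power2_eq_square power3_eq_cube power4_eq_xxxx algebra_simps)
    also have "\<dots> = (a - b)\<^sup>2 * a ^ 4 * ((z - w) * b ^ 3 / (a ^ 3 * (a - b)\<^sup>2) + 3 * b\<^sup>2 * (z * b - w * a) / (a ^ 4 * (a - b)))"
    proof -
      have "D\<^sup>2 * a ^ 4 * (p / (a ^ 3 * D\<^sup>2) + r / (a ^ 4 * D)) = p * a + r * D" if "D \<noteq> 0" for D p r
        using that \<open>a \<noteq> 0\<close> by (simp add: field_simps power2_eq_square power3_eq_cube power4_eq_xxxx)
      then show ?thesis using that(2) by simp
    qed
    finally show ?thesis using that by simp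
  qed
  have "ker_strain (z - w) - strain_taylor z w
      = (z - w) * cnj w ^ 3 / (cnj z ^ 3 * (cnj z - cnj w)\<^sup>2)
        + 3 * (cnj w)\<^sup>2 * (z * cnj w - w * cnj z) / (cnj z ^ 4 * (cnj z - cnj w))"
    unfolding ker_strain_def complex_cnj_diff by (rule alg[OF zw(3) zw(2)])
  also have "norm \<dots> \<le> norm ((z - w) * cnj w ^ 3 / (cnj z ^ 3 * (cnj z - cnj w)\<^sup>2))
      + norm (3 * (cnj w)\<^sup>2 * (z * cnj w - w * cnj z) / (cnj z ^ 4 * (cnj z - cnj w)))"
    by (rule norm_triangle_ineq)
  also have "\<dots> \<le> norm w ^ 3 / (norm z ^ 3 * norm (z - w)) + 6 * norm w ^ 3 / (norm z ^ 3 * norm (z - w))"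
  proof (rule add_mono)
    show "norm ((z - w) * cnj w ^ 3 / (cnj z ^ 3 * (cnj z - cnj w)\<^sup>2)) \<le> norm w ^ 3 / (norm z ^ 3 * norm (z - w))"
      using zw z by (simp add: norm_divide norm_mult norm_power nc power2_eq_square)
    have "norm (z * cnj w - w * cnj z) \<le> norm (z * cnj w) + norm (w * cnj z)" by (rule norm_triangle_ineq4)
    then have "norm (z * cnj w - w * cnj z) \<le> 2 * (norm z * norm w)" by (simp add: norm_mult mult.commute)
    then have "3 * (norm w)\<^sup>2 * norm (z * cnj w - w * cnj z) \<le> 3 * (norm w)\<^sup>2 * (2 * (norm z * norm w))"
      by (intro mult_left_mono) auto
    then have "3 * (norm w)\<^sup>2 * norm (z * cnj w - w * cnj z) / (norm z ^ 4 * norm (z - w))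
        \<le> 3 * (norm w)\<^sup>2 * (2 * (norm z * norm w)) / (norm z ^ 4 * norm (z - w))"
      by (intro divide_right_mono) auto
    also have "\<dots> = 6 * norm w ^ 3 / (norm z ^ 3 * norm (z - w))"
      using zw z by (simp add: field_simps power2_eq_square power3_eq_cube power4_eq_xxxx)
    finally show "norm (3 * (cnj w)\<^sup>2 * (z * cnj w - w * cnj z) / (cnj z ^ 4 * (cnj z - cnj w)))
        \<le> 6 * norm w ^ 3 / (norm z ^ 3 * norm (z - w))"
      by (simp add: norm_divide norm_mult norm_power nc)
  qed
  also have "\<dots> = 7 * norm w ^ 3 / (norm z ^ 3 * norm (z - w))"
  proof -
    have "p / x + 6 * p / x = 7 * p / x" for p x :: real by (simp flip: add_divide_distrib)
    then show ?thesis by blast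
  qed
  finally show "norm (ker_strain (z - w) - strain_taylor z w)
       \<le> 7 * norm w ^ 3 / (norm z ^ 3 * norm (z - w))" .
qed

text \<open>A moment \<open>\<integral> w\<^sup>m (cnj w)\<^sup>n F\<close> is multiplied by \<open>i\<^bsup>m-n+1\<^esup>\<close> under rotation and hence vanishes
  unless \<open>n - m - 1\<close> is divisible by four.  Of total order at most two only \<open>\<integral> cnj w F\<close>
  survives.  The reflection makes it real, so that the last two integrals are opposite.\<close>
lemma equivariant_moments:
  assumes q: "4 < q" and F: "decaying q A F" and e: "equivariant F"
  defines "m \<equiv> (LBINT w. cnj w * F w)"
  shows "integrable lborel (\<lambda>w. taylor z w * F w)"
    and "(LBINT w. taylor z w * F w) = 0"
    and "integrable lborel (\<lambda>w. taylor (cnj z) (cnj w) * F w)"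
    and "(LBINT w. taylor (cnj z) (cnj w) * F w) = m / (cnj z)\<^sup>2"
    and "integrable lborel (\<lambda>w. strain_taylor z w * cnj (F w))"
    and "(LBINT w. strain_taylor z w * cnj (F w))
      = - m / (cnj z)\<^sup>2"
proof -
  note [measurable] = decaying_measurable[OF F]
  have Fi: "F (\<i> * w) = \<i> * F w" and Fc: "F (cnj w) = cnj (F w)" for w
    using e unfolding equivariant_def by auto
  note F' = decaying_cnj[OF F]
  have i: "integrable lborel (\<lambda>w. w ^ a * cnj w ^ b * F w)" "integrable lborel (\<lambda>w. w ^ a * cnj w ^ b * cnj (F w))"
    if "a + b \<le> 2" for a b
    using moment_integrable[OF q F that] moment_integrable[OF q F' that] by auto
  have iF: "integrable lborel F" "integrable lborel (\<lambda>w. w * F w)" "integrable lborel (\<lambda>w. w\<^sup>2 * F w)"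
    "integrable lborel (\<lambda>w. cnj w * F w)" "integrable lborel (\<lambda>w. (cnj w)\<^sup>2 * F w)"
    using i(1)[of 0 0] i(1)[of 1 0] i(1)[of 2 0] i(1)[of 0 1] i(1)[of 0 2] by simp_all
  have iG: "integrable lborel (cnj_fun F)" "integrable lborel (\<lambda>w. w * cnj (F w))"
    "integrable lborel (\<lambda>w. cnj w * cnj (F w))" "integrable lborel (\<lambda>w. w * cnj w * cnj (F w))"
    "integrable lborel (\<lambda>w. (cnj w)\<^sup>2 * cnj (F w))"
    using i(2)[of 0 0] i(2)[of 1 0] i(2)[of 0 1] i(2)[of 1 1] i(2)[of 0 2] by simp_all
  have i1: "\<i> \<noteq> 1" by (simp add: complex_eq_iff)
  have mF: "(LBINT w. F w) = 0"
    by (rule moment_vanishes[where \<alpha>="\<i>"]) (auto simp: Fi i1)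
  have mwF: "(LBINT w. w * F w) = 0"
    by (rule moment_vanishes[where \<alpha>="-1"]) (unfold Fi, auto simp: algebra_simps)
  have mwwF: "(LBINT w. w\<^sup>2 * F w) = 0"
    by (rule moment_vanishes[where \<alpha>="-\<i>"]) (auto simp: Fi i1 power_mult_distrib complex_eq_iff)
  have mccF: "(LBINT w. (cnj w)\<^sup>2 * F w) = 0"
    by (rule moment_vanishes[where \<alpha>="-\<i>"]) (auto simp: Fi i1 power_mult_distrib complex_eq_iff)
  have mG: "(LBINT w. cnj (F w)) = 0" by (simp add: mF)
  have mcG: "(LBINT w. cnj w * cnj (F w)) = 0"
    by (rule moment_vanishes[where \<alpha>="-1"]) (unfold Fi, auto simp: algebra_simps)
  have mwcG: "(LBINT w. w * cnj w * cnj (F w)) = 0"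
    by (rule moment_vanishes[where \<alpha>="-\<i>"]) (unfold Fi, auto simp: algebra_simps complex_eq_iff)
  have mccG: "(LBINT w. (cnj w)\<^sup>2 * cnj (F w)) = 0"
    by (rule moment_vanishes[where \<alpha>="\<i>"]) (auto simp: Fi i1 power_mult_distrib)
  have mwG: "(LBINT w. w * cnj (F w)) = m"
  proof -
    have "m = (LBINT w. cnj (cnj w) * F (cnj w))"
      unfolding m_def by (rule integral_lborel_cnj[symmetric]) measurable
    then show ?thesis by (simp add: Fc)
  qed
  have e1: "taylor z w * F w = 1 / z * F w + 1 / z\<^sup>2 * (w * F w) + 1 / z ^ 3 * (w\<^sup>2 * F w)" for w
    by (simp add: distrib_right)
  show "integrable lborel (\<lambda>w. taylor z w * F w)"
    unfolding e1 by (intro Bochner_Integration.integrable_add integrable_mult_right iF)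
  show "(LBINT w. taylor z w * F w) = 0"
    unfolding e1 using iF by (simp add: mF mwF mwwF del: times_divide_eq_left)
  have e2: "taylor (cnj z) (cnj w) * F w
      = 1 / cnj z * F w + 1 / (cnj z)\<^sup>2 * (cnj w * F w) + 1 / cnj z ^ 3 * ((cnj w)\<^sup>2 * F w)" for w
    by (simp add: distrib_right)
  show "integrable lborel (\<lambda>w. taylor (cnj z) (cnj w) * F w)"
    unfolding e2 by (intro Bochner_Integration.integrable_add integrable_mult_right iF)
  show "(LBINT w. taylor (cnj z) (cnj w) * F w) = m / (cnj z)\<^sup>2"
    unfolding e2 using iF by (simp add: mF mccF m_def del: times_divide_eq_left) simp
  have e3: "strain_taylor z w * cnj (F w)
      = z / (cnj z)\<^sup>2 * cnj (F w) + (- 1 / (cnj z)\<^sup>2) * (w * cnj (F w)) + 2 * z / cnj z ^ 3 * (cnj w * cnj (F w))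
        + (- 2 / cnj z ^ 3) * (w * cnj w * cnj (F w)) + 3 * z / cnj z ^ 4 * ((cnj w)\<^sup>2 * cnj (F w))" for w
    by (simp add: algebra_simps add_divide_distrib diff_divide_distrib)
  show "integrable lborel (\<lambda>w. strain_taylor z w * cnj (F w))"
    unfolding e3 by (intro Bochner_Integration.integrable_add integrable_mult_right iG)
  show "(LBINT w. strain_taylor z w * cnj (F w))
      = - m / (cnj z)\<^sup>2"
  proof -
    have "(LBINT w. c1 * f1 w + c2 * f2 w + c3 * f3 w + c4 * f4 w + c5 * f5 w)
      = c1 * (LBINT w. f1 w) + c2 * (LBINT w. f2 w) + c3 * (LBINT w. f3 w)
        + c4 * (LBINT w. f4 w) + c5 * (LBINT w. f5 w)"
      if "integrable lborel f1" "integrable lborel f2" "integrable lborel f3" "integrable lborel f4" "integrable lborel f5"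
      for c1 c2 c3 c4 c5 and f1 f2 f3 f4 f5 :: "complex \<Rightarrow> complex"
      using that by simp
    from this[OF iG] show ?thesis unfolding e3 by (simp only: mG mwG mcG mwcG mccG) simp
  qed
qed

text \<open>Halving the distance to the origin costs only a constant factor in the weight.\<close>
lemma weight_half:
  fixes z x :: complex
  assumes q: "1 \<le> q" and x: "1 + norm z \<le> 2 * (1 + norm x)"
  shows "wt (1 - q) x \<le> 2 powr (q - 1) * wt (1 - q) z"
proof -
  have "wt (1 - q) x \<le> ((1 + norm z) / 2) powr (1 - q)"
    using q x by (intro powr_mono2') (auto simp: add_pos_nonneg)
  also have "\<dots> = 2 powr (q - 1) * wt (1 - q) z"
    by (simp add: powr_divide powr_diff field_simps)
  finally show ?thesis .
qed

lemma weighted_decay: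
  fixes z :: complex
  assumes q: "1 < q" and B: "0 \<le> B" and b: "x \<le> B" and d: "z \<noteq> 0 \<Longrightarrow> x \<le> B * norm z powr (1 - q)"
  shows "x \<le> 2 powr (q - 1) * B * wt (1 - q) z"
proof (cases "norm z \<le> 1")
  case True
  have "1 \<le> 2 powr (q - 1) * wt (1 - q) z"
    using weight_half[of q z 0] q True by simp
  then have "B * 1 \<le> B * (2 powr (q - 1) * wt (1 - q) z)" using B by (rule mult_left_mono)
  then show ?thesis using b by (simp add: mult_ac)
next
  case False
  have "norm z powr (1 - q) \<le> ((1 + norm z) / 2) powr (1 - q)"
    using q False by (intro powr_mono2') (auto simp: add_pos_nonneg)
  also have "\<dots> = 2 powr (q - 1) * wt (1 - q) z"
    by (simp add: powr_divide powr_diff field_simps)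
  finally have "B * norm z powr (1 - q) \<le> B * (2 powr (q - 1) * wt (1 - q) z)"
    using B by (rule mult_left_mono)
  moreover have "z \<noteq> 0" using False by auto
  ultimately show ?thesis using d by (simp add: mult_ac)
qed

lemma rotation_segment:
  assumes x: "x \<in> closed_segment z (\<i> * z)"
  shows "1 + norm z \<le> 2 * (1 + norm x)"
proof -
  obtain t where t: "0 \<le> t" "t \<le> 1" "x = (1 - t) *\<^sub>R z + t *\<^sub>R (\<i> * z)"
    using x unfolding closed_segment_def by auto
  have "x = Complex (1 - t) t * z"
    unfolding t(3) by (simp add: complex_eq_iff)
  then have n: "norm x = norm (Complex (1 - t) t) * norm z" by (simp add: norm_mult)
  have "1 - t \<le> norm (Complex (1 - t) t)" "t \<le> norm (Complex (1 - t) t)"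
    using abs_Re_le_cmod[of "Complex (1 - t) t"] abs_Im_le_cmod[of "Complex (1 - t) t"] by auto
  then have "1 / 2 \<le> norm (Complex (1 - t) t)" by linarith
  then have "1 / 2 * norm z \<le> norm x" unfolding n by (rule mult_right_mono) simp
  then show ?thesis by simp
qed

text \<open>Since \<open>u (i z) - u z = (i - 1) u z\<close>, the values of an equivariant field are controlled by its
  gradient along the segment from \<open>z\<close> to \<open>i z\<close>, which stays away from the origin.\<close>
lemma equivariant_decay:
  assumes w: "wirtinger u a b" and e: "equivariant u" and q: "1 < q"
    and a: "\<And>x. norm (a x) \<le> B * wt (1 - q) x"
    and b: "\<And>x. norm (b x) \<le> B * wt (1 - q) x" and B: "0 \<le> B"
  shows "norm (u z) \<le> 4 * 2 powr (q - 1) * B * wt (2 - q) z"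
proof -
  define M where "M = 2 * (B * (2 powr (q - 1) * wt (1 - q) z))"
  have "norm (u (\<i> * z) - u z) \<le> M * norm (\<i> * z - z)"
  proof (rule differentiable_bound[OF convex_closed_segment])
    fix x assume x: "x \<in> closed_segment z (\<i> * z)"
    show "(u has_derivative (\<lambda>h. a x * h + b x * cnj h)) (at x within closed_segment z (\<i> * z))"
      using w unfolding wirtinger_def by (blast intro: has_derivative_at_withinI)
    show "onorm (\<lambda>h. a x * h + b x * cnj h) \<le> M"
    proof (rule onorm_le)
      fix h
      have "wt (1 - q) x \<le> 2 powr (q - 1) * wt (1 - q) z"
        using q by (intro weight_half rotation_segment x) auto
      then have le: "B * wt (1 - q) x \<le> B * (2 powr (q - 1) * wt (1 - q) z)"
        using B by (rule mult_left_mono)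
      have "norm (a x * h + b x * cnj h) \<le> norm (a x) * norm h + norm (b x) * norm h"
        using norm_triangle_ineq[of "a x * h" "b x * cnj h"] by (simp add: norm_mult)
      also have "\<dots> = (norm (a x) + norm (b x)) * norm h" by (simp add: distrib_right)
      also have "\<dots> \<le> M * norm h"
        using a[of x] b[of x] le unfolding M_def by (intro mult_right_mono) auto
      finally show "norm (a x * h + b x * cnj h) \<le> M * norm h" .
    qed
  qed auto
  moreover have "u (\<i> * z) - u z = (\<i> - 1) * u z"
  proof -
    have "u (\<i> * z) = \<i> * u z" using e unfolding equivariant_def by blast
    then show ?thesis by (simp add: left_diff_distrib)
  qed
  moreover have "norm (u z) \<le> norm ((\<i> - 1) * u z)"
  proof -
    have "1 \<le> norm (\<i> - 1)" using abs_Im_le_cmod[of "\<i> - 1"] by simp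
    then have "1 * norm (u z) \<le> norm (\<i> - 1) * norm (u z)" by (rule mult_right_mono) simp
    then show ?thesis by (simp add: norm_mult)
  qed
  moreover have "norm (\<i> * z - z) \<le> 2 * (1 + norm z)"
    using norm_triangle_ineq4[of "\<i> * z" z] by (simp add: norm_mult)
  moreover have "0 \<le> M" using B by (simp add: M_def)
  ultimately have "norm (u z) \<le> M * (2 * (1 + norm z))"
    by (metis (no_types, lifting) mult_left_mono order_trans)
  also have "\<dots> = 4 * 2 powr (q - 1) * B * (wt (1 - q) z * (1 + norm z) powr 1)"
    by (simp add: M_def)
  also have "wt (1 - q) z * (1 + norm z) powr 1 = wt (2 - q) z"
    by (subst powr_add[symmetric]) simp
  finally show ?thesis .
qed

text \<open>The convolutions are bounded near the origin and decay like \<open>|z|\<^bsup>1-q\<^esup>\<close> away from it;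
  \<open>weighted_decay\<close> merges the two bounds.\<close>
lemma stokes_bounds:
  fixes q :: real
  assumes q: "4 < q" "q < 5"
  shows "\<exists>C\<ge>0. \<forall>F A z. decaying q A F \<longrightarrow> equivariant F \<longrightarrow>
    norm (conv ker_z F z) \<le> C * A * wt (1 - q) z \<and>
    norm (velocity_z F z) \<le> C * A * wt (1 - q) z \<and>
    norm (velocity_zbar F z) \<le> C * A * wt (1 - q) z \<and>
    norm (velocity F z) \<le> C * A * wt (2 - q) z"
proof -
  have q2: "2 < q" and q1: "1 < q" and q3: "3 < q" using q by auto
  obtain C1 where C1: "C1 \<ge> 0" "\<And>k F A z. singular_kernel k \<Longrightarrow> decaying q A F \<Longrightarrow> norm (conv k F z) \<le> C1 * A"
    using conv_integrable_bounded[OF q2] by blast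
  obtain C2 where C2: "C2 \<ge> 0" "\<And>k F A z P. singular_kernel k \<Longrightarrow> decaying q A F \<Longrightarrow> z \<noteq> 0 \<Longrightarrow>
      integrable lborel (\<lambda>w. P w * F w) \<Longrightarrow> P \<in> borel_measurable borel \<Longrightarrow>
      (\<And>w. w \<noteq> z \<Longrightarrow> norm (k (z - w) - P w) \<le> 7 * norm w ^ 3 / (norm z ^ 3 * norm (z - w))) \<Longrightarrow>
      norm (conv k F z - (LBINT w. P w * F w)) \<le> C2 * A * norm z powr (1 - q)"
    using conv_decay[OF q] by blast
  define C3 where "C3 = 2 powr (q - 1) * (C1 + C2)"
  define C where "C = C3 + norm stokes_const * C3 + 4 * 2 powr (q - 1) * (norm stokes_const * C3)"
  have C3: "0 \<le> C3" using C1 C2 by (simp add: C3_def)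
  have "norm (conv ker_z F z) \<le> C * A * wt (1 - q) z \<and>
    norm (velocity_z F z) \<le> C * A * wt (1 - q) z \<and>
    norm (velocity_zbar F z) \<le> C * A * wt (1 - q) z \<and>
    norm (velocity F z) \<le> C * A * wt (2 - q) z"
    if F: "decaying q A F" and e: "equivariant F" for F A z
  proof -
    have A: "0 \<le> A" by (rule decaying_nonneg[OF F])
    note F' = decaying_cnj[OF F]
    have CC: "C1 * A \<le> (C1 + C2) * A" "C2 * A \<le> (C1 + C2) * A" "0 \<le> (C1 + C2) * A"
      using C1 C2 A by (auto intro!: mult_right_mono)
    have X: "norm (conv ker_z F z) \<le> C3 * A * wt (1 - q) z" for z
    proof -
      have "norm (conv ker_z F z) \<le> 2 powr (q - 1) * ((C1 + C2) * A) * wt (1 - q) z"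
      proof (rule weighted_decay[OF q1])
        show "norm (conv ker_z F z) \<le> (C1 + C2) * A" using C1(2)[OF singular_ker_z F] CC(1) order_trans by blast
        assume z: "z \<noteq> 0"
        have "norm (conv ker_z F z) \<le> C2 * A * norm z powr (1 - q)"
          using C2(2)[OF singular_ker_z F z equivariant_moments(1)[OF q(1) F e] _ kernel_taylor(1)[OF z]]
          unfolding equivariant_moments(2)[OF q(1) F e] by simp
        also have "\<dots> \<le> (C1 + C2) * A * norm z powr (1 - q)" using CC(2) by (rule mult_right_mono) simp
        finally show "norm (conv ker_z F z) \<le> (C1 + C2) * A * norm z powr (1 - q)" .
      qed (use CC in auto)
      then show ?thesis by (simp add: C3_def mult_ac)
    qed
    have W: "norm (velocity_z F z) \<le> norm stokes_const * C3 * A * wt (1 - q) z" for z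
    proof -
      have "norm (velocity_z F z) \<le> norm stokes_const / 2 * (norm (conv ker_z F z) + norm (conv ker_z F z))"
        unfolding velocity_z_def conv_anti_cauchy norm_mult norm_divide
        using norm_triangle_ineq4[of "conv ker_z F z" "cnj (conv ker_z F z)"]
        by (intro mult_mono) auto
      also have "\<dots> = norm stokes_const * norm (conv ker_z F z)" by simp
      also have "\<dots> \<le> norm stokes_const * (C3 * A * wt (1 - q) z)" by (intro mult_left_mono X) simp
      finally show ?thesis by (simp add: mult_ac)
    qed
    have V: "norm (velocity_zbar F z) \<le> norm stokes_const * C3 * A * wt (1 - q) z" for z
    proof -
      let ?S = "conv ker_zbar F z + conv ker_strain (cnj_fun F) z"
      have "norm ?S \<le> 2 powr (q - 1) * (2 * ((C1 + C2) * A)) * wt (1 - q) z"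
      proof (rule weighted_decay[OF q1])
        have "norm ?S \<le> C1 * A + C1 * A"
          by (rule norm_triangle_mono[OF C1(2)[OF singular_ker_zbar F] C1(2)[OF singular_ker_strain F']])
        then show "norm ?S \<le> 2 * ((C1 + C2) * A)" using CC(1) by linarith
        assume z: "z \<noteq> 0"
        let ?m = "(LBINT w. cnj w * F w)"
        have a: "norm (conv ker_zbar F z - ?m / (cnj z)\<^sup>2) \<le> C2 * A * norm z powr (1 - q)"
          using C2(2)[OF singular_ker_zbar F z equivariant_moments(3)[OF q(1) F e] _ kernel_taylor(2)[OF z]]
          unfolding equivariant_moments(4)[OF q(1) F e] by simp
        have b: "norm (conv ker_strain (cnj_fun F) z - (- ?m / (cnj z)\<^sup>2)) \<le> C2 * A * norm z powr (1 - q)"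
          using C2(2)[OF singular_ker_strain F' z equivariant_moments(5)[OF q(1) F e] _ kernel_taylor(3)[OF z]]
          unfolding equivariant_moments(6)[OF q(1) F e] by simp
        \<comment> \<open>The leading terms of the two convolutions cancel.\<close>
        have "?S = (conv ker_zbar F z - ?m / (cnj z)\<^sup>2) + (conv ker_strain (cnj_fun F) z - (- ?m / (cnj z)\<^sup>2))" by simp
        also have "norm \<dots> \<le> C2 * A * norm z powr (1 - q) + C2 * A * norm z powr (1 - q)"
          by (rule norm_triangle_mono[OF a b])
        also have "\<dots> \<le> 2 * ((C1 + C2) * A * norm z powr (1 - q))"
          using mult_right_mono[OF CC(2) powr_ge_zero, of "norm z" "1 - q"] by linarith
        finally show "norm ?S \<le> 2 * ((C1 + C2) * A) * norm z powr (1 - q)" by simp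
      qed (use CC in auto)
      then have "norm stokes_const / 2 * norm ?S \<le> norm stokes_const / 2 * (2 powr (q - 1) * (2 * ((C1 + C2) * A)) * wt (1 - q) z)"
        by (intro mult_left_mono) auto
      then show ?thesis
        unfolding velocity_zbar_def norm_mult norm_divide C3_def by (simp add: algebra_simps)
    qed
    have m: "F \<in> borel_measurable borel" using F by (rule decaying_measurable)
    have U: "norm (velocity F z) \<le> 4 * 2 powr (q - 1) * (norm stokes_const * C3 * A) * wt (2 - q) z" for z
      by (rule equivariant_decay[OF velocity_wirtinger[OF q3 F] velocity_equivariant(1)[OF e m] q1 W V])
        (use C3 A in auto)
    have le: "C3 * A \<le> C * A" "norm stokes_const * C3 * A \<le> C * A" "4 * 2 powr (q - 1) * (norm stokes_const * C3 * A) \<le> C * A"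
      using C3 A unfolding C_def mult.assoc[symmetric]
      by (auto intro!: mult_right_mono simp: add_increasing add_increasing2)
    show ?thesis
      using order_trans[OF X mult_right_mono[OF le(1)]] order_trans[OF W mult_right_mono[OF le(2)]]
        order_trans[OF V mult_right_mono[OF le(2)]] order_trans[OF U mult_right_mono[OF le(3)]]
      by auto
  qed
  moreover have "0 \<le> C" using C3 by (simp add: C_def)
  ultimately show ?thesis by blast
qed

section \<open>The fixed point for small forces\<close>

text \<open>The convective term \<open>u \<sqdot> \<nabla>u\<close>, that is, the derivative of \<open>U\<close> in the direction \<open>U\<close>, for the
  velocity generated by the force \<open>F\<close>.\<close>
definition convect :: "(complex \<Rightarrow> complex) \<Rightarrow> complex \<Rightarrow> complex" where
  "convect F z = velocity F z * velocity_z F z + cnj (velocity F z) * velocity_zbar F z"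

lemma conv_diff:
  assumes "integrable lborel (\<lambda>w. k (z - w) * F w)" "integrable lborel (\<lambda>w. k (z - w) * G w)"
  shows "conv k (\<lambda>w. F w - G w) z = conv k F z - conv k G z"
  unfolding conv_def right_diff_distrib by (rule Bochner_Integration.integral_diff[OF assms])

lemma velocity_diff:
  assumes q: "3 < q" and F: "decaying q A F" and G: "decaying q B G"
  shows "velocity (\<lambda>w. F w - G w) z = velocity F z - velocity G z"
    and "velocity_z (\<lambda>w. F w - G w) z = velocity_z F z - velocity_z G z"
    and "velocity_zbar (\<lambda>w. F w - G w) z = velocity_zbar F z - velocity_zbar G z"
proof -
  have q2: "2 < q" using q by simp
  note F' = decaying_cnj[OF F] and G' = decaying_cnj[OF G]
  have d: "conv k (\<lambda>w. F w - G w) z = conv k F z - conv k G z"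
    "conv k (\<lambda>w. cnj (F w) - cnj (G w)) z = conv k (cnj_fun F) z - conv k (cnj_fun G) z"
    if "singular_kernel k" for k
    using conv_integrable[OF q2 that] F G F' G' by (auto intro!: conv_diff)
  have l: "conv ker_log (\<lambda>w. F w - G w) z = conv ker_log F z - conv ker_log G z"
    using log_kernel_integrable[OF q _ measurable_ker_log ker_log_bound] F G by (auto intro!: conv_diff)
  have l': "conv ker_dir (\<lambda>w. cnj (F w) - cnj (G w)) z = conv ker_dir (cnj_fun F) z - conv ker_dir (cnj_fun G) z"
    using log_kernel_integrable[OF q _ measurable_ker_dir ker_dir_bound] F' G' by (auto intro!: conv_diff)
  show "velocity (\<lambda>w. F w - G w) z = velocity F z - velocity G z"
    unfolding velocity_def complex_cnj_diff l l' by (simp add: algebra_simps diff_divide_distrib)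
  show "velocity_z (\<lambda>w. F w - G w) z = velocity_z F z - velocity_z G z"
    unfolding velocity_z_def complex_cnj_diff d[OF singular_ker_z] d[OF singular_ker_zbar] by (simp add: algebra_simps)
  show "velocity_zbar (\<lambda>w. F w - G w) z = velocity_zbar F z - velocity_zbar G z"
    unfolding velocity_zbar_def complex_cnj_diff d[OF singular_ker_strain] d[OF singular_ker_zbar] by (simp add: algebra_simps)
qed

lemma equivariant_diff: "equivariant F \<Longrightarrow> equivariant G \<Longrightarrow> equivariant (\<lambda>w. F w - G w)"
  unfolding equivariant_def by (auto simp: algebra_simps)

text \<open>The convective term is a bounded quadratic map for the weighted norms: decay rates \<open>q - 2\<close> of
  the velocity and \<open>q - 1\<close> of its gradient add up to more than \<open>q\<close>.\<close>
lemma convect_lipschitz: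
  assumes q: "4 < q" "q < 5"
  shows "\<exists>K\<ge>0. \<forall>F G A B D z. decaying q A F \<longrightarrow> decaying q B G \<longrightarrow> decaying q D (\<lambda>w. F w - G w) \<longrightarrow>
    equivariant F \<longrightarrow> equivariant G \<longrightarrow>
    norm (convect F z - convect G z) \<le> K * (A + B) * D * wt (- q) z"
proof -
  have q3: "3 < q" using q by simp
  obtain C where C: "C \<ge> 0" "\<And>F A z. decaying q A F \<Longrightarrow> equivariant F \<Longrightarrow>
    norm (velocity_z F z) \<le> C * A * wt (1 - q) z \<and>
    norm (velocity_zbar F z) \<le> C * A * wt (1 - q) z \<and>
    norm (velocity F z) \<le> C * A * wt (2 - q) z"
    using stokes_bounds[OF q] by blast
  have "norm (convect F z - convect G z) \<le> 2 * C\<^sup>2 * (A + B) * D * wt (- q) z"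
    if F: "decaying q A F" and G: "decaying q B G" and H: "decaying q D (\<lambda>w. F w - G w)"
      and eF: "equivariant F" and eG: "equivariant G" for F G A B D z
  proof -
    note d = velocity_diff[OF q3 F G]
    note nn = decaying_nonneg[OF F] decaying_nonneg[OF G] decaying_nonneg[OF H]
    define H' where "H' = (\<lambda>w. F w - G w)"
    note bF = C(2)[OF F eF, of z] and bG = C(2)[OF G eG, of z]
      and bH = C(2)[OF H equivariant_diff[OF eF eG], of z, folded H'_def]
    have w: "wt (2 - q) z * wt (1 - q) z \<le> wt (- q) z"
      unfolding powr_add[symmetric] using q by (intro powr_mono) auto
    have prod: "norm (x * y) \<le> C\<^sup>2 * (a * b) * wt (- q) z"
      if "norm x \<le> C * a * wt (2 - q) z" "norm y \<le> C * b * wt (1 - q) z" "0 \<le> a" "0 \<le> b"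
      for x y :: complex and a b
    proof -
      have "norm (x * y) \<le> (C * a * wt (2 - q) z) * (C * b * wt (1 - q) z)"
        unfolding norm_mult using that C by (intro mult_mono) auto
      also have "\<dots> = C\<^sup>2 * (a * b) * (wt (2 - q) z * wt (1 - q) z)"
        by (simp add: power2_eq_square)
      also have "\<dots> \<le> C\<^sup>2 * (a * b) * wt (- q) z" using that w by (intro mult_left_mono) auto
      finally show ?thesis .
    qed
    have "convect F z - convect G z
        = (velocity H' z * velocity_z F z + velocity G z * velocity_z H' z)
          + (cnj (velocity H' z) * velocity_zbar F z + cnj (velocity G z) * velocity_zbar H' z)"
      unfolding convect_def H'_def d by (simp add: algebra_simps)
    also have "norm \<dots> \<le> (C\<^sup>2 * (D * A) * wt (- q) z + C\<^sup>2 * (B * D) * wt (- q) z)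
        + (C\<^sup>2 * (D * A) * wt (- q) z + C\<^sup>2 * (B * D) * wt (- q) z)"
      using bF bG bH nn by (intro norm_triangle_mono prod) auto
    also have "\<dots> = 2 * C\<^sup>2 * (A + B) * D * wt (- q) z" by (simp add: algebra_simps)
    finally show ?thesis .
  qed
  then show ?thesis by (intro exI[of _ "2 * C\<^sup>2"]) auto
qed

lemma convect_zero: "convect (\<lambda>_. 0) z = 0"
  unfolding convect_def velocity_def velocity_z_def velocity_zbar_def conv_def by simp

lemma convect_continuous:
  assumes q: "3 < q" and F: "decaying q A F"
  shows "continuous_on UNIV (convect F)"
proof -
  note V = velocity_wirtinger[OF q F]
  then show ?thesis
    using wirtinger_continuous[OF V] unfolding convect_def[abs_def] wirtinger_def
    by (auto intro!: continuous_intros)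
qed

lemma convect_equivariant:
  assumes F: "equivariant F" and m: "F \<in> borel_measurable borel"
  shows "equivariant (convect F)"
proof -
  have "velocity F (\<i> * z) = \<i> * velocity F z" "velocity F (cnj z) = cnj (velocity F z)" for z
    using velocity_equivariant(1)[OF F m] unfolding equivariant_def by auto
  then show ?thesis
    unfolding equivariant_def convect_def velocity_equivariant(2-)[OF F m] by (simp add: algebra_simps)
qed

lemma small_data_fixed_point:
  assumes q: "4 < q" "q < 5"
  shows "\<exists>\<nu>>0. \<forall>f. decaying q \<nu> f \<longrightarrow> equivariant f \<longrightarrow>
    (\<exists>F A. decaying q A F \<and> equivariant F \<and> (\<forall>z. F z = f z + convect F z))"
proof -
  have q3: "3 < q" using q by simp
  obtain K where K: "K \<ge> 0" "\<And>F G A B D z. decaying q A F \<Longrightarrow> decaying q B G \<Longrightarrow> decaying q D (\<lambda>w. F w - G w) \<Longrightarrow>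
    equivariant F \<Longrightarrow> equivariant G \<Longrightarrow>
    norm (convect F z - convect G z) \<le> K * (A + B) * D * wt (- q) z"
    using convect_lipschitz[OF q] by blast
  \<comment> \<open>With this choice the ball of radius \<open>2 \<nu>\<close> is mapped into itself with contraction factor \<open>1/2\<close>.\<close>
  define \<nu> where "\<nu> = 1 / (8 * (K + 1))"
  have \<nu>: "0 < \<nu>" using K by (simp add: \<nu>_def)
  have K\<nu>: "4 * K * \<nu> \<le> 1 / 2" using K(1) by (simp add: \<nu>_def field_simps)
  have "\<exists>F A. decaying q A F \<and> equivariant F \<and> (\<forall>z. F z = f z + convect F z)"
    if f: "decaying q \<nu> f" and ef: "equivariant f" for f
  proof -
    define \<rho> :: "complex \<Rightarrow> real" where "\<rho> w = wt (- q) w" for w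
    have \<rho>: "0 < \<rho> w" for w using norm_ge_zero[of w] unfolding \<rho>_def powr_gt_zero by linarith
    have \<rho>c: "continuous_on UNIV \<rho>" unfolding \<rho>_def[abs_def]
      by (intro continuous_intros) (auto simp: add_nonneg_eq_0_iff)
    have \<rho>s: "\<rho> (\<i> * w) = \<rho> w" "\<rho> (cnj w) = \<rho> w" for w by (simp_all add: \<rho>_def norm_mult)
    \<comment> \<open>Dividing by the weight \<open>\<rho>\<close> turns the weighted space into the bounded continuous functions.\<close>
    define P where "P h w = of_real (\<rho> w) * apply_bcontfun h w" for h :: "complex \<Rightarrow>\<^sub>C complex" and w
    define S where "S = {h :: complex \<Rightarrow>\<^sub>C complex. norm h \<le> 2 * \<nu> \<and> equivariant (apply_bcontfun h)}"
    define T0 where "T0 h z = (f z + convect (P h) z) / of_real (\<rho> z)" for h z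
    define T where "T h = Bcontfun (T0 h)" for h
    have Pdec: "decaying q D (P h)" if "norm h \<le> D" for h D
      unfolding decaying_def
    proof (intro conjI allI)
      show "continuous_on UNIV (P h)" unfolding P_def by (intro continuous_intros continuous_on_apply_bcontfun \<rho>c)
      show "norm (P h w) \<le> D * wt (- q) w" for w
      proof -
        have "norm (apply_bcontfun h w) \<le> D" using norm_bounded[of h w] that by linarith
        then show ?thesis using \<rho>[of w] by (simp add: P_def norm_mult mult.commute \<rho>_def)
      qed
    qed
    have Pdiff: "(\<lambda>w. P h w - P g w) = P (h - g)" for h g
      by (auto simp: P_def algebra_simps)
    have Peq: "equivariant (P h)" if "h \<in> S" for h
      using that unfolding S_def equivariant_def P_def by (simp add: \<rho>s)
    have PS: "decaying q (2 * \<nu>) (P h)" if "h \<in> S" for h using Pdec that unfolding S_def by blast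
    have Tb: "norm (T0 h z) \<le> 2 * \<nu>" if h: "h \<in> S" for h z
    proof -
      have z: "decaying q 0 (\<lambda>_. 0)" "equivariant (\<lambda>_. 0)" by (auto simp: decaying_def equivariant_def)
      have "norm (convect (P h) z) \<le> K * (2 * \<nu>) * (2 * \<nu>) * \<rho> z"
        using K(2)[OF PS[OF h] z(1) _ Peq[OF h] z(2), of "2 * \<nu>" z] PS[OF h]
        by (simp add: convect_zero \<rho>_def)
      also have "K * (2 * \<nu>) * (2 * \<nu>) * \<rho> z = (4 * K * \<nu>) * (\<nu> * \<rho> z)" by simp
      also have "\<dots> \<le> 1 / 2 * (\<nu> * \<rho> z)" using K\<nu> \<nu> \<rho>[of z] by (intro mult_right_mono) auto
      also have "\<dots> \<le> \<nu> * \<rho> z" using \<nu> \<rho>[of z] by simp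
      finally have "norm (f z + convect (P h) z) \<le> \<nu> * \<rho> z + \<nu> * \<rho> z"
        using decaying_norm[OF f, of z] by (intro norm_triangle_mono) (simp_all add: \<rho>_def)
      then show ?thesis using \<rho>[of z] by (simp add: T0_def norm_divide field_simps)
    qed
    have Tc: "continuous_on UNIV (T0 h)" if h: "h \<in> S" for h
    proof -
      have "continuous_on UNIV f" using f unfolding decaying_def by blast
      moreover have "\<rho> z \<noteq> 0" for z using \<rho>[of z] by simp
      ultimately show ?thesis
        unfolding T0_def[abs_def] using convect_continuous[OF q3 PS[OF h]] \<rho>c
        by (intro continuous_intros) auto
    qed
    have Tap: "apply_bcontfun (T h) = T0 h" if h: "h \<in> S" for h
      unfolding T_def using bcontfun_normI[OF Tc[OF h] Tb[OF h]] by (rule Bcontfun_inverse)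
    have "\<exists>!h\<in>S. T h = h"
    proof (rule Banach_fix)
      have "closed S"
        unfolding closed_sequential_limits
      proof (intro allI impI, elim conjE)
        fix X l assume X: "\<forall>n. X n \<in> S" and l: "X \<longlonglongrightarrow> l"
        have pt: "(\<lambda>n. apply_bcontfun (X n) z) \<longlonglongrightarrow> apply_bcontfun l z" for z
        proof (rule metric_tendsto_imp_tendsto[OF l])
          show "\<forall>\<^sub>F n in sequentially. dist (apply_bcontfun (X n) z) (apply_bcontfun l z) \<le> dist (X n) l"
            by (simp add: dist_bounded)
        qed
        have n: "norm l \<le> 2 * \<nu>"
          using X by (intro tendsto_upperbound[OF tendsto_norm[OF l]]) (auto simp: S_def)
        have i: "apply_bcontfun l (\<i> * z) = \<i> * apply_bcontfun l z" for z
        proof (rule LIMSEQ_unique[OF pt])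
          have "(\<lambda>n. \<i> * apply_bcontfun (X n) z) \<longlonglongrightarrow> \<i> * apply_bcontfun l z" by (intro tendsto_intros pt)
          then show "(\<lambda>n. apply_bcontfun (X n) (\<i> * z)) \<longlonglongrightarrow> \<i> * apply_bcontfun l z"
            using X by (simp add: S_def equivariant_def)
        qed
        have c: "apply_bcontfun l (cnj z) = cnj (apply_bcontfun l z)" for z
        proof (rule LIMSEQ_unique[OF pt])
          have "(\<lambda>n. cnj (apply_bcontfun (X n) z)) \<longlonglongrightarrow> cnj (apply_bcontfun l z)" by (intro tendsto_intros pt)
          then show "(\<lambda>n. apply_bcontfun (X n) (cnj z)) \<longlonglongrightarrow> cnj (apply_bcontfun l z)"
            using X by (simp add: S_def equivariant_def)
        qed
        show "l \<in> S" using n i c by (simp add: S_def equivariant_def)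
      qed
      then show "complete S" by (simp add: complete_eq_closed)
      have "0 \<in> S" using \<nu> by (simp add: S_def equivariant_def)
      then show "S \<noteq> {}" by blast
      show "T ` S \<subseteq> S"
      proof (rule image_subsetI)
        fix h assume h: "h \<in> S"
        have "norm (T h) \<le> 2 * \<nu>" by (rule norm_bound) (simp add: Tap[OF h] Tb[OF h])
        moreover have "equivariant (T0 h)"
          using convect_equivariant[OF Peq[OF h] decaying_measurable[OF PS[OF h]]] ef
          unfolding equivariant_def T0_def \<rho>s by (simp add: algebra_simps add_divide_distrib)
        ultimately show "T h \<in> S" unfolding S_def Tap[OF h, symmetric] by simp
      qed
      fix h g assume h: "h \<in> S" and g: "g \<in> S"
      show "dist (T h) (T g) \<le> 1 / 2 * dist h g"
      proof (rule dist_bound)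
        fix z
        have "norm (convect (P h) z - convect (P g) z) \<le> K * (2 * \<nu> + 2 * \<nu>) * norm (h - g) * \<rho> z"
          using K(2)[OF PS[OF h] PS[OF g] _ Peq[OF h] Peq[OF g], of "norm (h - g)" z] Pdec[of "h - g"]
          by (simp add: Pdiff \<rho>_def)
        also have "\<dots> = (4 * K * \<nu>) * (norm (h - g) * \<rho> z)" by simp
        also have "\<dots> \<le> 1 / 2 * (norm (h - g) * \<rho> z)" using K\<nu> \<rho>[of z] by (intro mult_right_mono) auto
        finally have le: "norm (convect (P h) z - convect (P g) z) \<le> 1 / 2 * (norm (h - g) * \<rho> z)" .
        have "T0 h z - T0 g z = (convect (P h) z - convect (P g) z) / of_real (\<rho> z)"
          by (simp add: T0_def diff_divide_distrib add_divide_distrib)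
        then have "norm (T0 h z - T0 g z) = norm (convect (P h) z - convect (P g) z) / \<rho> z"
          using \<rho>[of z] by (simp add: norm_divide)
        then have "norm (T0 h z - T0 g z) \<le> 1 / 2 * norm (h - g)"
          using le \<rho>[of z] by (simp add: pos_divide_le_eq mult.assoc)
        then show "dist (apply_bcontfun (T h) z) (apply_bcontfun (T g) z) \<le> 1 / 2 * dist h g"
          by (simp add: Tap[OF h] Tap[OF g] dist_norm)
      qed
    qed auto
    then obtain h where h: "h \<in> S" "T h = h" by blast
    have "P h z = f z + convect (P h) z" for z
    proof -
      have "apply_bcontfun h z = T0 h z" using Tap[OF h(1)] h(2) by simp
      then show ?thesis using \<rho>[of z] by (simp add: P_def T0_def)
    qed
    then show ?thesis using PS[OF h(1)] Peq[OF h(1)] by blast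
  qed
  then show ?thesis using \<nu> by blast
qed

section \<open>Transfer to the Euclidean plane\<close>

text \<open>The isometric identification of the plane with the complex numbers, and its inverse.\<close>
definition toC :: "plane \<Rightarrow> complex" where "toC x = Complex (x $ 1) (x $ 2)"
definition toP :: "complex \<Rightarrow> plane" where "toP z = pt (Re z) (Im z)"

lemma toP_components[simp]: "toP z $ 1 = Re z" "toP z $ 2 = Im z"
  by (simp_all add: toP_def)

lemma toC_parts[simp]: "Re (toC x) = x $ 1" "Im (toC x) = x $ 2"
  by (simp_all add: toC_def)

lemma toC_toP[simp]: "toC (toP z) = z" by (simp add: complex_eq_iff)

lemma toP_toC[simp]: "toP (toC x) = x" by (simp add: vec_eq_iff forall_2)

lemma toC_pt[simp]: "toC (pt a b) = Complex a b" by (simp add: complex_eq_iff)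

lemma linear_toC: "linear toC" by (rule linearI) (simp_all add: complex_eq_iff)

lemma linear_toP: "linear toP" by (rule linearI) (simp_all add: vec_eq_iff forall_2)

lemma bounded_linear_toC: "bounded_linear toC"
  using linear_toC by (simp add: linear_conv_bounded_linear)

lemma bounded_linear_toP: "bounded_linear toP"
  using linear_toP by (simp add: linear_conv_bounded_linear)

lemma continuous_toC[continuous_intros]: "continuous_on S f \<Longrightarrow> continuous_on S (\<lambda>x. toC (f x))"
  by (rule bounded_linear.continuous_on[OF bounded_linear_toC])

lemma continuous_toP[continuous_intros]: "continuous_on S f \<Longrightarrow> continuous_on S (\<lambda>x. toP (f x))"
  by (rule bounded_linear.continuous_on[OF bounded_linear_toP])

lemma norm_toC[simp]: "norm (toC x) = norm x"
  by (simp add: cmod_def norm_vec_def L2_set_def sum_2)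

lemma norm_toP[simp]: "norm (toP z) = norm z"
  using norm_toC[of "toP z"] by simp

lemma Basis_plane: "(Basis :: plane set) = {axis 1 1, axis 2 1}"
  by (auto simp: Basis_vec_def) (metis exhaust_2)

lemma lborel_distr_toC: "distr lborel borel toC = lborel"
proof (rule lborel_eqI[symmetric])
  fix l u :: complex assume lu: "\<And>b. b \<in> Basis \<Longrightarrow> l \<bullet> b \<le> u \<bullet> b"
  have lu': "Re l \<le> Re u" "Im l \<le> Im u"
    using lu[of 1] lu[of \<i>] by (auto simp: Basis_complex_def)
  have ne: "axis 1 1 \<noteq> (axis 2 1 :: plane)" by (simp add: axis_eq_axis)
  have m: "toC \<in> borel_measurable borel"
    by (intro borel_measurable_continuous_onI continuous_intros)
  have "emeasure (distr lborel borel toC) (box l u) = emeasure lborel (toC -` box l u)"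
    using m by (subst emeasure_distr) auto
  also have "toC -` box l u = box (toP l) (toP u)"
    by (auto simp: box_def Basis_complex_def Basis_plane inner_axis)
  also have "emeasure lborel (box (toP l) (toP u)) = (\<Prod>b\<in>Basis. (toP u - toP l) \<bullet> b)"
    using lu' by (intro emeasure_lborel_box) (auto simp: Basis_plane inner_axis)
  also have "(\<Prod>b\<in>Basis. (toP u - toP l) \<bullet> b) = (\<Prod>b\<in>Basis. (u - l) \<bullet> b)"
    unfolding Basis_plane Basis_complex_def using ne by (simp add: inner_axis complex_eq_iff)
  finally show "emeasure (distr lborel borel toC) (box l u) = (\<Prod>b\<in>Basis. (u - l) \<bullet> b)" .
qed simp

lemma integral_toC:
  fixes g :: "complex \<Rightarrow> 'b::{banach, second_countable_topology}"
  assumes "g \<in> borel_measurable borel"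
  shows "(LBINT x. g (toC x)) = (LBINT z. g z)"
  by (rule lborel_integral_invariant[OF lborel_distr_toC _ assms])
    (intro borel_measurable_continuous_onI continuous_intros)

lemma plane_eq_axes: "(h :: plane) = h $ 1 *\<^sub>R axis 1 1 + h $ 2 *\<^sub>R axis 2 1"
  by (simp add: vec_eq_iff forall_2 axis_def)

lemma has_derivative_partial:
  assumes g: "g differentiable_on UNIV"
  shows "(g has_derivative (\<lambda>h. partial 1 g x * h $ 1 + partial 2 g x * h $ 2)) (at x)"
proof -
  have d: "(g has_derivative frechet_derivative g (at x)) (at x)"
    using g by (simp add: differentiable_on_def frechet_derivative_works)
  then have l: "linear (frechet_derivative g (at x))" by (rule has_derivative_linear)
  have "frechet_derivative g (at x) h = partial 1 g x * h $ 1 + partial 2 g x * h $ 2" for h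
    by (subst plane_eq_axes[of h]) (simp add: linear_add[OF l] linear_cmul[OF l] partial_def mult.commute)
  then show ?thesis using d by (metis (no_types, lifting) ext)
qed

lemma partial_eqI:
  assumes "(g has_derivative g') (at x)"
  shows "partial i g x = g' (axis i 1)"
  unfolding partial_def using frechet_derivative_at[OF assms] by simp

text \<open>Here \<open>p\<close> and \<open>r\<close> are the two partial derivatives of \<open>g\<close>.\<close>
lemma wirtinger_of_plane:
  fixes g :: "plane \<Rightarrow> complex"
  assumes g: "\<And>x. (g has_derivative (\<lambda>h. p x * of_real (h $ 1) + r x * of_real (h $ 2))) (at x)"
    and p: "continuous_on UNIV p" and r: "continuous_on UNIV r"
  shows "wirtinger (\<lambda>z. g (toP z)) (\<lambda>z. (p (toP z) - \<i> * r (toP z)) / 2) (\<lambda>z. (p (toP z) + \<i> * r (toP z)) / 2)"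
  unfolding wirtinger_def
proof (intro conjI allI)
  fix z
  have "((\<lambda>z. g (toP z)) has_derivative (\<lambda>h. p (toP z) * of_real (toP h $ 1) + r (toP z) * of_real (toP h $ 2))) (at z)"
    by (rule has_derivative_compose[OF bounded_linear.has_derivative[OF bounded_linear_toP has_derivative_ident] g])
  moreover have "p (toP z) * of_real (toP h $ 1) + r (toP z) * of_real (toP h $ 2)
      = (p (toP z) - \<i> * r (toP z)) / 2 * h + (p (toP z) + \<i> * r (toP z)) / 2 * cnj h" for h
    by (simp add: complex_eq_iff field_simps)
  ultimately show "((\<lambda>z. g (toP z)) has_derivative
      (\<lambda>h. (p (toP z) - \<i> * r (toP z)) / 2 * h + (p (toP z) + \<i> * r (toP z)) / 2 * cnj h)) (at z)" by simp
qed (auto intro!: continuous_intros continuous_on_compose2[OF p] continuous_on_compose2[OF r])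

lemma Ck_continuous: "Ck k g \<Longrightarrow> continuous_on UNIV g"
  by (cases k) (auto intro: differentiable_imp_continuous_on)

text \<open>A test function \<open>\<phi>\<close>, read as a function \<open>\<psi>\<close> on the complex numbers, satisfies
  \<open>\<partial>\<psi>/\<partial>(cnj z) = b\<close>, and \<open>\<partial>b/\<partial>z\<close> is a quarter of its Laplacian.  The latter uses the symmetry of
  the mixed second derivatives.\<close>
lemma test_function_wirtinger:
  assumes \<phi>: "test_function \<phi>"
  defines "p1 \<equiv> partial 1 \<phi>" and "p2 \<equiv> partial 2 \<phi>"
  defines "\<psi> \<equiv> \<lambda>z. complex_of_real (\<phi> (toP z))"
    and "b \<equiv> \<lambda>z. (of_real (p1 (toP z)) + \<i> * of_real (p2 (toP z))) / 2"
  shows "\<exists>R. \<forall>x. R < norm x \<longrightarrow> \<phi> x = 0"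
    and "continuous_on UNIV p1" "continuous_on UNIV p2"
    and "continuous_on UNIV (partial 1 p1)" "continuous_on UNIV (partial 2 p2)"
    and "wirtinger \<psi> (\<lambda>z. (of_real (p1 (toP z)) - \<i> * of_real (p2 (toP z))) / 2) b"
    and "\<exists>d. wirtinger b (\<lambda>z. of_real ((partial 1 p1 (toP z) + partial 2 p2 (toP z)) / 4)) d"
proof -
  have C: "Ck k \<phi>" for k using \<phi> unfolding test_function_def by blast
  have D: "\<phi> differentiable_on UNIV" "p1 differentiable_on UNIV" "p2 differentiable_on UNIV"
    and cp: "continuous_on UNIV p1" "continuous_on UNIV p2"
    and c2: "continuous_on UNIV (partial i p1)" "continuous_on UNIV (partial i p2)" for i
    using C[of "Suc (Suc 0)"] C[of "Suc 0"] unfolding p1_def p2_def by auto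
  show "continuous_on UNIV p1" "continuous_on UNIV p2"
    "continuous_on UNIV (partial 1 p1)" "continuous_on UNIV (partial 2 p2)" using cp c2 by auto
  have "bounded (closure {x. \<phi> x \<noteq> 0})" using \<phi> unfolding test_function_def by (auto intro: compact_imp_bounded)
  then obtain R where "\<And>x. x \<in> closure {x. \<phi> x \<noteq> 0} \<Longrightarrow> norm x \<le> R" unfolding bounded_iff by auto
  then have "\<forall>x. R < norm x \<longrightarrow> \<phi> x = 0"
    using closure_subset[of "{x. \<phi> x \<noteq> 0}"] by (metis (mono_tags, lifting) linorder_not_less mem_Collect_eq subset_iff)
  then show "\<exists>R. \<forall>x. R < norm x \<longrightarrow> \<phi> x = 0" by blast
  note d0 = has_derivative_partial[OF D(1), folded p1_def p2_def]
  note d1 = has_derivative_partial[OF D(2)] and d2 = has_derivative_partial[OF D(3)]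
  have mixed: "partial 2 p1 x = partial 1 p2 x" for x
  proof -
    have e: "(\<lambda>y. p1 y * (axis 1 1 :: plane) $ 1 + p2 y * (axis 1 1 :: plane) $ 2) = p1"
      "(\<lambda>y. p1 y * (axis 2 1 :: plane) $ 1 + p2 y * (axis 2 1 :: plane) $ 2) = p2"
      by (auto simp: axis_def)
    have "partial 1 p1 x * (axis 2 1 :: plane) $ 1 + partial 2 p1 x * (axis 2 1 :: plane) $ 2
        = partial 1 p2 x * (axis 1 1 :: plane) $ 1 + partial 2 p2 x * (axis 1 1 :: plane) $ 2"
    proof (rule mixed_partials_equal[OF d0, of "axis 1 1" "\<lambda>x h. partial 1 p1 x * h $ 1 + partial 2 p1 x * h $ 2"
          "axis 2 1" "\<lambda>x h. partial 1 p2 x * h $ 1 + partial 2 p2 x * h $ 2"], unfold e)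
    qed (auto intro!: d1 d2 continuous_intros c2)
    then show ?thesis by (simp add: axis_def)
  qed
  have "((\<lambda>x. complex_of_real (\<phi> x)) has_derivative
      (\<lambda>h. of_real (p1 x) * of_real (h $ 1) + of_real (p2 x) * of_real (h $ 2))) (at x)" for x
    using has_derivative_of_real[OF d0[of x]] by simp
  from wirtinger_of_plane[OF this]
  show "wirtinger \<psi> (\<lambda>z. (of_real (p1 (toP z)) - \<i> * of_real (p2 (toP z))) / 2) b"
    unfolding \<psi>_def b_def by (auto intro!: continuous_intros cp)
  have "((\<lambda>x. (of_real (p1 x) + \<i> * of_real (p2 x)) / 2) has_derivative
      (\<lambda>h. (of_real (partial 1 p1 x) + \<i> * of_real (partial 1 p2 x)) / 2 * of_real (h $ 1)
         + (of_real (partial 2 p1 x) + \<i> * of_real (partial 2 p2 x)) / 2 * of_real (h $ 2))) (at x)" for x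
  proof -
    have "((\<lambda>x. (of_real (p1 x) + \<i> * of_real (p2 x)) / (2::complex)) has_derivative
      (\<lambda>h. (of_real (partial 1 p1 x * h $ 1 + partial 2 p1 x * h $ 2)
         + \<i> * of_real (partial 1 p2 x * h $ 1 + partial 2 p2 x * h $ 2)) / 2)) (at x)"
      by (intro bounded_linear.has_derivative[OF bounded_linear_divide] has_derivative_add
          has_derivative_mult_right has_derivative_of_real d1 d2)
    then show ?thesis by (simp add: algebra_simps add_divide_distrib)
  qed
  then have w: "wirtinger b (\<lambda>z. ((of_real (partial 1 p1 (toP z)) + \<i> * of_real (partial 1 p2 (toP z))) / 2
      - \<i> * ((of_real (partial 2 p1 (toP z)) + \<i> * of_real (partial 2 p2 (toP z))) / 2)) / 2)
      (\<lambda>z. ((of_real (partial 1 p1 (toP z)) + \<i> * of_real (partial 1 p2 (toP z))) / 2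
      + \<i> * ((of_real (partial 2 p1 (toP z)) + \<i> * of_real (partial 2 p2 (toP z))) / 2)) / 2)"
    unfolding b_def by (rule wirtinger_of_plane; intro continuous_intros c2; simp)
  have id: "((of_real (partial 1 p1 x) + \<i> * of_real (partial 1 p2 x)) / 2
      - \<i> * ((of_real (partial 2 p1 x) + \<i> * of_real (partial 2 p2 x)) / 2)) / 2
      = complex_of_real ((partial 1 p1 x + partial 2 p2 x) / 4)" for x
    unfolding mixed by (simp add: complex_eq_iff field_simps)
  show "\<exists>d. wirtinger b (\<lambda>z. of_real ((partial 1 p1 (toP z) + partial 2 p2 (toP z)) / 4)) d"
    using w unfolding id by blast
qed

section \<open>From the fixed point to a solution\<close>

lemma integral_component:
  assumes "integrable lborel G"
  shows "(LBINT z. toP (G z) $ i) = toP (LBINT z. G z) $ i"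
  by (rule integral_bounded_linear[OF bounded_linear_compose[OF bounded_linear_vec_nth bounded_linear_toP] assms])

text \<open>The fixed point equation says that the total force \<open>F\<close> of the Stokes problem consists of the
  given force and the convective term of its own solution.\<close>
lemma solution_of_fixed_point:
  assumes q: "3 < q" and F: "decaying q A F" and fp: "\<And>z. F z = toC (f (toP z)) + convect F z"
  shows "navier_stokes_solution f (\<lambda>x. toP (velocity F (toC x))) (\<lambda>x. pressure F (toC x))"
proof -
  have q2: "2 < q" using q by simp
  define u where "u x = toP (velocity F (toC x))" for x
  define p where "p x = pressure F (toC x)" for x
  note W = velocity_wirtinger[OF q F]
  have cV: "continuous_on UNIV (velocity F)" by (rule wirtinger_continuous[OF W])
  have cz: "continuous_on UNIV (velocity_z F)" "continuous_on UNIV (velocity_zbar F)"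
    using W unfolding wirtinger_def by auto
  have cP: "continuous_on UNIV (pressure F)"
    unfolding pressure_def[abs_def] by (intro continuous_intros conv_continuous[OF q2 singular_ker_z F])
  have cF: "continuous_on UNIV F" using F unfolding decaying_def by blast
  have cN: "continuous_on UNIV (convect F)" by (rule convect_continuous[OF q F])
  define Du where "Du x h = toP (velocity_z F (toC x) * toC h + velocity_zbar F (toC x) * cnj (toC h))" for x h
  have du: "((\<lambda>x. u x $ i) has_derivative (\<lambda>h. Du x h $ i)) (at x)" for i x
  proof -
    have "(velocity F has_derivative (\<lambda>h. velocity_z F (toC x) * h + velocity_zbar F (toC x) * cnj h)) (at (toC x))"
      using W unfolding wirtinger_def by blast
    from has_derivative_compose[OF bounded_linear.has_derivative[OF bounded_linear_toC has_derivative_ident] this]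
    have "((\<lambda>x. velocity F (toC x)) has_derivative
        (\<lambda>h. velocity_z F (toC x) * toC h + velocity_zbar F (toC x) * cnj (toC h))) (at x)" .
    from bounded_linear.has_derivative[OF bounded_linear_compose[OF bounded_linear_vec_nth bounded_linear_toP] this]
    show ?thesis unfolding u_def Du_def .
  qed
  have pu: "partial j (\<lambda>x. u x $ i) x = Du x (axis j 1) $ i" for i j x by (rule partial_eqI[OF du])
  have C1: "Ck 1 (\<lambda>x. u x $ i)" for i
  proof -
    have "continuous_on UNIV (\<lambda>x. Du x (axis j 1) $ i)" for j
      unfolding Du_def
      by (intro continuous_intros continuous_on_compose2[OF cz(1)] continuous_on_compose2[OF cz(2)]) auto
    moreover have "partial j (\<lambda>x. u x $ i) = (\<lambda>x. Du x (axis j 1) $ i)" for j using pu by blast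
    moreover have "(\<lambda>x. u x $ i) differentiable_on UNIV"
      unfolding differentiable_on_def differentiable_def using du by blast
    ultimately show ?thesis by simp
  qed
  have cp: "continuous_on UNIV p" unfolding p_def[abs_def] by (intro continuous_on_compose2[OF cP] continuous_intros) auto
  have conv: "convection u i x = toP (convect F (toC x)) $ i" for i x
  proof -
    have l: "linear (Du x)"
      unfolding Du_def by (rule linearI) (auto simp: vec_eq_iff forall_2 algebra_simps)
    have "convection u i x = (u x $ 1 *\<^sub>R Du x (axis 1 1) + u x $ 2 *\<^sub>R Du x (axis 2 1)) $ i"
      unfolding convection_def by (simp add: sum_2 pu)
    also have "u x $ 1 *\<^sub>R Du x (axis 1 1) + u x $ 2 *\<^sub>R Du x (axis 2 1) = Du x (u x)"
      by (subst (3) plane_eq_axes[of "u x"]) (simp only: linear_add[OF l] linear_cmul[OF l])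
    also have "Du x (u x) = toP (convect F (toC x))"
      by (simp add: Du_def u_def convect_def mult.commute)
    finally show ?thesis .
  qed
  have "(\<forall>i. dist_laplacian (dist_of (\<lambda>x. u x $ i)) \<phi> - dist_partial i (dist_of p) \<phi>
              - dist_of (convection u i) \<phi> = dist_of (\<lambda>x. f x $ i) \<phi>) \<and>
        (\<Sum>i\<in>UNIV. dist_partial i (dist_of (\<lambda>x. u x $ i)) \<phi>) = 0"
    if \<phi>: "test_function \<phi>" for \<phi>
  proof -
    define p1 where "p1 = partial 1 \<phi>"
    define p2 where "p2 = partial 2 \<phi>"
    define \<psi> where "\<psi> z = complex_of_real (\<phi> (toP z))" for z
    define b where "b z = (of_real (p1 (toP z)) + \<i> * of_real (p2 (toP z))) / 2" for z
    define a where "a z = (of_real (p1 (toP z)) - \<i> * of_real (p2 (toP z))) / 2" for z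
    define e where "e z = complex_of_real ((partial 1 p1 (toP z) + partial 2 p2 (toP z)) / 4)" for z
    note tf = test_function_wirtinger[OF \<phi>, folded p1_def p2_def]
    obtain R where R: "\<And>x. R < norm x \<Longrightarrow> \<phi> x = 0" using tf(1) by blast
    have c: "continuous_on UNIV p1" "continuous_on UNIV p2"
      "continuous_on UNIV (partial 1 p1)" "continuous_on UNIV (partial 2 p2)" using tf(2-5) by auto
    have w\<psi>: "wirtinger \<psi> a b" using tf(6) unfolding \<psi>_def[abs_def] a_def[abs_def] b_def[abs_def] .
    obtain d where wb: "wirtinger b e d" using tf(7) unfolding b_def[abs_def] e_def[abs_def] by blast
    have z\<psi>: "\<psi> z = 0" if "R < norm z" for z using R[of "toP z"] that by (simp add: \<psi>_def)
    have zb: "b z = 0" if "R < norm z" for z by (rule wirtinger_support(2)[OF w\<psi> z\<psi> that])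
    have za: "a z = 0" if "R < norm z" for z by (rule wirtinger_support(1)[OF w\<psi> z\<psi> that])
    have ze: "e z = 0" if "R < norm z" for z by (rule wirtinger_support(1)[OF wb zb that])
    have c\<psi>: "continuous_on UNIV \<psi>" "continuous_on UNIV a" "continuous_on UNIV b" "continuous_on UNIV e"
      using wirtinger_continuous[OF w\<psi>] w\<psi> wb unfolding wirtinger_def by auto
    have c\<phi>: "continuous_on UNIV \<phi>"
      using \<phi> Ck_continuous unfolding test_function_def by blast
    have int: "integrable lborel (\<lambda>z. g z * h z)"
      if "continuous_on UNIV g" "continuous_on UNIV h" "\<And>z. R < norm z \<Longrightarrow> h z = 0" for g h :: "complex \<Rightarrow> complex"
      using that by (intro integrable_continuous_compact_support[of _ R]) (auto intro!: continuous_intros)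
    \<comment> \<open>Integrals over the plane of single components become components of complex integrals.\<close>
    have transfer: "(LBINT x. toP (g (toC x)) $ i * r x) = toP (LBINT z. g z * of_real (r (toP z))) $ i"
      if g: "continuous_on UNIV g" and r: "continuous_on UNIV r"
        and i: "integrable lborel (\<lambda>z. g z * of_real (r (toP z)))" for g r i
    proof -
      have "(LBINT x. toP (g (toC x)) $ i * r x) = (LBINT x. toP (g (toC x)) $ i * r (toP (toC x)))" by simp
      also have "\<dots> = (LBINT z. toP (g z) $ i * r (toP z))"
        by (rule integral_toC[of "\<lambda>z. toP (g z) $ i * r (toP z)"])
          (intro borel_measurable_continuous_onI continuous_intros g continuous_on_compose2[OF r]; simp)
      also have "\<dots> = (LBINT z. toP (g z * of_real (r (toP z))) $ i)"
      proof (rule Bochner_Integration.integral_cong[OF refl])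
        show "toP (g z) $ i * r (toP z) = toP (g z * of_real (r (toP z))) $ i" for z
        proof -
          have "g z * of_real (r (toP z)) = r (toP z) *\<^sub>R g z" by (simp add: scaleR_conv_of_real mult.commute)
          then show ?thesis by (simp add: linear_cmul[OF linear_toP] mult.commute)
        qed
      qed
      also have "\<dots> = toP (LBINT z. g z * of_real (r (toP z))) $ i" by (rule integral_component[OF i])
      finally show ?thesis .
    qed
    have zp: "p1 x = 0" "p2 x = 0" if "R < norm x" for x
      using za[of "toC x"] zb[of "toC x"] that by (simp_all add: a_def b_def complex_eq_iff)
    have iu: "integrable lborel (\<lambda>x. u x $ i * h x)"
      if "continuous_on UNIV h" "\<And>x. R < norm x \<Longrightarrow> h x = 0" for h i
      using that unfolding u_def
      by (intro integrable_continuous_compact_support[of _ R])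
        (auto intro!: continuous_intros continuous_on_compose2[OF cV])
    have momentum: "dist_laplacian (dist_of (\<lambda>x. u x $ i)) \<phi> - dist_partial i (dist_of p) \<phi>
              - dist_of (convection u i) \<phi> = dist_of (\<lambda>x. f x $ i) \<phi>" for i
    proof -
      define L where "L x = partial 1 p1 x + partial 2 p2 x" for x
      have cL: "continuous_on UNIV L" unfolding L_def[abs_def] by (intro continuous_intros c)
      have cLP: "continuous_on UNIV (\<lambda>z. L (toP z))"
        by (rule continuous_on_compose2[OF cL]) (auto intro!: continuous_intros)
      have eL: "4 * e z = of_real (L (toP z))" for z by (simp add: e_def L_def)
      have zL: "L x = 0" if "R < norm x" for x using ze[of "toC x"] that eL[of "toC x"] by simp
      have zpp: "partial 1 p1 x = 0" "partial 2 p2 x = 0" if "R < norm x" for x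
      proof -
        have "(p1 has_derivative (\<lambda>h. partial 1 p1 x * h $ 1 + partial 2 p1 x * h $ 2)) (at x)"
          "(p2 has_derivative (\<lambda>h. partial 1 p2 x * h $ 1 + partial 2 p2 x * h $ 2)) (at x)"
          using \<phi> unfolding test_function_def p1_def p2_def
          by (auto intro!: has_derivative_partial dest!: spec[of _ "Suc (Suc 0)"])
        from derivative_zero_outside[OF this(1) zp(1) that] derivative_zero_outside[OF this(2) zp(2) that]
        show "partial 1 p1 x = 0" "partial 2 p2 x = 0"
          by (auto dest: fun_cong[of _ _ "axis 1 1"] fun_cong[of _ _ "axis 2 1"] simp: axis_def)
      qed
      have "dist_laplacian (dist_of (\<lambda>x. u x $ i)) \<phi>
          = (LBINT x. u x $ i * partial 1 p1 x) + (LBINT x. u x $ i * partial 2 p2 x)"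
        by (simp add: dist_laplacian_def dist_partial_def dist_of_def sum_2 p1_def p2_def)
      also have "\<dots> = (LBINT x. u x $ i * L x)"
        unfolding L_def distrib_left
        by (rule Bochner_Integration.integral_add[symmetric]) (intro iu c zpp; assumption)+
      also have "\<dots> = toP (LBINT z. velocity F z * (4 * e z)) $ i"
        unfolding u_def eL
        by (rule transfer[OF cV cL]) (use cLP int[OF cV, of "\<lambda>z. 4 * e z"] ze c\<psi> in \<open>auto simp: eL intro!: continuous_intros\<close>)
      finally have 1: "dist_laplacian (dist_of (\<lambda>x. u x $ i)) \<phi> = toP (LBINT z. velocity F z * (4 * e z)) $ i" .
      have "- dist_partial i (dist_of p) \<phi> = (LBINT x. p x * partial i \<phi> x)"
        by (simp add: dist_partial_def dist_of_def)
      also have "\<dots> = (LBINT x. (\<lambda>z. toP (of_real (pressure F z) * (2 * b z)) $ i) (toC x))"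
      proof (rule Bochner_Integration.integral_cong[OF refl])
        fix x
        have "toP (of_real r * (2 * b (toC x))) $ i = r * partial i \<phi> x" for r
          using exhaust_2[of i] by (auto simp: b_def p1_def p2_def)
        then show "p x * partial i \<phi> x = (\<lambda>z. toP (of_real (pressure F z) * (2 * b z)) $ i) (toC x)"
          by (simp add: p_def)
      qed
      also have "\<dots> = (LBINT z. toP (of_real (pressure F z) * (2 * b z)) $ i)"
        by (rule integral_toC)
          (intro borel_measurable_continuous_onI continuous_intros cP c\<psi>)
      also have "\<dots> = toP (LBINT z. of_real (pressure F z) * (2 * b z)) $ i"
        by (rule integral_component[OF int]) (auto intro!: continuous_intros cP c\<psi> simp: zb)
      finally have 2: "- dist_partial i (dist_of p) \<phi> = toP (LBINT z. of_real (pressure F z) * (2 * b z)) $ i" .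
      have i3: "integrable lborel (\<lambda>z. convect F z * \<psi> z)" by (rule int[OF cN c\<psi>(1) z\<psi>])
      have 3: "dist_of (convection u i) \<phi> = toP (LBINT z. convect F z * \<psi> z) $ i"
        unfolding dist_of_def conv \<psi>_def by (rule transfer[OF cN c\<phi> i3[unfolded \<psi>_def]])
      define f' where "f' z = F z - convect F z" for z
      have cf: "continuous_on UNIV f'" unfolding f'_def[abs_def] by (intro continuous_intros cF cN)
      have ff: "f x = toP (f' (toC x))" for x using fp[of "toC x"] by (simp add: f'_def)
      have i4: "integrable lborel (\<lambda>z. f' z * \<psi> z)" by (rule int[OF cf c\<psi>(1) z\<psi>])
      have 4: "dist_of (\<lambda>x. f x $ i) \<phi> = toP (LBINT z. f' z * \<psi> z) $ i"
        unfolding dist_of_def ff \<psi>_def by (rule transfer[OF cf c\<phi> i4[unfolded \<psi>_def]])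
      have "(LBINT z. velocity F z * (4 * e z)) + (LBINT z. of_real (pressure F z) * (2 * b z))
          = (LBINT z. F z * \<psi> z)"
        by (rule stokes_weak[OF q F w\<psi> wb z\<psi>])
      also have "\<dots> = (LBINT z. f' z * \<psi> z + convect F z * \<psi> z)" by (simp add: f'_def algebra_simps)
      also have "\<dots> = (LBINT z. f' z * \<psi> z) + (LBINT z. convect F z * \<psi> z)"
        by (rule Bochner_Integration.integral_add[OF i4 i3])
      finally have "toP (LBINT z. velocity F z * (4 * e z)) + toP (LBINT z. of_real (pressure F z) * (2 * b z))
          = toP (LBINT z. f' z * \<psi> z) + toP (LBINT z. convect F z * \<psi> z)"
        by (simp only: linear_add[OF linear_toP, symmetric])
      from arg_cong[OF this, of "\<lambda>v. v $ i"] show ?thesis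
        unfolding 1 3 4 using 2 by simp
    qed
    have "(\<Sum>i\<in>UNIV. dist_partial i (dist_of (\<lambda>x. u x $ i)) \<phi>) = 0"
    proof -
      have iW: "integrable lborel (\<lambda>z. velocity F z * a z)" by (rule int[OF cV c\<psi>(2) za])
      have iZ: "integrable lborel (\<lambda>z. velocity_z F z * \<psi> z)" by (rule int[OF cz(1) c\<psi>(1) z\<psi>])
      have "(\<Sum>i\<in>UNIV. dist_partial i (dist_of (\<lambda>x. u x $ i)) \<phi>)
          = - ((LBINT x. u x $ 1 * p1 x) + (LBINT x. u x $ 2 * p2 x))"
        by (simp add: dist_partial_def dist_of_def sum_2 p1_def p2_def)
      also have "(LBINT x. u x $ 1 * p1 x) + (LBINT x. u x $ 2 * p2 x)
          = (LBINT x. u x $ 1 * p1 x + u x $ 2 * p2 x)"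
        by (rule Bochner_Integration.integral_add[symmetric]) (intro iu c zp; assumption)+
      also have "\<dots> = (LBINT x. (\<lambda>z. 2 * Re (velocity F z * a z)) (toC x))"
        by (rule Bochner_Integration.integral_cong[OF refl]) (simp add: u_def a_def)
      also have "\<dots> = (LBINT z. 2 * Re (velocity F z * a z))"
        by (rule integral_toC) (intro borel_measurable_continuous_onI continuous_intros cV c\<psi>)
      also have "\<dots> = 2 * (LBINT z. Re (velocity F z * a z))" by (rule integral_mult_right_zero)
      also have "(LBINT z. Re (velocity F z * a z)) = Re (LBINT z. velocity F z * a z)"
        by (rule integral_Re[OF iW])
      also have "\<dots> = - Re (LBINT z. velocity_z F z * \<psi> z)"
        using wirtinger_by_parts(1)[OF W w\<psi> z\<psi>] by simp
      also have "Re (LBINT z. velocity_z F z * \<psi> z) = (LBINT z. Re (velocity_z F z * \<psi> z))"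
        by (rule integral_Re[OF iZ, symmetric])
      also have "\<dots> = 0" by (simp add: \<psi>_def velocity_div_free)
      finally show ?thesis by simp
    qed
    then show ?thesis using momentum by blast
  qed
  then show ?thesis
    unfolding navier_stokes_solution_def using C1 cp unfolding u_def p_def by blast
qed

text \<open>The constant \<open>2\<^sup>q\<close> comes from \<open>(1 + |x|)\<^sup>q \<le> 2\<^sup>q (1 + |x|\<^sup>q)\<close>.\<close>
lemma B0_decaying:
  assumes q: "0 < q" and f: "f \<in> B0 q" and n: "B0_norm q f \<le> \<nu>"
  shows "decaying q (2 powr q * \<nu>) (\<lambda>z. toC (f (toP z)))"
  unfolding decaying_def
proof (intro conjI allI)
  have cf: "continuous_on UNIV f" using f unfolding B0_def by blast
  show "continuous_on UNIV (\<lambda>z. toC (f (toP z)))"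
    by (intro continuous_intros continuous_on_compose2[OF cf]) auto
  fix z
  define x where "x = toP z"
  have "bounded (range (\<lambda>x. weight q x *\<^sub>R f x))" using f unfolding B0_def by blast
  moreover have w: "0 < weight q x" for x unfolding weight_def by (simp add: add_pos_nonneg)
  ultimately have "bdd_above (range (\<lambda>x. weight q x * norm (f x)))"
    unfolding bounded_iff bdd_above_def by (force simp: abs_of_pos)
  then have "weight q x * norm (f x) \<le> B0_norm q f" unfolding B0_norm_def by (rule cSUP_upper[OF UNIV_I])
  then have le: "weight q x * norm (f x) \<le> \<nu>" using n by simp
  have "wt q x \<le> 2 powr q * weight q x"
  proof (cases "norm x \<le> 1")
    case True
    have "wt q x \<le> 2 powr q" using True q by (intro powr_mono2) auto
    also have "\<dots> \<le> 2 powr q * weight q x" by (simp add: weight_def)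
    finally show ?thesis .
  next
    case False
    have "wt q x \<le> (2 * norm x) powr q" using False q by (intro powr_mono2) auto
    also have "\<dots> \<le> 2 powr q * weight q x" by (simp add: weight_def powr_mult)
    finally show ?thesis .
  qed
  then have "wt q x * norm (f x) \<le> 2 powr q * weight q x * norm (f x)" by (rule mult_right_mono) simp
  also have "\<dots> \<le> 2 powr q * \<nu>" using le by (simp add: mult.assoc)
  finally have "wt q x * norm (f x) \<le> 2 powr q * \<nu>" .
  moreover have "0 < wt q x" by (simp add: add_nonneg_eq_0_iff)
  ultimately have "norm (f x) \<le> 2 powr q * \<nu> * wt (- q) x"
    by (simp add: powr_minus field_simps)
  then show "norm (toC (f (toP z))) \<le> 2 powr q * \<nu> * wt (- q) z"
    by (simp add: x_def)
qed

lemma decay_bigo: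
  fixes g :: "plane \<Rightarrow> real"
  assumes b: "\<And>x. norm (g x) \<le> C * (1 + norm x) powr s" and s: "s < 0" and C: "0 \<le> C"
  shows "g \<in> O[at_infinity](\<lambda>x. norm x powr s)" and "(g \<longlongrightarrow> 0) at_infinity"
proof -
  have ev: "eventually (\<lambda>x::plane. norm (g x) \<le> C * norm x powr s) at_infinity"
    unfolding eventually_at_infinity
  proof (intro exI[of _ 1] allI impI)
    fix x :: plane assume x: "1 \<le> norm x"
    have "(1 + norm x) powr s \<le> norm x powr s" using x s by (intro powr_mono2') auto
    then have "C * (1 + norm x) powr s \<le> C * norm x powr s" using C by (rule mult_left_mono)
    with b[of x] show "norm (g x) \<le> C * norm x powr s" by linarith
  qed
  show "g \<in> O[at_infinity](\<lambda>x. norm x powr s)"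
    using ev by (intro bigoI[of _ C]) simp
  have "((\<lambda>x::plane. C * norm x powr s) \<longlongrightarrow> C * 0) at_infinity"
    by (intro tendsto_mult tendsto_const tendsto_neg_powr s filterlim_norm_at_top)
  then show "(g \<longlongrightarrow> 0) at_infinity"
    using ev by (intro Lim_null_comparison[of g "\<lambda>x. C * norm x powr s"]) simp_all
qed

theorem corollary3p7:
  fixes \<epsilon> :: real
  assumes "0 < \<epsilon>" and "\<epsilon> < 1"
  shows "\<exists>\<nu>>0. \<forall>f :: plane \<Rightarrow> plane.
    f \<in> B0 (4 + \<epsilon>) \<and> B0_norm (4 + \<epsilon>) f \<le> \<nu> \<and> (\<integral>x. f x \<partial>lborel) = 0 \<and>
    (\<forall>x1 x2.
      f (pt x1 x2) $ 1 = f (pt x1 (- x2)) $ 1 \<and>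
      f (pt x1 x2) $ 1 = - (f (pt (- x1) x2) $ 1) \<and>
      f (pt x1 x2) $ 2 = - (f (pt x1 (- x2)) $ 2) \<and>
      f (pt x1 x2) $ 2 = f (pt (- x1) x2) $ 2) \<and>
    (\<forall>x1 x2.
      f (pt x1 x2) $ 1 = f (pt x2 x1) $ 2 \<and>
      f (pt x1 x2) $ 1 = - (f (pt (- x2) (- x1)) $ 2) \<and>
      f (pt x1 x2) $ 2 = f (pt x2 x1) $ 1 \<and>
      f (pt x1 x2) $ 2 = - (f (pt (- x2) (- x1)) $ 1))
    \<longrightarrow> (\<exists>u p. navier_stokes_solution f u p \<and>
          (u \<longlongrightarrow> 0) at_infinity \<and>
          (\<lambda>x. norm (u x)) \<in> O[at_infinity](\<lambda>x. norm x powr (- 2 - \<epsilon>)) \<and>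
          p \<in> O[at_infinity](\<lambda>x. norm x powr (- 3 - \<epsilon>)))"
proof -
  define q where "q = 4 + \<epsilon>"
  have q: "4 < q" "q < 5" and q3: "3 < q" using assms by (auto simp: q_def)
  obtain \<nu> where \<nu>: "\<nu> > 0" "\<And>g. decaying q \<nu> g \<Longrightarrow> equivariant g \<Longrightarrow>
      \<exists>F A. decaying q A F \<and> equivariant F \<and> (\<forall>z. F z = g z + convect F z)"
    using small_data_fixed_point[OF q] by blast
  obtain C where C: "C \<ge> 0" "\<And>F A z. decaying q A F \<Longrightarrow> equivariant F \<Longrightarrow>
      norm (conv ker_z F z) \<le> C * A * wt (1 - q) z \<and>
      norm (velocity F z) \<le> C * A * wt (2 - q) z"
    using stokes_bounds[OF q] by blast
  show ?thesis
  proof (intro exI[of _ "\<nu> / 2 powr q"] conjI allI impI; (elim conjE)?)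
    show "0 < \<nu> / 2 powr q" using \<nu> by simp
    fix f :: "plane \<Rightarrow> plane"
    assume f: "f \<in> B0 (4 + \<epsilon>)" "B0_norm (4 + \<epsilon>) f \<le> \<nu> / 2 powr q"
      and s1: "\<forall>x1 x2.
      f (pt x1 x2) $ 1 = f (pt x1 (- x2)) $ 1 \<and>
      f (pt x1 x2) $ 1 = - (f (pt (- x1) x2) $ 1) \<and>
      f (pt x1 x2) $ 2 = - (f (pt x1 (- x2)) $ 2) \<and>
      f (pt x1 x2) $ 2 = f (pt (- x1) x2) $ 2"
      and s2: "\<forall>x1 x2.
      f (pt x1 x2) $ 1 = f (pt x2 x1) $ 2 \<and>
      f (pt x1 x2) $ 1 = - (f (pt (- x2) (- x1)) $ 2) \<and>
      f (pt x1 x2) $ 2 = f (pt x2 x1) $ 1 \<and>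
      f (pt x1 x2) $ 2 = - (f (pt (- x2) (- x1)) $ 1)"
    define g where "g z = toC (f (toP z))" for z
    have g: "decaying q \<nu> g"
      using B0_decaying[of q f "\<nu> / 2 powr q"] f q unfolding g_def[abs_def] q_def by simp
    \<comment> \<open>The rotation by a right angle is a diagonal reflection followed by one in an axis.\<close>
    have rot: "f (pt (- y) x) $ 1 = - (f (pt x y) $ 2)" "f (pt (- y) x) $ 2 = f (pt x y) $ 1" for x y
      using s1[rule_format, of y x] s2[rule_format, of x y] by simp_all
    have refl: "f (pt x (- y)) $ 1 = f (pt x y) $ 1" "f (pt x (- y)) $ 2 = - (f (pt x y) $ 2)" for x y
      using s1[rule_format, of x y] by simp_all
    have "equivariant g"
      unfolding equivariant_def g_def toP_def by (auto simp: complex_eq_iff rot refl)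
    then obtain F A where F: "decaying q A F" "equivariant F" "\<And>z. F z = g z + convect F z"
      using \<nu>(2)[OF g] by blast
    have A: "0 \<le> A" by (rule decaying_nonneg[OF F(1)])
    define u where "u x = toP (velocity F (toC x))" for x
    define p where "p x = pressure F (toC x)" for x
    have sol: "navier_stokes_solution f u p"
      unfolding u_def[abs_def] p_def[abs_def]
      by (rule solution_of_fixed_point[OF q3 F(1)]) (use F(3) in \<open>simp add: g_def\<close>)
    have ub: "norm (norm (u x)) \<le> C * A * wt (- 2 - \<epsilon>) x" for x
      using C(2)[OF F(1,2), of "toC x"] by (simp add: u_def q_def)
    have pb: "norm (p x) \<le> 2 * norm stokes_const * (C * A) * wt (- 3 - \<epsilon>) x" for x
    proof -
      have "norm (p x) \<le> norm (2 * stokes_const * conv ker_z F (toC x))"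
        unfolding p_def pressure_def using abs_Re_le_cmod[of "2 * stokes_const * conv ker_z F (toC x)"] by simp
      also have "\<dots> = 2 * norm stokes_const * norm (conv ker_z F (toC x))" by (simp add: norm_mult)
      also have "\<dots> \<le> 2 * norm stokes_const * (C * A * wt (1 - q) (toC x))"
        using C(2)[OF F(1,2), of "toC x"] by (intro mult_left_mono) auto
      finally show ?thesis by (simp add: q_def mult.assoc)
    qed
    have "((\<lambda>x. norm (u x)) \<longlongrightarrow> 0) at_infinity"
      using decay_bigo(2)[OF ub] C(1) A assms by simp
    then have "(u \<longlongrightarrow> 0) at_infinity" by (rule tendsto_norm_zero_cancel)
    moreover have "(\<lambda>x. norm (u x)) \<in> O[at_infinity](\<lambda>x. norm x powr (- 2 - \<epsilon>))"
      using decay_bigo(1)[OF ub] C(1) A assms by simp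
    moreover have "p \<in> O[at_infinity](\<lambda>x. norm x powr (- 3 - \<epsilon>))"
      using decay_bigo(1)[OF pb] C(1) A assms by simp
    ultimately show "\<exists>u p. navier_stokes_solution f u p \<and>
          (u \<longlongrightarrow> 0) at_infinity \<and>
          (\<lambda>x. norm (u x)) \<in> O[at_infinity](\<lambda>x. norm x powr (- 2 - \<epsilon>)) \<and>
          p \<in> O[at_infinity](\<lambda>x. norm x powr (- 3 - \<epsilon>))"
      using sol by blast
  qed
qed

end
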